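(* $F^{(k)}$ can be computed in the bounded-error quantum query model with $O(k^5\log^2N\log k)$ queries. However, every randomized decision tree of depth $\tilde o(\sqrt N)$ computing $F^{(k)}$ has worst-case success probability at most $\frac12+\exp(-\Omega(k))$.
   Context: Let $n\in\mathbb{N}$, $N=2^n$ sufficiently large, $k\in\mathbb{N}$ with $k=o(N^{1/50})$, $\epsilon=\frac{1}{60k^2\ln N}$; asymptotics as $N\to\infty$. $H_N$ is the $N\times N$ matrix with $H_N(a,b)=N^{-1/2}(-1)^{\sum_i a_ib_i}$ for $a,b\in\{0,1\}^n$. For $z=(x,y)$, $x,y\in\mathbb{R}^N$, $forr(z)=\frac1N\langle x,H_Ny\rangle$. $F:\{-1,1\}^{2N}\to\{-1,1\}$ is the partial function with $F(z)=-1$ if $forr(z)\ge\epsilon/2$, $F(z)=1$ if $forr(z)\le\epsilon/4$, undefined otherwise; $F^{(k)}:\{-1,1\}^{2kN}\to\{-1,1\}$ is the partial function $F^{(k)}(z_1,\dots,z_k)=\prod_{j=1}^kF(z_j)$ (defined when all $F(z_j)$ are defined). Success probability refers to inputs in the domain of $F^{(k)}$.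
   Formalization: The factor log k in the quantum query bound is read as max(1, log_2 k), since for k = 1 the literal bound would be 0 queries, which is false; k ≥ 1 is assumed so that ε is defined. *)

theory Defs
  imports
    "HOL-Probability.Probability_Mass_Function"
    "HOL-Library.Landau_Symbols"
    "Jordan_Normal_Form.Schur_Decomposition"
begin

definition sign_cube :: "nat \<Rightarrow> real vec set" where
  "sign_cube M = {z \<in> carrier_vec M. \<forall>i<M. z $ i \<in> {-1, 1}}"

text \<open>A bit string \<open>a\<close> of length \<open>n\<close> is identified with the natural number \<open>a < 2 ^ n\<close> whose binary
  digits are \<open>bit a i\<close> for \<open>i < n\<close>.\<close>

definition hadamard :: "nat \<Rightarrow> real mat" where
  "hadamard n = mat (2 ^ n) (2 ^ n)
     (\<lambda>(a, b). (-1) ^ (\<Sum>i<n. of_bool (bit a i) * of_bool (bit b i)) / sqrt (2 ^ n))"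

text \<open>A vector of length \<open>2 * 2 ^ n\<close> is read as \<open>z = (x, y)\<close> with both halves of length \<open>2 ^ n\<close>.\<close>

definition forr :: "nat \<Rightarrow> real vec \<Rightarrow> real" where
  "forr n z = 1 / 2 ^ n * (vec_first z (2 ^ n) \<bullet> (hadamard n *\<^sub>v vec_last z (2 ^ n)))"

definition forr_eps :: "nat \<Rightarrow> nat \<Rightarrow> real" where
  "forr_eps n k = 1 / (60 * real k ^ 2 * ln (2 ^ n))"

definition forr_fun :: "nat \<Rightarrow> nat \<Rightarrow> real vec \<rightharpoonup> real" where
  "forr_fun n k z =
     (if z \<notin> sign_cube (2 * 2 ^ n) then None
      else if forr n z \<ge> forr_eps n k / 2 then Some (-1)
      else if forr n z \<le> forr_eps n k / 4 then Some 1
      else None)"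

text \<open>\<open>z = (z\<^sub>0, \<dots>, z\<^sub>k\<^sub>-\<^sub>1)\<close> is the concatenation of its \<open>k\<close> blocks of length \<open>L\<close>.\<close>

definition block :: "nat \<Rightarrow> real vec \<Rightarrow> nat \<Rightarrow> real vec" where
  "block L z j = vec L (\<lambda>i. z $ (j * L + i))"

definition xor_forr :: "nat \<Rightarrow> nat \<Rightarrow> real vec \<rightharpoonup> real" where
  "xor_forr n k z =
     (if z \<in> sign_cube (2 * k * 2 ^ n) \<and> (\<forall>j<k. block (2 * 2 ^ n) z j \<in> dom (forr_fun n k))
      then Some (\<Prod>j<k. the (forr_fun n k (block (2 * 2 ^ n) z j)))
      else None)"

text \<open>As the domain is nonempty, the infimum in the worst-case success probability below is a genuine minimum
  over a finite nonempty set.\<close>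

lemma dom_xor_forr_nonempty:
  "dom (xor_forr n k) \<noteq> {}"
proof -
  define N where "N = (2::nat) ^ n"
  define zz where "zz s L = vec L (\<lambda>i. if i mod (2 * N) < N then s else (1::real))" for s L
  have N0: "N > 0" by (simp add: N_def)
  have cube: "zz s L \<in> sign_cube L" if "s \<in> {-1, 1}" for s L
    using that by (auto simp: zz_def sign_cube_def)
  have first: "vec_first (zz s (2 * N)) N = s \<cdot>\<^sub>v vec N (\<lambda>_. 1)" for s
    by (rule eq_vecI) (use N0 in \<open>auto simp: zz_def vec_first_def\<close>)
  have last: "vec_last (zz s (2 * N)) N = vec N (\<lambda>_. 1)" for s
    by (rule eq_vecI) (use N0 in \<open>auto simp: zz_def vec_last_def\<close>)
  have "forr n (zz s (2 * N)) = s * (1 / 2 ^ n * (vec N (\<lambda>_. 1) \<bullet> (hadamard n *\<^sub>v vec N (\<lambda>_. 1))))" for s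
    unfolding forr_def using first[of s] last[of s]
    by (simp add: N_def smult_scalar_prod_distrib[where n = "2 ^ n"] hadamard_def)
  then obtain s where s: "s \<in> {-1, 1}" "forr n (zz s (2 * N)) \<le> 0"
    by (metis insertI1 insert_iff linorder_linear mult_1 mult_minus1 neg_le_0_iff_le)
  have "forr_eps n k \<ge> 0" by (simp add: forr_eps_def)
  with s have le: "forr n (zz s (2 * N)) \<le> forr_eps n k / 4" by linarith
  have dF: "zz s (2 * N) \<in> dom (forr_fun n k)"
    using cube[OF s(1), of "2 * N"] le by (auto simp: forr_fun_def N_def dom_def)
  have blk: "block (2 * N) (zz s (2 * k * N)) j = zz s (2 * N)" if "j < k" for j
  proof (rule eq_vecI)
    fix i assume "i < dim_vec (zz s (2 * N))"
    then have i: "i < 2 * N" by (simp add: zz_def)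
    have "j * (2 * N) + i < (j + 1) * (2 * N)" using i by (simp add: algebra_simps)
    also have "\<dots> \<le> k * (2 * N)" using that by (intro mult_right_mono) auto
    finally have "j * (2 * N) + i < 2 * k * N" by (simp add: algebra_simps)
    then show "block (2 * N) (zz s (2 * k * N)) j $ i = zz s (2 * N) $ i"
      using i by (simp add: block_def zz_def)
  qed (simp add: block_def zz_def)
  have "xor_forr n k (zz s (2 * k * N)) \<noteq> None"
    unfolding xor_forr_def using cube[OF s(1), of "2 * k * N"] blk dF by (simp add: N_def)
  then show ?thesis by auto
qed

datatype dtree = Leaf real | Query nat dtree dtree

fun dtree_depth :: "dtree \<Rightarrow> nat" where
  "dtree_depth (Leaf s) = 0"
| "dtree_depth (Query i l r) = Suc (max (dtree_depth l) (dtree_depth r))"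

fun dtree_over :: "nat \<Rightarrow> dtree \<Rightarrow> bool" where
  "dtree_over M (Leaf s) \<longleftrightarrow> s \<in> {-1, 1}"
| "dtree_over M (Query i l r) \<longleftrightarrow> i < M \<and> dtree_over M l \<and> dtree_over M r"

fun dtree_eval :: "dtree \<Rightarrow> real vec \<Rightarrow> real" where
  "dtree_eval (Leaf s) z = s"
| "dtree_eval (Query i l r) z = (if z $ i = -1 then dtree_eval l z else dtree_eval r z)"

definition randomized_dtrees :: "nat \<Rightarrow> nat \<Rightarrow> dtree pmf set" where
  "randomized_dtrees M d = {R. \<forall>T \<in> set_pmf R. dtree_over M T \<and> dtree_depth T \<le> d}"

definition worst_case_success :: "(real vec \<rightharpoonup> real) \<Rightarrow> dtree pmf \<Rightarrow> real" where
  "worst_case_success f R =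
     (INF z \<in> dom f. measure_pmf.prob R {T. f z = Some (dtree_eval T z)})"

text \<open>The state space has the computational basis \<open>|i, b, w\<rangle>\<close> with query register \<open>i < M\<close>, answer
  bit \<open>b\<close> and workspace \<open>w < W\<close>. A query maps \<open>|i, b, w\<rangle>\<close> to \<open>|i, b \<oplus> [z\<^sub>i = -1], w\<rangle>\<close>.\<close>

definition basis_index :: "nat \<Rightarrow> nat \<Rightarrow> bool \<Rightarrow> nat \<Rightarrow> nat" where
  "basis_index W i b w = (2 * i + of_bool b) * W + w"

definition query_op :: "nat \<Rightarrow> nat \<Rightarrow> real vec \<Rightarrow> complex mat" where
  "query_op M W z = mat (2 * M * W) (2 * M * W)
     (\<lambda>(r, c). of_bool (\<exists>i<M. \<exists>b. \<exists>w<W.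
        c = basis_index W i b w \<and> r = basis_index W i (b \<noteq> (z $ i = -1)) w))"

definition unitary_mat :: "nat \<Rightarrow> complex mat \<Rightarrow> bool" where
  "unitary_mat D U \<longleftrightarrow> U \<in> carrier_mat D D \<and> mat_adjoint U * U = 1\<^sub>m D \<and> U * mat_adjoint U = 1\<^sub>m D"

definition final_state :: "nat \<Rightarrow> nat \<Rightarrow> complex mat \<Rightarrow> complex mat list \<Rightarrow> real vec \<Rightarrow> complex vec" where
  "final_state M W U Us z =
     foldl (\<lambda>\<psi> V. V *\<^sub>v (query_op M W z *\<^sub>v \<psi>)) (U *\<^sub>v unit_vec (2 * M * W) 0) Us"

definition output_prob :: "complex vec \<Rightarrow> (nat \<Rightarrow> real) \<Rightarrow> real \<Rightarrow> real" where
  "output_prob \<psi> out s = (\<Sum>r | r < dim_vec \<psi> \<and> out r = s. (cmod (\<psi> $ r))\<^sup>2)"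

text \<open>\<open>U, V\<^sub>1, \<dots>, V\<^sub>q\<close> are the input-independent unitaries of the algorithm, with one query before each
  \<open>V\<^sub>t\<close>; measuring the basis state \<open>r\<close> at the end produces the output \<open>out r\<close>.\<close>

definition bounded_error_quantum_computable :: "nat \<Rightarrow> (real vec \<rightharpoonup> real) \<Rightarrow> nat \<Rightarrow> bool" where
  "bounded_error_quantum_computable M f q \<longleftrightarrow>
     (\<exists>W U Us out. W > 0 \<and> unitary_mat (2 * M * W) U \<and> (\<forall>V \<in> set Us. unitary_mat (2 * M * W) V) \<and>
        length Us = q \<and> range out \<subseteq> {-1, 1} \<and>
        (\<forall>z \<in> dom f. output_prob (final_state M W U Us z) out (the (f z)) \<ge> 2 / 3))"

end

theory Submission
  imports Defs "HOL-Real_Asymp.Real_Asymp"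
begin

unbundle no vec_syntax

text \<open>
  Lower bound. The whole tree has no more queries than a single block is allowed, so an induction over
  the tree shows that its correlation with \<open>F\<^sup>(\<^sup>k\<^sup>)\<close> under a product distribution is at most the \<open>k\<close>-th power of
  the best correlation on one block; it suffices to bound the latter by a constant below \<open>1\<close>. On one
  block, uniform inputs (where the forrelation is about \<open>N\<^sup>-\<^sup>1\<^sup>/\<^sup>2\<close>) are compared with independent signs of
  means \<open>(X, H\<^sup>T X)\<close>, where \<open>X\<close> is the end point of a random walk of tiny steps \<open>\<eta> u\<close>, \<open>u\<close> uniform
  in \<open>{-1, 1}\<^sup>N\<close>, with total variance \<open>\<delta> = 1 / (32 ln N)\<close> and stopped when a mean exceeds \<open>1/2\<close>. The
  forrelation of the means is \<open>|X|\<^sup>2 / N\<close>, and its first two moments give a constant probability of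
  being at least \<open>\<epsilon> / 2\<close>. One step changes the acceptance probability of a tree, up to \<open>O(\<eta>\<^sup>3)\<close>, by at
  most \<open>\<eta>\<^sup>2 E |Q|\<close>, where \<open>Q\<close> is the bilinear form \<open>\<Sum> H\<^sub>i\<^sub>j \<phi>\<^sub>i \<phi>\<^sub>N\<^sub>+\<^sub>j\<close> in the centred queried
  coordinates; \<open>Q\<close> is a martingale along the tree, and \<open>E Q\<^sup>2 = O(d\<^sup>2 log\<^sup>2 N / N)\<close>.

  Upper bound. One query to the uniform superposition over a block followed by a fixed unitary accepts
  with probability \<open>(1 + forr) / 2\<close>. Each block is tested \<open>O(log k / \<epsilon>\<^sup>2)\<close> times, with the measurements
  deferred by pushing every used query register onto a stack, and the counts are compared with a
  threshold.
\<close>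

section \<open>Product measures on the cube\<close>

text \<open>The scale \<delta> is squeezed from two sides. All 2 N means must stay below 1/2
  simultaneously, and the union bound over them forces \<delta> down by a factor
  \<open>ln N\<close>; on the other side \<delta> has to dominate \<epsilon> / 2, which has the same
  logarithm in its denominator. That logarithm also cancels the one in E |Q|, so that the whole walk
  moves the expected output of a tree by O(d / sqrt N) and no power of \<open>log N\<close> is lost
  in the depth.

  A walk replaces one large jump because its steps can be shrunk at fixed total variance: the
  constant in the cubic error is exponential in N, yet the sum of these errors vanishes with \<eta>,
  so only the second-order coefficient has to be understood. The price is a bound at every vector of
  means that the walk visits; stopping confines the live ones to [-1/2, 1/2], where the scores are
  at most 2.

  The random inputs may miss the domain of F. Conditioning puts them there, but the biased side
  survives only with constant probability, so the correlation on one block is bounded by a constant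
  below 1 and not by o(1). The power k then gives the exponential decay.\<close>

definition cube_expect :: "nat \<Rightarrow> (nat \<Rightarrow> real) \<Rightarrow> (real vec \<Rightarrow> real) \<Rightarrow> real" where
  "cube_expect M v g = (\<Sum>z\<in>sign_cube M. (\<Prod>i<M. (1 + z $ i * v i) / 2) * g z)"

lemma sign_cube_cases: "z \<in> sign_cube M \<Longrightarrow> i < M \<Longrightarrow> z $ i = -1 \<or> z $ i = 1"
  unfolding sign_cube_def by blast

lemma sign_cubeI: "dim_vec z = M \<Longrightarrow> (\<And>i. i < M \<Longrightarrow> z $ i = -1 \<or> z $ i = 1) \<Longrightarrow> z \<in> sign_cube M"
  unfolding sign_cube_def carrier_vec_def by blast

lemma dim_sign_cube: "z \<in> sign_cube M \<Longrightarrow> dim_vec z = M"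
  unfolding sign_cube_def carrier_vec_def by blast

lemma sign_cube_append_bij:
  "bij_betw (\<lambda>(x, y). x @\<^sub>v y) (sign_cube a \<times> sign_cube b) (sign_cube (a + b))"
proof (rule bij_betw_byWitness[where f' = "\<lambda>z. (vec_first z a, vec_last z b)"])
  have "vec_first (x @\<^sub>v y) a = x" "vec_last (x @\<^sub>v y) b = y" if "dim_vec x = a" "dim_vec y = b" for x y :: "real vec"
    using that by (auto simp: vec_first_def vec_last_def intro!: eq_vecI)
  then show "\<forall>p\<in>sign_cube a \<times> sign_cube b. (vec_first (case p of (x, y) \<Rightarrow> x @\<^sub>v y) a, vec_last (case p of (x, y) \<Rightarrow> x @\<^sub>v y) b) = p"
    using dim_sign_cube by auto
  show "\<forall>z\<in>sign_cube (a + b). (case (vec_first z a, vec_last z b) of (x, y) \<Rightarrow> x @\<^sub>v y) = z"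
    by (simp add: sign_cube_def)
  have "x @\<^sub>v y \<in> sign_cube (a + b)" if "x \<in> sign_cube a" "y \<in> sign_cube b" for x y
  proof (rule sign_cubeI)
    fix i assume "i < a + b"
    then show "(x @\<^sub>v y) $ i = -1 \<or> (x @\<^sub>v y) $ i = 1"
      using sign_cube_cases[OF that(1), of i] sign_cube_cases[OF that(2), of "i - a"]
        dim_sign_cube[OF that(1)] dim_sign_cube[OF that(2)] by (cases "i < a") simp_all
  qed (use dim_sign_cube[OF that(1)] dim_sign_cube[OF that(2)] in simp)
  then show "(\<lambda>(x, y). x @\<^sub>v y) ` (sign_cube a \<times> sign_cube b) \<subseteq> sign_cube (a + b)"
    by auto
  have "vec_first z a \<in> sign_cube a" "vec_last z b \<in> sign_cube b" if "z \<in> sign_cube (a + b)" for z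
    using dim_sign_cube[OF that]
    by (intro sign_cubeI; simp add: vec_first_def vec_last_def sign_cube_cases[OF that] trans_less_add1)+
  then show "(\<lambda>z. (vec_first z a, vec_last z b)) ` sign_cube (a + b) \<subseteq> sign_cube a \<times> sign_cube b"
    by auto
qed

lemma sign_cube_0: "sign_cube 0 = {vec 0 (\<lambda>_. 0)}"
  by (auto simp: sign_cube_def)

lemma sign_cube_1: "sign_cube 1 = {vec 1 (\<lambda>_. -1), vec 1 (\<lambda>_. 1)}"
  by (auto simp: sign_cube_def)

lemma finite_sign_cube [simp]: "finite (sign_cube M)"
proof (induction M)
  case 0
  then show ?case by (simp add: sign_cube_0)
next
  case (Suc M)
  have "finite (sign_cube M \<times> sign_cube 1)" using Suc by (simp add: sign_cube_1 del: One_nat_def)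
  then show ?case using bij_betw_finite[OF sign_cube_append_bij[of M 1]] by simp
qed

text \<open>Fubini for the cube as a product of k cubes, peeling off the last block. Blocks of
  length 1 give the product formula for expectations; blocks of the length of a forrelation instance
  factor the XOR correlation at a leaf.\<close>

lemma sum_prod_blocks:
  fixes g :: "nat \<Rightarrow> real vec \<Rightarrow> real"
  shows "(\<Sum>z\<in>sign_cube (k * L). \<Prod>j<k. g j (block L z j)) = (\<Prod>j<k. \<Sum>y\<in>sign_cube L. g j y)"
proof (induction k)
  case 0
  then show ?case by (simp add: sign_cube_0)
next
  case (Suc k)
  have blk: "block L (x @\<^sub>v y) j = (if j < k then block L x j else y)"
    if "x \<in> sign_cube (k * L)" "y \<in> sign_cube L" "j \<le> k" for x y j
  proof -
    have "j * L + i < k * L" if "j < k" "i < L" for i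
    proof -
      have "j * L + i < Suc j * L" using that by simp
      also have "\<dots> \<le> k * L" using that by (intro mult_right_mono) auto
      finally show ?thesis .
    qed
    moreover have "dim_vec x = k * L" "dim_vec y = L" using that by (auto simp: sign_cube_def)
    ultimately show ?thesis using that(3)
      by (intro eq_vecI) (auto simp: block_def trans_less_add1)
  qed
  have "(\<Sum>z\<in>sign_cube (Suc k * L). \<Prod>j<Suc k. g j (block L z j))
      = (\<Sum>z\<in>sign_cube (k * L + L). \<Prod>j<Suc k. g j (block L z j))" by (simp add: add.commute)
  also have "\<dots> = (\<Sum>p\<in>sign_cube (k * L) \<times> sign_cube L.
      \<Prod>j<Suc k. g j (block L (case p of (x, y) \<Rightarrow> x @\<^sub>v y) j))"
    by (rule sum.reindex_bij_betw[OF sign_cube_append_bij, symmetric])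
  also have "\<dots> = (\<Sum>(x, y)\<in>sign_cube (k * L) \<times> sign_cube L. (\<Prod>j<k. g j (block L x j)) * g k y)"
    by (intro sum.cong refl) (auto simp: blk intro!: prod.cong)
  also have "\<dots> = (\<Sum>x\<in>sign_cube (k * L). \<Prod>j<k. g j (block L x j)) * (\<Sum>y\<in>sign_cube L. g k y)"
    by (simp add: sum.cartesian_product[symmetric] sum_product)
  finally show ?case using Suc by simp
qed

lemma cube_expect_prod:
  "cube_expect M v (\<lambda>z. \<Prod>i<M. g i (z $ i))
     = (\<Prod>i<M. (1 + v i) / 2 * g i 1 + (1 - v i) / 2 * g i (-1))"
proof -
  have "cube_expect M v (\<lambda>z. \<Prod>i<M. g i (z $ i))
      = (\<Sum>z\<in>sign_cube (M * 1). \<Prod>i<M. (1 + block 1 z i $ 0 * v i) / 2 * g i (block 1 z i $ 0))"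
    by (simp add: cube_expect_def block_def prod.distrib[symmetric])
  also have "\<dots> = (\<Prod>i<M. \<Sum>y\<in>sign_cube 1. (1 + y $ 0 * v i) / 2 * g i (y $ 0))"
    by (rule sum_prod_blocks)
  also have "\<dots> = (\<Prod>i<M. (1 + v i) / 2 * g i 1 + (1 - v i) / 2 * g i (-1))"
  proof (rule prod.cong[OF refl])
    fix i
    have "vec 1 (\<lambda>_. -1::real) \<noteq> vec 1 (\<lambda>_. 1)"
    proof
      assume "vec 1 (\<lambda>_. -1::real) = vec 1 (\<lambda>_. 1)"
      then have "vec 1 (\<lambda>_. -1::real) $ 0 = vec 1 (\<lambda>_. 1) $ 0" by (rule arg_cong)
      then show False by simp
    qed
    then show "(\<Sum>y\<in>sign_cube 1. (1 + y $ 0 * v i) / 2 * g i (y $ 0))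
      = (1 + v i) / 2 * g i 1 + (1 - v i) / 2 * g i (-1)"
      unfolding sign_cube_1 by simp
  qed
  finally show ?thesis .
qed

lemma cube_expect_const: "cube_expect M v (\<lambda>_. c) = c"
proof -
  have "cube_expect M v (\<lambda>z. \<Prod>i<M. (\<lambda>_ _. 1) i (z $ i)) = 1"
    by (subst cube_expect_prod) (simp add: field_simps)
  then have "cube_expect M v (\<lambda>_. 1) = 1" by simp
  then show ?thesis by (simp add: cube_expect_def sum_distrib_right[symmetric])
qed

lemma cube_expect_add: "cube_expect M v (\<lambda>z. f z + g z) = cube_expect M v f + cube_expect M v g"
  by (simp add: cube_expect_def distrib_left sum.distrib)

lemma cube_expect_diff: "cube_expect M v (\<lambda>z. f z - g z) = cube_expect M v f - cube_expect M v g"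
  by (simp add: cube_expect_def right_diff_distrib sum_subtractf)

lemma cube_expect_cmult: "cube_expect M v (\<lambda>z. c * f z) = c * cube_expect M v f"
  by (simp add: cube_expect_def sum_distrib_left mult_ac)

lemma cube_expect_sum: "cube_expect M v (\<lambda>z. \<Sum>i\<in>I. f i z) = (\<Sum>i\<in>I. cube_expect M v (f i))"
  unfolding cube_expect_def sum_distrib_left by (rule sum.swap)

lemma cube_expect_cong:
  "(\<And>z. z \<in> sign_cube M \<Longrightarrow> f z = g z) \<Longrightarrow> cube_expect M v f = cube_expect M v g"
  by (simp add: cube_expect_def)

lemma cube_weight_nonneg:
  fixes z :: "real vec"
  assumes "z \<in> sign_cube M" "\<And>i. i < M \<Longrightarrow> \<bar>v i\<bar> \<le> 1"
  shows "(\<Prod>i<M. (1 + z $ i * v i) / 2) \<ge> 0"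
proof (rule prod_nonneg)
  fix i assume "i \<in> {..<M}"
  then have "z $ i = -1 \<or> z $ i = 1" "\<bar>v i\<bar> \<le> 1"
    using assms sign_cube_cases by auto
  then show "(1 + z $ i * v i) / 2 \<ge> 0" by auto
qed

lemma cube_expect_mono:
  assumes "\<And>i. i < M \<Longrightarrow> \<bar>v i\<bar> \<le> 1" "\<And>z. z \<in> sign_cube M \<Longrightarrow> f z \<le> g z"
  shows "cube_expect M v f \<le> cube_expect M v g"
  unfolding cube_expect_def
  by (intro sum_mono mult_left_mono cube_weight_nonneg) (use assms in auto)

definition flip_coord :: "nat \<Rightarrow> real vec \<Rightarrow> real vec" where
  "flip_coord i z = vec (dim_vec z) (\<lambda>j. if j = i then - z $ j else z $ j)"

text \<open>Independence of coordinate i from a function that ignores it, where ignoring is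
  expressed as invariance under \<open>flip_coord\<close>. The points z and
  \<open>flip_coord i z\<close> have weights proportional to \<open>1 + z $ i * v i\<close> and
  \<open>1 - z $ i * v i\<close>, so summing over such pairs replaces \<open>z $ i\<close> by
  \<open>v i\<close>. Every pair is counted twice, hence the \<open>A + A\<close> and
  \<open>B + B\<close>.\<close>

lemma cube_expect_coord:
  assumes i: "i < M" and g: "\<And>z. z \<in> sign_cube M \<Longrightarrow> g (flip_coord i z) = g z"
  shows "cube_expect M v (\<lambda>z. z $ i * g z) = v i * cube_expect M v g"
proof -
  define P where "P z = (\<Prod>j<M. (1 + z $ j * v j) / 2)" for z :: "real vec"
  define R where "R z = (\<Prod>j\<in>{..<M}-{i}. (1 + z $ j * v j) / 2)" for z :: "real vec"
  have PR: "P z = (1 + z $ i * v i) / 2 * R z" for z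
    unfolding P_def R_def by (rule prod.remove) (use i in auto)
  have flip: "flip_coord i z $ j = (if j = i then - z $ j else z $ j)" "flip_coord i z \<in> sign_cube M"
    if "z \<in> sign_cube M" "j < M" for z j
  proof -
    have f: "flip_coord i z $ l = (if l = i then - z $ l else z $ l)" if "l < M" for l
      using that dim_sign_cube[OF \<open>z \<in> sign_cube M\<close>] by (simp add: flip_coord_def)
    then show "flip_coord i z $ j = (if j = i then - z $ j else z $ j)" using that by blast
    show "flip_coord i z \<in> sign_cube M"
    proof (rule sign_cubeI)
      show "flip_coord i z $ l = -1 \<or> flip_coord i z $ l = 1" if "l < M" for l
        using sign_cube_cases[OF \<open>z \<in> sign_cube M\<close> that] f[OF that] by auto
    qed (use dim_sign_cube[OF \<open>z \<in> sign_cube M\<close>] in \<open>simp add: flip_coord_def\<close>)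
  qed
  have R: "R (flip_coord i z) = R z" if "z \<in> sign_cube M" for z
    unfolding R_def using flip(1)[OF that] by (intro prod.cong) auto
  have bij: "bij_betw (flip_coord i) (sign_cube M) (sign_cube M)"
  proof (rule bij_betw_byWitness[where f' = "flip_coord i"])
    show "\<forall>z\<in>sign_cube M. flip_coord i (flip_coord i z) = z" by (auto simp: flip_coord_def)
    then show "\<forall>z\<in>sign_cube M. flip_coord i (flip_coord i z) = z" .
  qed (use flip(2)[OF _ i] in \<open>auto simp: image_subset_iff\<close>)
  have re: "(\<Sum>z\<in>sign_cube M. h (flip_coord i z)) = (\<Sum>z\<in>sign_cube M. h z)" for h :: "real vec \<Rightarrow> real"
    by (rule sum.reindex_bij_betw[OF bij])
  have key: "P z * (z $ i * g z) + P (flip_coord i z) * (flip_coord i z $ i * g (flip_coord i z))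
      = v i * (P z * g z + P (flip_coord i z) * g (flip_coord i z))" if z: "z \<in> sign_cube M" for z
  proof -
    have P': "P (flip_coord i z) = (1 - z $ i * v i) / 2 * R z"
      unfolding PR[of "flip_coord i z"] R[OF z] using flip(1)[OF z i] by simp
    have alg: "(1 + a * b) / 2 * r * (a * c) + (1 - a * b) / 2 * r * (- a * c)
      = b * ((1 + a * b) / 2 * r * c + (1 - a * b) / 2 * r * c)" if "a = -1 \<or> a = 1" for a b c r :: real
      using that by (elim disjE) (simp_all add: field_simps)
    have f: "flip_coord i z $ i = - z $ i" using flip(1)[OF z i] by simp
    show ?thesis
      unfolding P' f g[OF z] PR[of z] by (rule alg[OF sign_cube_cases[OF z i]])
  qed
  define A where "A = (\<Sum>z\<in>sign_cube M. P z * (z $ i * g z))"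
  define B where "B = (\<Sum>z\<in>sign_cube M. P z * g z)"
  have A': "A = (\<Sum>z\<in>sign_cube M. P (flip_coord i z) * (flip_coord i z $ i * g (flip_coord i z)))"
    unfolding A_def re[of "\<lambda>z. P z * (z $ i * g z)"] ..
  have B': "B = (\<Sum>z\<in>sign_cube M. P (flip_coord i z) * g (flip_coord i z))"
    unfolding B_def re[of "\<lambda>z. P z * g z"] ..
  have "(\<Sum>z\<in>sign_cube M. P z * (z $ i * g z)
      + P (flip_coord i z) * (flip_coord i z $ i * g (flip_coord i z))) = A + A"
    by (simp only: sum.distrib A'[symmetric] A_def[symmetric])
  moreover have "(\<Sum>z\<in>sign_cube M. v i * (P z * g z + P (flip_coord i z) * g (flip_coord i z))) = v i * (B + B)"
    by (simp only: sum_distrib_left[symmetric] sum.distrib B'[symmetric] B_def[symmetric])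
  ultimately have "A = v i * B" using key by simp
  then show ?thesis unfolding A_def B_def P_def cube_expect_def .
qed

section \<open>Decision trees under product measures\<close>

fun dtree_vars :: "dtree \<Rightarrow> nat set" where
  "dtree_vars (Leaf s) = {}"
| "dtree_vars (Query i l r) = insert i (dtree_vars l \<union> dtree_vars r)"

fun read_once :: "dtree \<Rightarrow> bool" where
  "read_once (Leaf s) \<longleftrightarrow> True"
| "read_once (Query i l r) \<longleftrightarrow> i \<notin> dtree_vars l \<union> dtree_vars r \<and> read_once l \<and> read_once r"

fun fix_query :: "nat \<Rightarrow> bool \<Rightarrow> dtree \<Rightarrow> dtree" where
  "fix_query i b (Leaf s) = Leaf s"
| "fix_query i b (Query j l r) =
     (if j = i then (if b then fix_query i b l else fix_query i b r)
      else Query j (fix_query i b l) (fix_query i b r))"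

lemma dtree_depth_fix_query: "dtree_depth (fix_query i b T) \<le> dtree_depth T"
  by (induction T) auto

lemma dtree_vars_fix_query: "dtree_vars (fix_query i b T) \<subseteq> dtree_vars T - {i}"
  by (induction T) auto

lemma dtree_over_fix_query: "dtree_over M T \<Longrightarrow> dtree_over M (fix_query i b T)"
  by (induction T) auto

lemma dtree_eval_fix_query: "b \<longleftrightarrow> z $ i = -1 \<Longrightarrow> dtree_eval (fix_query i b T) z = dtree_eval T z"
  by (induction T) auto

text \<open>A repeated query has a known answer, so both subtrees of the root are specialised by
  \<open>fix_query\<close> and then treated recursively. The induction runs over the depth bound
  because the specialised subtrees are not subterms. Freshness of every queried coordinate is what
  makes \<open>dtree_ext\<close> an expectation and what the updates of the scores rely on.\<close>

lemma read_once_exists: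
  assumes "dtree_over M T" "dtree_depth T \<le> d"
  shows "\<exists>T'. read_once T' \<and> dtree_over M T' \<and> dtree_depth T' \<le> d \<and> dtree_vars T' \<subseteq> dtree_vars T
    \<and> (\<forall>z. dtree_eval T' z = dtree_eval T z)"
  using assms
proof (induction d arbitrary: T)
  case 0
  then show ?case by (cases T) (auto intro!: exI[of _ T])
next
  case (Suc d)
  show ?case
  proof (cases T)
    case (Leaf s)
    then show ?thesis using Suc.prems by (intro exI[of _ T]) auto
  next
    case (Query i l r)
    have "\<exists>T'. read_once T' \<and> dtree_over M T' \<and> dtree_depth T' \<le> d \<and> dtree_vars T' \<subseteq> dtree_vars (fix_query i b t)
        \<and> (\<forall>z. dtree_eval T' z = dtree_eval (fix_query i b t) z)" if "t = l \<or> t = r" for b t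
    proof (rule Suc.IH)
      show "dtree_over M (fix_query i b t)" using that Suc.prems Query by (auto intro: dtree_over_fix_query)
      show "dtree_depth (fix_query i b t) \<le> d"
        using that Suc.prems Query dtree_depth_fix_query[of i b t] by auto
    qed
    then obtain l' r' where
      l': "read_once l'" "dtree_over M l'" "dtree_depth l' \<le> d" "dtree_vars l' \<subseteq> dtree_vars (fix_query i True l)"
        "\<And>z. dtree_eval l' z = dtree_eval (fix_query i True l) z" and
      r': "read_once r'" "dtree_over M r'" "dtree_depth r' \<le> d" "dtree_vars r' \<subseteq> dtree_vars (fix_query i False r)"
        "\<And>z. dtree_eval r' z = dtree_eval (fix_query i False r) z" by metis
    show ?thesis
      using Suc.prems Query l' r' dtree_vars_fix_query[of i True l] dtree_vars_fix_query[of i False r]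
      by (intro exI[of _ "Query i l' r'"]) (auto simp: dtree_eval_fix_query)
  qed
qed

lemma dtree_eval_bounds: "dtree_over M T \<Longrightarrow> dtree_eval T z \<in> {-1, 1}"
  by (induction T) auto

lemma dtree_eval_flip:
  assumes "i \<notin> dtree_vars T" "dtree_over M T" "dim_vec z = M"
  shows "dtree_eval T (flip_coord i z) = dtree_eval T z"
  using assms by (induction T) (auto simp: flip_coord_def)

text \<open>This is the multilinear extension of \<open>dtree_eval\<close> only for read-once trees.\<close>

fun dtree_ext :: "dtree \<Rightarrow> (nat \<Rightarrow> real) \<Rightarrow> real" where
  "dtree_ext (Leaf s) v = s"
| "dtree_ext (Query i l r) v = (1 - v i) / 2 * dtree_ext l v + (1 + v i) / 2 * dtree_ext r v"

lemma cube_expect_dtree: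
  assumes "read_once T" "dtree_over M T"
  shows "cube_expect M v (dtree_eval T) = dtree_ext T v"
  using assms
proof (induction T)
  case (Leaf s)
  have "dtree_eval (Leaf s) = (\<lambda>_. s)" by (rule ext) simp
  then show ?case by (simp add: cube_expect_const)
next
  case (Query i l r)
  have inv: "dtree_eval r (flip_coord i z) - dtree_eval l (flip_coord i z) = dtree_eval r z - dtree_eval l z"
    if "z \<in> sign_cube M" for z
    using that Query.prems by (auto simp: sign_cube_def dtree_eval_flip)
  have "cube_expect M v (dtree_eval (Query i l r)) =
    cube_expect M v (\<lambda>z. 1/2 * ((dtree_eval l z + dtree_eval r z) + z $ i * (dtree_eval r z - dtree_eval l z)))"
  proof (rule cube_expect_cong)
    fix z assume "z \<in> sign_cube M"
    then have "z $ i = -1 \<or> z $ i = 1" using Query.prems by (simp add: sign_cube_cases)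
    then show "dtree_eval (Query i l r) z =
      1/2 * ((dtree_eval l z + dtree_eval r z) + z $ i * (dtree_eval r z - dtree_eval l z))"
      by auto
  qed
  also have "\<dots> = 1/2 * ((dtree_ext l v + dtree_ext r v) + v i * (dtree_ext r v - dtree_ext l v))"
    using Query by (simp only: cube_expect_cmult cube_expect_add)
      (simp add: cube_expect_coord[where g = "\<lambda>z. dtree_eval r z - dtree_eval l z", OF _ inv] cube_expect_diff)
  also have "\<dots> = dtree_ext (Query i l r) v" by (simp add: field_simps)
  finally show ?case .
qed

text \<open>\<open>\<phi>\<close> records the score \<open>(z\<^sub>i - v\<^sub>i) / (1 - v\<^sub>i\<^sup>2) = z\<^sub>i / (1 + z\<^sub>i v\<^sub>i)\<close> of every queried
  coordinate and is \<open>0\<close> elsewhere; \<open>G\<close> is evaluated at the leaf that is reached under the product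
  measure with means \<open>v\<close>.\<close>

fun leaf_expect :: "(nat \<Rightarrow> real) \<Rightarrow> (nat \<Rightarrow> real) \<Rightarrow> dtree \<Rightarrow> ((nat \<Rightarrow> real) \<Rightarrow> real \<Rightarrow> real) \<Rightarrow> real" where
  "leaf_expect v \<phi> (Leaf s) G = G \<phi> s"
| "leaf_expect v \<phi> (Query i l r) G =
     (1 - v i) / 2 * leaf_expect v (\<phi>(i := - 1 / (1 - v i))) l G
   + (1 + v i) / 2 * leaf_expect v (\<phi>(i := 1 / (1 + v i))) r G"

lemma prod_fun_upd_fresh:
  fixes w \<phi> :: "nat \<Rightarrow> real"
  assumes "i < M" "\<phi> i = 0"
  shows "(\<Prod>j<M. 1 + w j * (\<phi>(i := a)) j) = (1 + w i * a) * (\<Prod>j<M. 1 + w j * \<phi> j)"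
proof -
  have "(\<Prod>j<M. 1 + w j * (\<phi>(i := a)) j) = (1 + w i * a) * (\<Prod>j\<in>{..<M}-{i}. 1 + w j * (\<phi>(i := a)) j)"
    by (subst prod.remove[of _ i]) (use assms in auto)
  also have "(\<Prod>j\<in>{..<M}-{i}. 1 + w j * (\<phi>(i := a)) j) = (\<Prod>j\<in>{..<M}-{i}. 1 + w j * \<phi> j)"
    by (intro prod.cong) auto
  also have "\<dots> = (\<Prod>j<M. 1 + w j * \<phi> j)"
    by (subst prod.remove[of "{..<M}" i]) (use assms in auto)
  finally show ?thesis .
qed

text \<open>A change of measure. Since
  \<open>1 + z * (v + w) = (1 + z * v) * (1 + w * (z / (1 + z * v)))\<close> for a sign z, the
  likelihood ratio at a leaf between the means v + w and v is the product of
  \<open>1 + w i * \<phi> i\<close> over the queried coordinates. An arbitrary initial \<phi> is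
  carried along for the induction.\<close>

lemma dtree_ext_shift:
  assumes "read_once T" "dtree_over M T" "\<And>i. i < M \<Longrightarrow> \<bar>v i\<bar> < 1" "\<And>i. i \<in> dtree_vars T \<Longrightarrow> \<phi> i = 0"
  shows "dtree_ext T (\<lambda>i. v i + w i) * (\<Prod>i<M. 1 + w i * \<phi> i)
    = leaf_expect v \<phi> T (\<lambda>\<psi> s. s * (\<Prod>i<M. 1 + w i * \<psi> i))"
  using assms
proof (induction T arbitrary: \<phi>)
  case (Leaf s)
  then show ?case by simp
next
  case (Query i l r)
  define P where "P = (\<Prod>i<M. 1 + w i * \<phi> i)"
  have i: "i < M" "\<phi> i = 0" "\<bar>v i\<bar> < 1" using Query.prems by auto
  have l: "leaf_expect v (\<phi>(i := - 1 / (1 - v i))) l (\<lambda>\<psi> s. s * (\<Prod>i<M. 1 + w i * \<psi> i))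
      = dtree_ext l (\<lambda>i. v i + w i) * ((1 + w i * (- 1 / (1 - v i))) * P)"
    unfolding P_def prod_fun_upd_fresh[of i M \<phi> w, OF i(1,2), symmetric]
    by (rule Query.IH(1)[symmetric]) (use Query.prems in auto)
  have r: "leaf_expect v (\<phi>(i := 1 / (1 + v i))) r (\<lambda>\<psi> s. s * (\<Prod>i<M. 1 + w i * \<psi> i))
      = dtree_ext r (\<lambda>i. v i + w i) * ((1 + w i * (1 / (1 + v i))) * P)"
    unfolding P_def prod_fun_upd_fresh[of i M \<phi> w, OF i(1,2), symmetric]
    by (rule Query.IH(2)[symmetric]) (use Query.prems in auto)
  have ne: "1 - v i \<noteq> 0" "1 + v i \<noteq> 0" using i(3) by linarith+
  have "(1 - v i) / 2 * (a * ((1 + w i * (- 1 / (1 - v i))) * P)) + (1 + v i) / 2 * (b * ((1 + w i * (1 / (1 + v i))) * P))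
    = ((1 - (v i + w i)) / 2 * a + (1 + (v i + w i)) / 2 * b) * P" for a b
  proof -
    have e: "(1 - v i) * (1 + w i * (- 1 / (1 - v i))) = 1 - (v i + w i)"
      "(1 + v i) * (1 + w i * (1 / (1 + v i))) = 1 + (v i + w i)" using ne by (simp_all add: field_simps)
    have "(1 - v i) / 2 * (a * ((1 + w i * (- 1 / (1 - v i))) * P)) + (1 + v i) / 2 * (b * ((1 + w i * (1 / (1 + v i))) * P))
      = ((1 - v i) * (1 + w i * (- 1 / (1 - v i)))) / 2 * a * P + ((1 + v i) * (1 + w i * (1 / (1 + v i)))) / 2 * b * P"
      by (simp only: times_divide_eq_left mult_ac)
    then show ?thesis unfolding e by (simp only: distrib_right)
  qed
  then show ?case unfolding leaf_expect.simps l r dtree_ext.simps P_def[symmetric] by simp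
qed

lemma leaf_expect_add:
  "leaf_expect v \<phi> T (\<lambda>\<psi> s. F \<psi> s + G \<psi> s) = leaf_expect v \<phi> T F + leaf_expect v \<phi> T G"
  by (induction T arbitrary: \<phi>) (auto simp: algebra_simps)

lemma leaf_expect_cmult: "leaf_expect v \<phi> T (\<lambda>\<psi> s. c * G \<psi> s) = c * leaf_expect v \<phi> T G"
  by (induction T arbitrary: \<phi>) (auto simp: algebra_simps)

lemma leaf_expect_const: "leaf_expect v \<phi> T (\<lambda>\<psi> s. c) = c"
  by (induction T arbitrary: \<phi>) (auto simp: field_simps)

lemma leaf_expect_cube:
  "cube_expect N u (\<lambda>x. leaf_expect v \<phi> T (G x)) = leaf_expect v \<phi> T (\<lambda>\<psi> s. cube_expect N u (\<lambda>x. G x \<psi> s))"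
  by (induction T arbitrary: \<phi>) (simp_all only: leaf_expect.simps cube_expect_add cube_expect_cmult)

text \<open>The comparison may assume \<open>\<bar>\<psi> i\<bar> \<le> 2\<close>, because means of
  modulus at most 1/2 keep both scores \<open>1 / (1 - v i)\<close> and \<open>1 / (1 + v i)\<close>
  at most 2.\<close>

lemma leaf_expect_mono:
  assumes "dtree_over M T" "\<And>i. i < M \<Longrightarrow> \<bar>v i\<bar> \<le> 1/2" "\<And>i. \<bar>\<phi> i\<bar> \<le> 2"
    and "\<And>\<psi> s. (\<And>i. \<bar>\<psi> i\<bar> \<le> 2) \<Longrightarrow> \<bar>s\<bar> = 1 \<Longrightarrow> F \<psi> s \<le> G \<psi> s"
  shows "leaf_expect v \<phi> T F \<le> leaf_expect v \<phi> T G"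
  using assms(1,3)
proof (induction T arbitrary: \<phi>)
  case (Leaf s)
  then show ?case using assms(4) by auto
next
  case (Query i l r)
  have v: "\<bar>v i\<bar> \<le> 1/2" using Query.prems assms(2) by auto
  then have "1 - v i \<ge> 1/2" "1 + v i \<ge> 1/2" by linarith+
  then have "\<bar>- 1 / (1 - v i)\<bar> \<le> 2" "\<bar>1 / (1 + v i)\<bar> \<le> 2" by (simp_all add: field_simps)
  then have "leaf_expect v (\<phi>(i := - 1 / (1 - v i))) l F \<le> leaf_expect v (\<phi>(i := - 1 / (1 - v i))) l G"
     "leaf_expect v (\<phi>(i := 1 / (1 + v i))) r F \<le> leaf_expect v (\<phi>(i := 1 / (1 + v i))) r G"
    using Query by (auto intro!: Query.IH)
  then show ?case unfolding leaf_expect.simps using v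
    by (intro add_mono mult_left_mono) auto
qed

section \<open>The bilinear form along a decision tree\<close>

lemma exp_le_quadratic:
  fixes y :: real
  assumes "\<bar>y\<bar> \<le> 1"
  shows "exp y \<le> 1 + y + y\<^sup>2"
proof (cases "y \<ge> 0")
  case True
  then show ?thesis using assms exp_bound[of y] by simp
next
  case False
  define t where "t = - y"
  have t: "t > 0" "t \<le> 1" using False assms by (auto simp: t_def)
  have q: "1 + t + t\<^sup>2 / 2 \<le> exp t" using t by (intro exp_lower_Taylor_quadratic) auto
  have pos: "1 - t + t\<^sup>2 \<ge> 0" using t by (simp add: power2_eq_square)
  have "(1 - t + t\<^sup>2) * (1 + t + t\<^sup>2 / 2) = 1 + (t\<^sup>2 + t ^ 3 + t ^ 4) / 2"
    by (simp add: field_simps power2_eq_square power3_eq_cube power4_eq_xxxx)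
  then have "1 \<le> (1 - t + t\<^sup>2) * (1 + t + t\<^sup>2 / 2)" using t by simp
  also have "\<dots> \<le> (1 - t + t\<^sup>2) * exp t" by (rule mult_left_mono[OF q pos])
  finally have "exp (- t) \<le> 1 - t + t\<^sup>2" by (simp add: exp_minus field_simps)
  then show ?thesis by (simp add: t_def)
qed

text \<open>The score of a sign with mean v has mean 0, so the linear term of the quadratic bound
  for exp cancels. Its second moment is \<open>(a + b) / 2\<close>, which is at most 2; the
  hypotheses keep the exponents in [-1, 1], where the quadratic bound is valid.\<close>

lemma biased_sign_mgf_le:
  fixes v s :: real
  assumes "\<bar>v\<bar> \<le> 1/2" "\<bar>s\<bar> \<le> 1/2"
  shows "(1 - v) / 2 * exp (s * (- 1 / (1 - v))) + (1 + v) / 2 * exp (s * (1 / (1 + v))) \<le> exp (2 * s\<^sup>2)"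
proof -
  have v: "1 - v \<ge> 1/2" "1 + v \<ge> 1/2" using assms(1) by linarith+
  define a where "a = 1 / (1 - v)"
  define b where "b = 1 / (1 + v)"
  have ab: "0 < a" "a \<le> 2" "0 < b" "b \<le> 2" "(1 - v) * a = 1" "(1 + v) * b = 1"
    using v by (auto simp: a_def b_def field_simps)
  have "\<bar>s * (- a)\<bar> \<le> 1/2 * 2" "\<bar>s * b\<bar> \<le> 1/2 * 2" unfolding abs_mult using ab assms(2)
    by (intro mult_mono; simp)+
  then have e: "exp (s * (- a)) \<le> 1 + s * (- a) + (s * (- a))\<^sup>2" "exp (s * b) \<le> 1 + s * b + (s * b)\<^sup>2"
    using exp_le_quadratic[of "s * (- a)"] exp_le_quadratic[of "s * b"] by auto
  have "(1 - v) / 2 * exp (s * (- a)) + (1 + v) / 2 * exp (s * b)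
     \<le> (1 - v) / 2 * (1 + s * (- a) + (s * (- a))\<^sup>2) + (1 + v) / 2 * (1 + s * b + (s * b)\<^sup>2)"
    using e v by (intro add_mono mult_left_mono) auto
  also have "\<dots> = 1 - s * ((1 - v) * a) / 2 + s * ((1 + v) * b) / 2 + s\<^sup>2 * (((1 - v) * a) * a + ((1 + v) * b) * b) / 2"
    by (simp add: field_simps power2_eq_square)
  also have "\<dots> = 1 + s\<^sup>2 * (a + b) / 2" unfolding ab by simp
  also have "\<dots> \<le> 1 + s\<^sup>2 * 4 / 2" using ab by (intro add_mono divide_right_mono mult_left_mono) auto
  also have "\<dots> \<le> exp (2 * s\<^sup>2)" using exp_ge_add_one_self[of "2 * s\<^sup>2"] by simp
  finally show ?thesis unfolding a_def b_def by simp
qed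

lemma biased_sign_cosh_le:
  fixes v s x :: real
  assumes "\<bar>v\<bar> \<le> 1/2" "\<bar>s\<bar> \<le> 1/2"
  shows "(1 - v) / 2 * cosh (x + s * (- 1 / (1 - v))) + (1 + v) / 2 * cosh (x + s * (1 / (1 + v)))
    \<le> exp (2 * s\<^sup>2) * cosh x"
proof -
  define E where "E t = (1 - v) / 2 * exp (t * (- 1 / (1 - v))) + (1 + v) / 2 * exp (t * (1 / (1 + v)))" for t
  have "(1 - v) / 2 * cosh (x + s * (- 1 / (1 - v))) + (1 + v) / 2 * cosh (x + s * (1 / (1 + v)))
    = exp x / 2 * E s + exp (- x) / 2 * E (- s)"
  proof -
    have c: "cosh (x + s * t) = (exp x * exp (s * t) + exp (- x) * exp (- s * t)) / 2" for t
      by (simp add: cosh_field_def flip: exp_add)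
    show ?thesis unfolding E_def c by (simp only: distrib_left add_divide_distrib times_divide_eq_right times_divide_eq_left mult_ac add_ac)
  qed
  also have "\<dots> \<le> exp x / 2 * exp (2 * s\<^sup>2) + exp (- x) / 2 * exp (2 * s\<^sup>2)"
    using biased_sign_mgf_le[OF assms] biased_sign_mgf_le[of v "- s"] assms
    by (intro add_mono mult_left_mono) (auto simp: E_def)
  also have "\<dots> = exp (2 * s\<^sup>2) * cosh x" by (simp add: cosh_field_def field_simps)
  finally show ?thesis .
qed

text \<open>A truncation at level K: what exceeds \<open>K\<^sup>2\<close> is paid for by cosh,
  damped by \<open>exp (- K)\<close>. Choosing K as the logarithm of the number of sums under
  control makes the damping cancel their number.\<close>

lemma square_le_cosh:
  fixes s K :: real
  assumes "K \<ge> 0"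
  shows "s\<^sup>2 \<le> K\<^sup>2 + (4 * K + 4) * exp (- K) * cosh s"
proof (cases "\<bar>s\<bar> \<le> K")
  case True
  then have "s\<^sup>2 \<le> K\<^sup>2" using abs_le_square_iff[of s K] assms by simp
  moreover have "0 \<le> (4 * K + 4) * exp (- K) * cosh s" using assms by simp
  ultimately show ?thesis by linarith
next
  case False
  define r where "r = \<bar>s\<bar> - K"
  have r: "r > 0" using False by (simp add: r_def)
  have "1 + r + r\<^sup>2 / 2 \<le> exp r" using r by (intro exp_lower_Taylor_quadratic) auto
  then have b: "r \<le> exp r" "r\<^sup>2 \<le> 2 * exp r" using r zero_le_power2[of r] by linarith+
  have "s\<^sup>2 = (K + r)\<^sup>2" by (simp add: r_def)
  also have "\<dots> = K\<^sup>2 + 2 * K * r + r\<^sup>2" by (simp add: power2_eq_square algebra_simps)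
  also have "\<dots> \<le> K\<^sup>2 + 2 * K * exp r + 2 * exp r"
    using b assms by (intro add_mono mult_left_mono) auto
  also have "\<dots> = K\<^sup>2 + (4 * K + 4) * exp (- K) * (exp \<bar>s\<bar> / 2)"
    by (simp add: r_def exp_diff exp_minus field_simps)
  also have "\<dots> \<le> K\<^sup>2 + (4 * K + 4) * exp (- K) * cosh s"
  proof -
    have "exp \<bar>s\<bar> / 2 \<le> cosh \<bar>s\<bar>" by (simp add: cosh_field_def)
    then show ?thesis using assms by (intro add_left_mono mult_left_mono) auto
  qed
  finally show ?thesis .
qed

text \<open>The remainder R obeys the recursion
  \<open>R' = R + \<eta> * a M * R + \<eta> ^ 3 * (a M * Q)\<close>, where Q is the second
  elementary symmetric sum. A constant that is exponential in M is acceptable because \<eta> is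
  chosen last.\<close>

lemma prod_second_order:
  fixes a :: "nat \<Rightarrow> real"
  assumes \<eta>: "0 \<le> \<eta>" "\<eta> \<le> 1" and a: "\<And>i. i < M \<Longrightarrow> \<bar>a i\<bar> \<le> b"
  shows "\<bar>(\<Prod>i<M. 1 + \<eta> * a i) - (1 + \<eta> * (\<Sum>i<M. a i) + \<eta>\<^sup>2 * (\<Sum>i<M. \<Sum>j<i. a i * a j))\<bar>
    \<le> \<eta> ^ 3 * (1 + 2 * b) ^ M"
  using a
proof (induction M)
  case 0
  then show ?case using \<eta> by simp
next
  case (Suc M)
  have b: "b \<ge> 0" using Suc.prems[of 0] by simp
  define B where "B = (1 + 2 * b) ^ M"
  have B: "B \<ge> 1" "B \<ge> 0" unfolding B_def using b by (simp_all add: one_le_power)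
  define P where "P = (\<Prod>i<M. 1 + \<eta> * a i)"
  define S where "S = (\<Sum>i<M. a i)"
  define Q where "Q = (\<Sum>i<M. \<Sum>j<i. a i * a j)"
  define R where "R = P - (1 + \<eta> * S + \<eta>\<^sup>2 * Q)"
  have R: "\<bar>R\<bar> \<le> \<eta> ^ 3 * B" using Suc unfolding R_def P_def S_def Q_def B_def by simp
  have le: "\<bar>\<Sum>i<K. a i\<bar> \<le> (1 + 2 * b) ^ K \<and> \<bar>\<Sum>i<K. \<Sum>j<i. a i * a j\<bar> \<le> (1 + 2 * b) ^ K" if "K \<le> M" for K
    using that
  proof (induction K)
    case 0
    then show ?case by simp
  next
    case (Suc K)
    define C where "C = (1 + 2 * b) ^ K"
    have C: "C \<ge> 1" unfolding C_def using b by (simp add: one_le_power)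
    have aK: "\<bar>a K\<bar> \<le> b" using Suc.prems \<open>\<And>i. i < Suc M \<Longrightarrow> \<bar>a i\<bar> \<le> b\<close> by simp
    have IH: "\<bar>\<Sum>i<K. a i\<bar> \<le> C" "\<bar>\<Sum>i<K. \<Sum>j<i. a i * a j\<bar> \<le> C" using Suc unfolding C_def by auto
    have bC: "b \<le> b * C" using mult_left_mono[OF C b] by simp
    have "\<bar>\<Sum>i<Suc K. a i\<bar> \<le> C + b" using IH(1) aK by simp
    also have "\<dots> \<le> C * (1 + 2 * b)" using bC b C by (simp add: algebra_simps)
    finally have 1: "\<bar>\<Sum>i<Suc K. a i\<bar> \<le> C * (1 + 2 * b)" .
    have "\<bar>a K * (\<Sum>j<K. a j)\<bar> \<le> b * C" unfolding abs_mult using aK IH(1) b by (intro mult_mono) auto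
    moreover have "(\<Sum>i<Suc K. \<Sum>j<i. a i * a j) = (\<Sum>i<K. \<Sum>j<i. a i * a j) + a K * (\<Sum>j<K. a j)"
      by (simp add: sum_distrib_left)
    ultimately have "\<bar>\<Sum>i<Suc K. \<Sum>j<i. a i * a j\<bar> \<le> C + b * C" using IH(2) by linarith
    also have "\<dots> \<le> C * (1 + 2 * b)" using b C by (simp add: algebra_simps)
    finally show ?case using 1 by (simp add: C_def mult_ac)
  qed
  then have Q: "\<bar>Q\<bar> \<le> B" unfolding Q_def B_def by simp
  have aM: "\<bar>a M\<bar> \<le> b" using Suc.prems by simp
  have "(\<Prod>i<Suc M. 1 + \<eta> * a i) - (1 + \<eta> * (\<Sum>i<Suc M. a i) + \<eta>\<^sup>2 * (\<Sum>i<Suc M. \<Sum>j<i. a i * a j))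
    = P * (1 + \<eta> * a M) - (1 + \<eta> * (S + a M) + \<eta>\<^sup>2 * (Q + a M * S))"
    by (simp add: P_def S_def Q_def sum_distrib_left)
  also have "\<dots> = R + \<eta> * a M * R + \<eta> ^ 3 * (a M * Q)"
    unfolding R_def by (simp add: algebra_simps power2_eq_square power3_eq_cube)
  finally have eq: "(\<Prod>i<Suc M. 1 + \<eta> * a i) - (1 + \<eta> * (\<Sum>i<Suc M. a i) + \<eta>\<^sup>2 * (\<Sum>i<Suc M. \<Sum>j<i. a i * a j))
    = R + \<eta> * a M * R + \<eta> ^ 3 * (a M * Q)" .
  have "\<bar>\<eta> * a M * R\<bar> \<le> b * (\<eta> ^ 3 * B)"
  proof -
    have "\<bar>\<eta> * a M\<bar> \<le> 1 * b" unfolding abs_mult using \<eta> aM b by (intro mult_mono) auto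
    then show ?thesis unfolding abs_mult[of "\<eta> * a M"] using R b by (intro mult_mono) auto
  qed
  moreover have "\<bar>\<eta> ^ 3 * (a M * Q)\<bar> \<le> \<eta> ^ 3 * (b * B)"
    unfolding abs_mult using aM Q b \<eta> by (intro mult_mono) auto
  ultimately have "\<bar>R + \<eta> * a M * R + \<eta> ^ 3 * (a M * Q)\<bar> \<le> \<eta> ^ 3 * B + b * (\<eta> ^ 3 * B) + \<eta> ^ 3 * (b * B)"
    using R by linarith
  also have "\<dots> = \<eta> ^ 3 * (1 + 2 * b) ^ Suc M" by (simp add: B_def algebra_simps)
  finally show ?case unfolding eq .
qed

section \<open>The bilinear form as a martingale\<close>

text \<open>These are the only properties of the Hadamard matrix that the arguments in this locale
  use. Flatness limits the effect of one query on the sums it enters; the two orthogonality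
  relations give the covariances and the Parseval identities.\<close>

locale flat_orthogonal =
  fixes N :: nat and H :: "nat \<Rightarrow> nat \<Rightarrow> real"
  assumes N_pos: "N > 0"
    and flat: "\<And>i j. i < N \<Longrightarrow> j < N \<Longrightarrow> \<bar>H i j\<bar> = 1 / sqrt (real N)"
    and row_orth: "\<And>i i'. i < N \<Longrightarrow> i' < N \<Longrightarrow> (\<Sum>j<N. H i j * H i' j) = of_bool (i = i')"
    and col_orth: "\<And>j j'. j < N \<Longrightarrow> j' < N \<Longrightarrow> (\<Sum>i<N. H i j * H i j') = of_bool (j = j')"
begin

definition pair_form :: "(nat \<Rightarrow> real) \<Rightarrow> real" where
  "pair_form \<phi> = (\<Sum>i<N. \<Sum>j<N. H i j * \<phi> i * \<phi> (N + j))"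

text \<open>The partial derivative of \<open>pair_form\<close> in coordinate m, hence the increment
  of the form per unit of score when m is queried.\<close>

definition partner :: "(nat \<Rightarrow> real) \<Rightarrow> nat \<Rightarrow> real" where
  "partner \<phi> m = (if m < N then \<Sum>j<N. H m j * \<phi> (N + j) else \<Sum>i<N. H i (m - N) * \<phi> i)"

lemma sum_fun_upd_fresh:
  fixes \<phi> c :: "nat \<Rightarrow> real"
  assumes "\<phi> m = 0" "m < K"
  shows "(\<Sum>i<K. c i * (\<phi>(m := a)) i) = (\<Sum>i<K. c i * \<phi> i) + c m * a"
proof -
  have "(\<Sum>i<K. c i * (\<phi>(m := a)) i) = c m * a + (\<Sum>i\<in>{..<K}-{m}. c i * (\<phi>(m := a)) i)"
    by (subst sum.remove[of _ m]) (use assms in auto)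
  also have "(\<Sum>i\<in>{..<K}-{m}. c i * (\<phi>(m := a)) i) = (\<Sum>i\<in>{..<K}-{m}. c i * \<phi> i)"
    by (intro sum.cong) auto
  also have "\<dots> = (\<Sum>i<K. c i * \<phi> i)" by (subst sum.remove[of "{..<K}" m]) (use assms in auto)
  finally show ?thesis by simp
qed

lemma pair_form_upd:
  assumes "m < 2 * N" "\<phi> m = 0"
  shows "pair_form (\<phi>(m := a)) = pair_form \<phi> + a * partner \<phi> m"
proof (cases "m < N")
  case True
  have "pair_form \<psi> = (\<Sum>i<N. (\<Sum>j<N. H i j * \<psi> (N + j)) * \<psi> i)" for \<psi>
    by (simp add: pair_form_def sum_distrib_right sum_distrib_left mult_ac)
  then have "pair_form (\<phi>(m := a)) = (\<Sum>i<N. (\<Sum>j<N. H i j * \<phi> (N + j)) * (\<phi>(m := a)) i)"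
    using True by simp
  also have "\<dots> = pair_form \<phi> + partner \<phi> m * a"
    using sum_fun_upd_fresh[of \<phi> m N "\<lambda>i. \<Sum>j<N. H i j * \<phi> (N + j)" a] assms True
    by (simp add: partner_def pair_form_def sum_distrib_right sum_distrib_left mult_ac)
  finally show ?thesis by (simp add: mult.commute)
next
  case False
  define m' where "m' = m - N"
  have m': "m = N + m'" "m' < N" using False assms by (auto simp: m'_def)
  have pf: "pair_form \<psi> = (\<Sum>j<N. (\<Sum>i<N. H i j * \<psi> i) * (\<psi> (N + j)))" for \<psi>
    unfolding pair_form_def by (subst sum.swap) (simp add: sum_distrib_right)
  have up: "(\<phi>(m := a)) (N + j) = ((\<lambda>j. \<phi> (N + j))(m' := a)) j" for j by (simp add: m')
  have "(\<Sum>i<N. H i j * (\<phi>(m := a)) i) = (\<Sum>i<N. H i j * \<phi> i)" for j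
    using m' by (intro sum.cong) auto
  then have "pair_form (\<phi>(m := a)) = (\<Sum>j<N. (\<Sum>i<N. H i j * \<phi> i) * ((\<lambda>j. \<phi> (N + j))(m' := a)) j)"
    unfolding pf up by simp
  also have "\<dots> = pair_form \<phi> + partner \<phi> m * a"
    using sum_fun_upd_fresh[of "\<lambda>j. \<phi> (N + j)" m' N "\<lambda>j. \<Sum>i<N. H i j * \<phi> i" a] assms m'
    by (simp add: partner_def pf)
  finally show ?thesis by (simp add: mult.commute)
qed

text \<open>The coefficient h is an entry of H if m and m' lie in different halves and 0 otherwise.
  It is independent of a, so that both answers to the query are treated with the same h.\<close>

lemma partner_upd:
  assumes "m < 2 * N" "m' < 2 * N" "\<phi> m = 0"
  shows "\<exists>h. \<bar>h\<bar> \<le> 1 / sqrt (real N) \<and> (\<forall>a. partner (\<phi>(m := a)) m' = partner \<phi> m' + h * a)"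
proof (cases "m' < N")
  case True
  show ?thesis
  proof (cases "m < N")
    case True
    then have "partner (\<phi>(m := a)) m' = partner \<phi> m'" for a
      using \<open>m' < N\<close> by (auto simp: partner_def)
    then show ?thesis by (intro exI[of _ 0]) auto
  next
    case False
    define l where "l = m - N"
    have l: "m = N + l" "l < N" using False assms by (auto simp: l_def)
    have up: "(\<phi>(m := a)) (N + j) = ((\<lambda>j. \<phi> (N + j))(l := a)) j" for j a by (simp add: l)
    have "partner (\<phi>(m := a)) m' = partner \<phi> m' + H m' l * a" for a
      unfolding partner_def up using sum_fun_upd_fresh[of "\<lambda>j. \<phi> (N + j)" l N "\<lambda>j. H m' j" a] True assms l by simp
    then show ?thesis using flat[of m' l] True l by (intro exI[of _ "H m' l"]) auto
  qed
next
  case False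
  define l where "l = m' - N"
  have l: "m' = N + l" "l < N" using False assms by (auto simp: l_def)
  show ?thesis
  proof (cases "m < N")
    case True
    have "partner (\<phi>(m := a)) m' = partner \<phi> m' + H m l * a" for a
      unfolding partner_def using sum_fun_upd_fresh[of \<phi> m N "\<lambda>i. H i l" a] True assms l by simp
    then show ?thesis using flat[of m l] True l by (intro exI[of _ "H m l"]) auto
  next
    case False
    then have "partner (\<phi>(m := a)) m' = partner \<phi> m'" for a
      using l by (auto simp: partner_def intro!: sum.cong)
    then show ?thesis by (intro exI[of _ 0]) auto
  qed
qed

definition partner_potential :: "real \<Rightarrow> (nat \<Rightarrow> real) \<Rightarrow> real" where
  "partner_potential \<mu> \<phi> = (\<Sum>m<2*N. cosh (\<mu> * partner \<phi> m))"

text \<open>Whatever coordinate is queried, each scaled partner sum moves by a centred score times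
  at most \<open>\<mu> / sqrt N\<close>, so every summand grows in expectation by at most the same
  factor. The last hypothesis is the smallness required by
  \<open>biased_sign_cosh_le\<close>.\<close>

lemma partner_potential_step:
  assumes "m < 2 * N" "\<phi> m = 0" "\<bar>v\<bar> \<le> 1/2" "\<mu> \<ge> 0" "\<mu> / sqrt (real N) \<le> 1/2"
  shows "(1 - v) / 2 * partner_potential \<mu> (\<phi>(m := - 1 / (1 - v))) + (1 + v) / 2 * partner_potential \<mu> (\<phi>(m := 1 / (1 + v)))
    \<le> exp (2 * \<mu>\<^sup>2 / N) * partner_potential \<mu> \<phi>"
proof -
  have step: "(1 - v) / 2 * cosh (\<mu> * partner (\<phi>(m := - 1 / (1 - v))) m') + (1 + v) / 2 * cosh (\<mu> * partner (\<phi>(m := 1 / (1 + v))) m')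
    \<le> exp (2 * \<mu>\<^sup>2 / N) * cosh (\<mu> * partner \<phi> m')" if m': "m' < 2 * N" for m'
  proof -
    obtain h where h: "\<bar>h\<bar> \<le> 1 / sqrt (real N)" "\<And>a. partner (\<phi>(m := a)) m' = partner \<phi> m' + h * a"
      using partner_upd[of m m' \<phi>, OF assms(1) m' assms(2)] by auto
    define s where "s = \<mu> * h"
    have "\<bar>s\<bar> \<le> \<mu> * (1 / sqrt (real N))" unfolding s_def abs_mult using assms h by (intro mult_mono) auto
    then have s: "\<bar>s\<bar> \<le> \<mu> / sqrt (real N)" by simp
    then have s': "\<bar>s\<bar> \<le> 1/2" using assms(5) by linarith
    from s have "s\<^sup>2 \<le> (\<mu> / sqrt (real N))\<^sup>2" using abs_le_square_iff[of s "\<mu> / sqrt (real N)"] assms(4) by simp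
    then have s2: "2 * s\<^sup>2 \<le> 2 * \<mu>\<^sup>2 / N" by (simp add: power_divide)
    have eq: "\<mu> * (partner \<phi> m' + h * a) = \<mu> * partner \<phi> m' + s * a" for a by (simp add: s_def algebra_simps)
    have "(1 - v) / 2 * cosh (\<mu> * partner \<phi> m' + s * (- 1 / (1 - v))) + (1 + v) / 2 * cosh (\<mu> * partner \<phi> m' + s * (1 / (1 + v)))
      \<le> exp (2 * s\<^sup>2) * cosh (\<mu> * partner \<phi> m')"
      by (rule biased_sign_cosh_le[OF assms(3) s'])
    also have "\<dots> \<le> exp (2 * \<mu>\<^sup>2 / N) * cosh (\<mu> * partner \<phi> m')"
      using s2 by (intro mult_right_mono) auto
    finally show ?thesis unfolding h(2) eq .
  qed
  show ?thesis unfolding partner_potential_def sum_distrib_left sum.distrib[symmetric]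
    by (rule sum_mono) (use step in auto)
qed

text \<open>Along a path, \<open>pair_form\<close> is a martingale whose increment at a query of \<open>m\<close> is controlled by
  \<open>partner \<phi> m\<close>; since \<open>m\<close> is chosen adaptively, all \<open>2 N\<close> of these sums are kept small
  simultaneously by the exponential potential.\<close>

lemma leaf_expect_pair_form_square:
  assumes "read_once T" "dtree_over (2 * N) T" "\<And>i. i \<in> dtree_vars T \<Longrightarrow> \<phi> i = 0"
    and "dtree_depth T \<le> d" and v: "\<And>i. i < 2 * N \<Longrightarrow> \<bar>v i\<bar> \<le> 1/2"
    and \<mu>: "\<mu> > 0" "\<mu> / sqrt (real N) \<le> 1/2" and K: "K \<ge> 0"
  shows "leaf_expect v \<phi> T (\<lambda>\<psi> _. (pair_form \<psi>)\<^sup>2) \<le> (pair_form \<phi>)\<^sup>2 + d * (4/3 / \<mu>\<^sup>2 *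
    (K\<^sup>2 + (4 * K + 4) * exp (- K) * (exp (2 * \<mu>\<^sup>2 / N) ^ d * partner_potential \<mu> \<phi>)))"
  using assms(1-4)
proof (induction T arbitrary: \<phi> d)
  case (Leaf s)
  have "partner_potential \<mu> \<phi> \<ge> 0" by (auto simp: partner_potential_def intro!: sum_nonneg)
  then show ?case using K by simp
next
  case (Query i l r)
  then obtain e where d: "d = Suc e" by (cases d) auto
  define x where "x = exp (2 * \<mu>\<^sup>2 / N)"
  define c where "c = (4 * K + 4) * exp (- K)"
  define k where "k = 4/3 / \<mu>\<^sup>2"
  define \<Phi> where "\<Phi> = partner_potential \<mu>"
  have \<Phi>0: "\<Phi> \<psi> \<ge> 0" for \<psi> by (auto simp: \<Phi>_def partner_potential_def intro!: sum_nonneg)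
  have c0: "c \<ge> 0" "k \<ge> 0" using K by (auto simp: c_def k_def)
  have x1: "x \<ge> 1" by (simp add: x_def)
  have i: "i < 2 * N" "\<phi> i = 0" using Query.prems by auto
  define p where "p = v i"
  have p: "\<bar>p\<bar> \<le> 1/2" using v[OF i(1)] by (simp add: p_def)
  have p': "1 - p > 0" "1 + p > 0" using p by linarith+
  define \<phi>1 where "\<phi>1 = \<phi>(i := - 1 / (1 - p))"
  define \<phi>2 where "\<phi>2 = \<phi>(i := 1 / (1 + p))"
  have IH1: "leaf_expect v \<phi>1 l (\<lambda>\<psi> _. (pair_form \<psi>)\<^sup>2) \<le> (pair_form \<phi>1)\<^sup>2 + e * (k * (K\<^sup>2 + c * (x ^ e * \<Phi> \<phi>1)))"
    unfolding k_def c_def x_def \<Phi>_def by (rule Query.IH(1)) (use Query.prems d in \<open>auto simp: \<phi>1_def\<close>)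
  have IH2: "leaf_expect v \<phi>2 r (\<lambda>\<psi> _. (pair_form \<psi>)\<^sup>2) \<le> (pair_form \<phi>2)\<^sup>2 + e * (k * (K\<^sup>2 + c * (x ^ e * \<Phi> \<phi>2)))"
    unfolding k_def c_def x_def \<Phi>_def by (rule Query.IH(2)) (use Query.prems d in \<open>auto simp: \<phi>2_def\<close>)
  define L where "L = partner \<phi> i"
  have pf: "pair_form \<phi>1 = pair_form \<phi> + - 1 / (1 - p) * L" "pair_form \<phi>2 = pair_form \<phi> + 1 / (1 + p) * L"
    unfolding \<phi>1_def \<phi>2_def L_def using pair_form_upd[of i \<phi>, OF i] by auto
  have sq: "(1 - p) / 2 * (pair_form \<phi>1)\<^sup>2 + (1 + p) / 2 * (pair_form \<phi>2)\<^sup>2 \<le> (pair_form \<phi>)\<^sup>2 + 4/3 * L\<^sup>2"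
  proof -
    \<comment> \<open>The cross term cancels because the score has mean 0; what remains is
      \<open>L\<^sup>2\<close> times the variance of the score.\<close>
    have "(1 - p) / 2 * (pair_form \<phi>1)\<^sup>2 + (1 + p) / 2 * (pair_form \<phi>2)\<^sup>2 = (pair_form \<phi>)\<^sup>2 + L\<^sup>2 / ((1 - p) * (1 + p))"
      unfolding pf using p' by (simp add: divide_simps) (simp add: power2_eq_square algebra_simps)
    moreover have "L\<^sup>2 / ((1 - p) * (1 + p)) \<le> L\<^sup>2 / (3/4)"
    proof (rule divide_left_mono)
      have "p\<^sup>2 \<le> (1/2)\<^sup>2" using abs_le_square_iff[of p "1/2"] p by simp
      then show "3/4 \<le> (1 - p) * (1 + p)" by (simp add: algebra_simps power2_eq_square)
    qed (use p' in auto)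
    ultimately show ?thesis by simp
  qed
  have L: "4/3 * L\<^sup>2 \<le> k * (K\<^sup>2 + c * (x ^ Suc e * \<Phi> \<phi>))"
  proof -
    have "(\<mu> * L)\<^sup>2 \<le> K\<^sup>2 + c * cosh (\<mu> * L)" unfolding c_def by (rule square_le_cosh[OF K])
    also have "\<dots> \<le> K\<^sup>2 + c * \<Phi> \<phi>"
      unfolding \<Phi>_def partner_potential_def L_def using i c0
      by (intro add_left_mono mult_left_mono member_le_sum) auto
    \<comment> \<open>Enlarging the bound by a power of \<open>x \<ge> 1\<close> brings this query
      into the form that the induction hypothesis gives for the later ones.\<close>
    also have "\<dots> \<le> K\<^sup>2 + c * (x ^ Suc e * \<Phi> \<phi>)"
      using one_le_power[OF x1, of "Suc e"] \<Phi>0[of \<phi>] c0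
      by (intro add_left_mono mult_left_mono) (auto intro: mult_left_le_imp_le mult_le_cancel_right1[THEN iffD2])
    finally have "k * (\<mu> * L)\<^sup>2 \<le> k * (K\<^sup>2 + c * (x ^ Suc e * \<Phi> \<phi>))"
      by (rule mult_left_mono[OF _ c0(2)])
    moreover have "k * (\<mu> * L)\<^sup>2 = 4/3 * L\<^sup>2"
      using \<mu>(1) by (simp add: k_def power_mult_distrib)
    ultimately show ?thesis by simp
  qed
  have pot: "(1 - p) / 2 * \<Phi> \<phi>1 + (1 + p) / 2 * \<Phi> \<phi>2 \<le> x * \<Phi> \<phi>"
    unfolding \<Phi>_def \<phi>1_def \<phi>2_def x_def by (rule partner_potential_step) (use i p \<mu> in auto)
  have "leaf_expect v \<phi> (Query i l r) (\<lambda>\<psi> _. (pair_form \<psi>)\<^sup>2)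
    = (1 - p) / 2 * leaf_expect v \<phi>1 l (\<lambda>\<psi> _. (pair_form \<psi>)\<^sup>2) + (1 + p) / 2 * leaf_expect v \<phi>2 r (\<lambda>\<psi> _. (pair_form \<psi>)\<^sup>2)"
    by (simp add: p_def \<phi>1_def \<phi>2_def)
  also have "\<dots> \<le> (1 - p) / 2 * ((pair_form \<phi>1)\<^sup>2 + e * (k * (K\<^sup>2 + c * (x ^ e * \<Phi> \<phi>1))))
     + (1 + p) / 2 * ((pair_form \<phi>2)\<^sup>2 + e * (k * (K\<^sup>2 + c * (x ^ e * \<Phi> \<phi>2))))"
    using IH1 IH2 p' by (intro add_mono mult_left_mono) auto
  also have "\<dots> = ((1 - p) / 2 * (pair_form \<phi>1)\<^sup>2 + (1 + p) / 2 * (pair_form \<phi>2)\<^sup>2)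
     + e * (k * (K\<^sup>2 + c * (x ^ e * ((1 - p) / 2 * \<Phi> \<phi>1 + (1 + p) / 2 * \<Phi> \<phi>2))))"
    by (simp add: algebra_simps add_divide_distrib diff_divide_distrib)
  also have "\<dots> \<le> ((pair_form \<phi>)\<^sup>2 + k * (K\<^sup>2 + c * (x ^ Suc e * \<Phi> \<phi>))) + e * (k * (K\<^sup>2 + c * (x ^ e * (x * \<Phi> \<phi>))))"
  proof (rule add_mono)
    show "(1 - p) / 2 * (pair_form \<phi>1)\<^sup>2 + (1 + p) / 2 * (pair_form \<phi>2)\<^sup>2
      \<le> (pair_form \<phi>)\<^sup>2 + k * (K\<^sup>2 + c * (x ^ Suc e * \<Phi> \<phi>))" using sq L by linarith
    show "e * (k * (K\<^sup>2 + c * (x ^ e * ((1 - p) / 2 * \<Phi> \<phi>1 + (1 + p) / 2 * \<Phi> \<phi>2))))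
      \<le> e * (k * (K\<^sup>2 + c * (x ^ e * (x * \<Phi> \<phi>))))"
      using c0 x1 by (intro mult_left_mono add_left_mono pot) auto
  qed
  also have "\<dots> = (pair_form \<phi>)\<^sup>2 + d * (k * (K\<^sup>2 + c * (x ^ d * \<Phi> \<phi>)))"
    by (simp add: d algebra_simps)
  finally show ?case unfolding k_def c_def x_def \<Phi>_def .
qed

text \<open>With \<open>\<mu>\<^sup>2 = N / d\<close> the potential grows only by
  \<open>exp 2\<close> over d queries, and the d increments of order
  \<open>1 / \<mu>\<^sup>2\<close> sum to order \<open>d\<^sup>2 / N\<close>. With K = ln (2 N) the
  damping \<open>exp (- K)\<close> cancels the initial potential 2 N. The condition
  \<open>d \<ge> 4\<close> gives \<open>\<mu> / sqrt N \<le> 1/2\<close>.\<close>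

lemma leaf_expect_abs_pair_form:
  assumes "read_once T" "dtree_over (2 * N) T" "dtree_depth T \<le> d" and d: "d \<ge> 4"
    and v: "\<And>i. i < 2 * N \<Longrightarrow> \<bar>v i\<bar> \<le> 1/2"
  shows "leaf_expect v (\<lambda>_. 0) T (\<lambda>\<psi> _. \<bar>pair_form \<psi>\<bar>) \<le> 16 * d * (ln (2 * N) + 4) / sqrt N"
proof -
  define K where "K = ln (2 * real N)"
  have K: "K \<ge> 0" using N_pos by (simp add: K_def)
  define \<mu> where "\<mu> = sqrt (N / d)"
  have \<mu>: "\<mu> > 0" "\<mu>\<^sup>2 = N / d" using d N_pos by (auto simp: \<mu>_def)
  have \<mu>2: "\<mu> / sqrt (real N) \<le> 1/2"
  proof -
    have "\<mu> / sqrt (real N) = 1 / sqrt d" using N_pos by (simp add: \<mu>_def real_sqrt_divide)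
    moreover have "sqrt d \<ge> sqrt 4" using d by (intro real_sqrt_le_mono) simp
    ultimately show ?thesis using d by (simp add: field_simps)
  qed
  have "partner (\<lambda>_. 0) m = 0" for m by (simp add: partner_def)
  then have pot: "partner_potential \<mu> (\<lambda>_. 0) = 2 * N" by (simp add: partner_potential_def)
  have pf: "pair_form (\<lambda>_. 0) = 0" by (simp add: pair_form_def)
  have "exp (2 * \<mu>\<^sup>2 / N) ^ d = exp (d * (2 * \<mu>\<^sup>2 / N))" by (rule exp_of_nat_mult[symmetric])
  also have "d * (2 * \<mu>\<^sup>2 / N) = 2" using d N_pos by (simp add: \<mu>)
  finally have ex: "exp (2 * \<mu>\<^sup>2 / N) ^ d = exp 2" .
  have exp2: "exp (2::real) \<le> 9"
  proof -
    have "exp (2::real) = exp 1 ^ 2" by (simp add: exp_of_nat_mult[symmetric])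
    also have "\<dots> \<le> 3 ^ 2" using exp_le by (intro power_mono) auto
    finally show ?thesis by simp
  qed
  have eK: "exp (- K) * (exp 2 * (2 * real N)) = exp 2" using N_pos by (simp add: K_def exp_minus)
  have "leaf_expect v (\<lambda>_. 0) T (\<lambda>\<psi> _. (pair_form \<psi>)\<^sup>2) \<le> d * (4/3 / \<mu>\<^sup>2 * (K\<^sup>2 + (4 * K + 4) * exp (- K) * (exp 2 * (2 * N))))"
    using leaf_expect_pair_form_square[OF assms(1,2) _ assms(3) v \<mu>(1) \<mu>2 K, of "\<lambda>_. 0"] by (simp add: ex pot pf)
  also have "\<dots> = 4/3 * d\<^sup>2 / N * (K\<^sup>2 + (4 * K + 4) * exp 2)"
  proof -
    have "d * (4/3 / \<mu>\<^sup>2) = 4/3 * d\<^sup>2 / N" using d N_pos unfolding \<mu>(2) by (simp add: power2_eq_square)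
    moreover have "(4 * K + 4) * exp (- K) * (exp 2 * (2 * real N)) = (4 * K + 4) * exp 2"
      using eK by (metis mult.assoc)
    ultimately show ?thesis by (metis (no_types, opaque_lifting) mult.assoc of_nat_mult of_nat_numeral)
  qed
  also have "\<dots> \<le> 4/3 * d\<^sup>2 / N * (K\<^sup>2 + (4 * K + 4) * 9)"
    using exp2 K by (intro mult_left_mono add_left_mono) auto
  also have "\<dots> \<le> 4/3 * d\<^sup>2 / N * (48 * (K + 4)\<^sup>2)"
    using K by (intro mult_left_mono) (auto simp: power2_eq_square algebra_simps)
  also have "\<dots> \<le> (16 * d * (K + 4) / sqrt N)\<^sup>2"
  proof -
    have "(16 * d * (K + 4) / sqrt N)\<^sup>2 = 4 * (4/3 * d\<^sup>2 / N * (48 * (K + 4)\<^sup>2))"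
      using N_pos by (simp add: power_divide power_mult_distrib)
    moreover have "0 \<le> 4/3 * d\<^sup>2 / N * (48 * (K + 4)\<^sup>2)" by simp
    ultimately show ?thesis by linarith
  qed
  finally have sq: "leaf_expect v (\<lambda>_. 0) T (\<lambda>\<psi> _. (pair_form \<psi>)\<^sup>2) \<le> (16 * d * (K + 4) / sqrt N)\<^sup>2" .
  \<comment> \<open>The first moment is reached from the second by the arithmetic-geometric
    inequality with weight \<beta>, which is the square root of the bound on the second
    moment.\<close>
  define \<beta> where "\<beta> = 16 * d * (K + 4) / sqrt N"
  have \<beta>: "\<beta> > 0" using d N_pos K by (simp add: \<beta>_def)
  have "leaf_expect v (\<lambda>_. 0) T (\<lambda>\<psi> _. \<bar>pair_form \<psi>\<bar>) \<le> leaf_expect v (\<lambda>_. 0) T (\<lambda>\<psi> _. 1 / (2 * \<beta>) * (pair_form \<psi>)\<^sup>2 + \<beta> / 2)"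
  proof (rule leaf_expect_mono[OF assms(2) v])
    fix \<psi> :: "nat \<Rightarrow> real" and s :: real
    have "0 \<le> (\<bar>pair_form \<psi>\<bar> - \<beta>)\<^sup>2" by simp
    then have "2 * \<beta> * \<bar>pair_form \<psi>\<bar> \<le> (pair_form \<psi>)\<^sup>2 + \<beta>\<^sup>2"
      unfolding power2_diff by (simp add: mult_ac)
    then show "\<bar>pair_form \<psi>\<bar> \<le> 1 / (2 * \<beta>) * (pair_form \<psi>)\<^sup>2 + \<beta> / 2"
      using \<beta> by (simp add: field_simps power2_eq_square)
  qed auto
  also have "\<dots> = 1 / (2 * \<beta>) * leaf_expect v (\<lambda>_. 0) T (\<lambda>\<psi> _. (pair_form \<psi>)\<^sup>2) + \<beta> / 2"
    unfolding leaf_expect_add leaf_expect_cmult leaf_expect_const ..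
  also have "\<dots> \<le> 1 / (2 * \<beta>) * \<beta>\<^sup>2 + \<beta> / 2"
    using sq \<beta> unfolding \<beta>_def[symmetric] by (intro add_right_mono mult_left_mono) auto
  also have "\<dots> = \<beta>" using \<beta> by (simp add: power2_eq_square)
  finally show ?thesis by (simp add: \<beta>_def K_def)
qed

end

section \<open>The stopped random walk\<close>

lemma cosh_le_exp_square:
  fixes x :: real
  assumes "\<bar>x\<bar> \<le> 1"
  shows "cosh x \<le> exp (x\<^sup>2)"
proof -
  have "exp x \<le> 1 + x + x\<^sup>2" "exp (- x) \<le> 1 + - x + (- x)\<^sup>2"
    using assms by (intro exp_le_quadratic; simp)+
  then have "cosh x \<le> 1 + x\<^sup>2" by (simp add: cosh_field_def)
  also have "\<dots> \<le> exp (x\<^sup>2)" by (rule exp_ge_add_one_self)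
  finally show ?thesis .
qed

section \<open>Moments of linear and bilinear forms in signs\<close>

lemma orthogonal_parseval:
  fixes G :: "nat \<Rightarrow> nat \<Rightarrow> real"
  assumes "\<And>i i'. i < N \<Longrightarrow> i' < N \<Longrightarrow> (\<Sum>j<K. G i j * G i' j) = of_bool (i = i')"
  shows "(\<Sum>j<K. (\<Sum>i<N. G i j * a i)\<^sup>2) = (\<Sum>i<N. (a i)\<^sup>2)"
proof -
  have "(\<Sum>j<K. (\<Sum>i<N. G i j * a i)\<^sup>2) = (\<Sum>j<K. \<Sum>i<N. \<Sum>i'<N. a i * a i' * (G i j * G i' j))"
    by (simp add: power2_eq_square sum_product mult_ac)
  also have "\<dots> = (\<Sum>i<N. \<Sum>i'<N. a i * a i' * (\<Sum>j<K. G i j * G i' j))"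
    by (subst sum.swap, rule sum.cong[OF refl], subst sum.swap) (simp add: sum_distrib_left)
  also have "\<dots> = (\<Sum>i<N. \<Sum>i'<N. a i * a i' * of_bool (i = i'))"
    using assms by (intro sum.cong) auto
  also have "\<dots> = (\<Sum>i<N. (a i)\<^sup>2)"
    by (rule sum.cong[OF refl]) (simp add: sum.delta of_bool_def if_distrib power2_eq_square cong: if_cong)
  finally show ?thesis .
qed

lemma flip_coord_index: "j < dim_vec z \<Longrightarrow> j \<noteq> i \<Longrightarrow> flip_coord i z $ j = z $ j"
  by (simp add: flip_coord_def)

lemma sign_cube_square: "z \<in> sign_cube M \<Longrightarrow> i < M \<Longrightarrow> z $ i * z $ i = 1"
  using sign_cube_cases[of z M i] by auto

lemma cube_expect_pair:
  assumes "i < M" "j < M"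
    and g: "\<And>z l. z \<in> sign_cube M \<Longrightarrow> l = i \<or> l = j \<Longrightarrow> g (flip_coord l z) = g z"
  shows "cube_expect M v (\<lambda>z. z $ i * z $ j * g z) = (v i * v j + of_bool (i = j) * (1 - (v i)\<^sup>2)) * cube_expect M v g"
proof (cases "i = j")
  case True
  have "cube_expect M v (\<lambda>z. z $ i * z $ j * g z) = cube_expect M v g"
    using True assms by (intro cube_expect_cong) (simp add: sign_cube_square)
  then show ?thesis using True by (simp add: power2_eq_square)
next
  case False
  have "cube_expect M v (\<lambda>z. z $ i * (z $ j * g z)) = v i * cube_expect M v (\<lambda>z. z $ j * g z)"
    using assms False by (intro cube_expect_coord) (auto simp: flip_coord_index dim_sign_cube)
  also have "cube_expect M v (\<lambda>z. z $ j * g z) = v j * cube_expect M v g"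
    using assms False by (intro cube_expect_coord) auto
  finally show ?thesis using False by (simp add: mult_ac)
qed

lemma cube_expect_index: "i < M \<Longrightarrow> cube_expect M v (\<lambda>z. z $ i) = v i"
  using cube_expect_coord[of i M "\<lambda>_. 1" v] by (simp add: cube_expect_const)

context flat_orthogonal
begin

definition lin :: "(nat \<Rightarrow> real) \<Rightarrow> nat \<Rightarrow> real" where
  "lin X m = (if m < N then X m else \<Sum>i<N. H i (m - N) * X i)"

abbreviation unif :: "(real vec \<Rightarrow> real) \<Rightarrow> real" where
  "unif \<equiv> cube_expect N (\<lambda>_. 0)"

lemma lin_add: "lin (\<lambda>i. X i + \<eta> * Y i) = (\<lambda>m. lin X m + \<eta> * lin Y m)"
  by (rule ext) (simp add: lin_def algebra_simps sum.distrib sum_distrib_left)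

text \<open>Each coordinate of the means is a linear form with a unit coefficient vector, so both
  halves share the same exponential moments. The bound on single coefficients keeps the exponents of
  the individual factors small.\<close>

lemma lin_eq_sum:
  assumes "m < 2 * N"
  obtains c where "\<And>X. lin X m = (\<Sum>i<N. c i * X i)" "(\<Sum>i<N. (c i)\<^sup>2) = 1" "\<And>i. i < N \<Longrightarrow> \<bar>c i\<bar> \<le> 1"
proof (cases "m < N")
  case True
  have "lin X m = (\<Sum>i<N. of_bool (i = m) * X i)" for X
    using True by (simp add: lin_def of_bool_def if_distrib if_distribR sum.delta cong: if_cong)
  moreover have "(\<Sum>i<N. (of_bool (i = m))\<^sup>2) = (1::real)"
    using True by (simp add: of_bool_def if_distrib if_distribR sum.delta cong: if_cong)
  ultimately show ?thesis by (intro that[of "\<lambda>i. of_bool (i = m)"]) auto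
next
  case False
  then have m: "m - N < N" using assms by simp
  have "1 / sqrt N \<le> 1" using N_pos by simp
  then show ?thesis using False col_orth[OF m m] flat[OF _ m]
    by (intro that[of "\<lambda>i. H i (m - N)"]) (auto simp: lin_def power2_eq_square)
qed

lemma unif_pair: "i < N \<Longrightarrow> j < N \<Longrightarrow> unif (\<lambda>u. u $ i * u $ j) = of_bool (i = j)"
  using cube_expect_pair[of i N j "\<lambda>_. 1" "\<lambda>_. 0"] by (simp add: cube_expect_const)

lemma unif_lin: "m < 2 * N \<Longrightarrow> unif (\<lambda>u. lin (($) u) m) = 0"
  by (erule lin_eq_sum) (simp add: cube_expect_sum cube_expect_cmult cube_expect_index)

text \<open>The covariance of two forms is the inner product of their coefficient vectors. Within a
  half these are orthonormal, across the halves they produce the entries of H; this is how the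
  second-order term of a step becomes \<open>pair_form\<close>.\<close>

lemma unif_lin_lin:
  assumes "i < 2 * N" "j < i"
  shows "unif (\<lambda>u. lin (($) u) i * lin (($) u) j) = (if j < N \<and> N \<le> i then H j (i - N) else 0)"
proof -
  have "unif (\<lambda>u. (\<Sum>k<N. a k * u $ k) * (\<Sum>l<N. b l * u $ l)) = (\<Sum>k<N. a k * b k)" for a b
  proof -
    have "unif (\<lambda>u. (\<Sum>k<N. a k * u $ k) * (\<Sum>l<N. b l * u $ l))
        = (\<Sum>k<N. \<Sum>l<N. unif (\<lambda>u. (a k * b l) * (u $ k * u $ l)))"
      by (simp add: sum_product cube_expect_sum mult_ac)
    also have "\<dots> = (\<Sum>k<N. \<Sum>l<N. a k * b l * of_bool (k = l))"
      by (intro sum.cong refl) (simp only: cube_expect_cmult, simp add: unif_pair)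
    also have "\<dots> = (\<Sum>k<N. a k * b k)"
      by (rule sum.cong[OF refl]) (simp add: of_bool_def if_distrib if_distribR sum.delta cong: if_cong)
    finally show ?thesis .
  qed
  note * = this
  have x: "x i = (\<Sum>k<N. of_bool (k = i) * x k)" if "i < N" for i and x :: "nat \<Rightarrow> real"
    using that by (simp add: of_bool_def if_distrib if_distribR sum.delta cong: if_cong)
  consider "i < N" | "j < N" "N \<le> i" | "N \<le> j" using assms by linarith
  then show ?thesis
  proof cases
    case 1
    then show ?thesis using assms unif_pair[of i j] by (simp add: lin_def)
  next
    case 2
    have "unif (\<lambda>u. lin (($) u) i * lin (($) u) j) = unif (\<lambda>u. (\<Sum>k<N. H k (i - N) * u $ k) * (\<Sum>k<N. of_bool (k = j) * u $ k))"
      using 2 x[of j] by (simp add: lin_def)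
    also have "\<dots> = H j (i - N)" unfolding * using 2 by (simp add: of_bool_def if_distrib if_distribR sum.delta cong: if_cong)
    finally show ?thesis using 2 by simp
  next
    case 3
    have "unif (\<lambda>u. lin (($) u) i * lin (($) u) j) = unif (\<lambda>u. (\<Sum>k<N. H k (i - N) * u $ k) * (\<Sum>k<N. H k (j - N) * u $ k))"
      using 3 assms by (simp add: lin_def)
    also have "\<dots> = 0" unfolding * using 3 assms col_orth[of "i - N" "j - N"] by simp
    finally show ?thesis using 3 by simp
  qed
qed

lemma abs_lin_sign_le:
  assumes "u \<in> sign_cube N" "m < 2 * N"
  shows "\<bar>lin (($) u) m\<bar> \<le> sqrt N"
proof (cases "m < N")
  case True
  have "\<bar>u $ m\<bar> = 1" using sign_cube_cases[OF assms(1) True] by auto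
  then show ?thesis using True N_pos by (simp add: lin_def)
next
  case False
  have "\<bar>\<Sum>i<N. H i (m - N) * u $ i\<bar> \<le> (\<Sum>i<N. 1 / sqrt N)"
  proof (rule order_trans[OF sum_abs sum_mono])
    fix i assume i: "i \<in> {..<N}"
    have "\<bar>u $ i\<bar> = 1" using sign_cube_cases[OF assms(1), of i] i by auto
    then show "\<bar>H i (m - N) * u $ i\<bar> \<le> 1 / sqrt N"
      using flat[of i "m - N"] i False assms(2) by (simp add: abs_mult)
  qed
  also have "\<dots> = sqrt N" using N_pos by (simp add: real_div_sqrt)
  finally show ?thesis using False by (simp add: lin_def)
qed

lemma pair_form_lin: "pair_form (lin X) = (\<Sum>i<N. (X i)\<^sup>2)"
proof -
  have "pair_form (lin X) = (\<Sum>j<N. (\<Sum>i<N. H i j * X i) * (\<Sum>i<N. H i j * X i))"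
    unfolding pair_form_def by (subst sum.swap) (simp add: lin_def sum_distrib_right)
  also have "\<dots> = (\<Sum>i<N. (X i)\<^sup>2)"
    using orthogonal_parseval[where G = H and K = N and N = N and a = X, OF row_orth] by (simp add: power2_eq_square)
  finally show ?thesis .
qed

lemma cube_expect_pair_form: "cube_expect (2 * N) v (\<lambda>z. pair_form (($) z)) = pair_form v"
proof -
  have "cube_expect (2 * N) v (\<lambda>z. pair_form (($) z))
    = (\<Sum>i<N. \<Sum>j<N. H i j * cube_expect (2 * N) v (\<lambda>z. z $ i * z $ (N + j) * 1))"
    by (simp add: pair_form_def cube_expect_sum mult.assoc cube_expect_cmult)
  also have "\<dots> = (\<Sum>i<N. \<Sum>j<N. H i j * (v i * v (N + j)))"
    by (intro sum.cong refl, subst cube_expect_pair) (auto simp: cube_expect_const)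
  finally show ?thesis by (simp add: pair_form_def mult.assoc)
qed

text \<open>The two halves are independent, so a fourth moment factors into
  \<open>a i i' * a (N + j) (N + j')\<close>, and each factor is a product of means plus a diagonal
  variance \<open>D \<le> 1\<close>. The means alone give the square of \<open>pair_form v\<close>.
  The variance of the second half alone, of the first half alone, and of both together contribute at
  most N each, by Parseval and orthonormal rows.\<close>

lemma cube_expect_pair_form_square:
  assumes v: "\<And>i. i < 2 * N \<Longrightarrow> \<bar>v i\<bar> \<le> 1"
  shows "cube_expect (2 * N) v (\<lambda>z. (pair_form (($) z))\<^sup>2) \<le> (pair_form v)\<^sup>2 + 3 * N"
proof -
  define D where "D i = 1 - (v i)\<^sup>2" for i
  have D: "0 \<le> D i" "D i \<le> 1" if "i < 2 * N" for i
    using v[OF that] by (auto simp: D_def abs_square_le_1)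
  have v2: "(v i)\<^sup>2 \<le> 1" if "i < 2 * N" for i
    using v[OF that] by (auto simp: abs_square_le_1)
  define a where "a i j = v i * v j + of_bool (i = j) * D i" for i j
  define r where "r i = (\<Sum>j<N. H i j * v (N + j))" for i
  define cc where "cc j = (\<Sum>i<N. H i j * v i)" for j
  define B where "B i i' = (\<Sum>j<N. \<Sum>j'<N. H i j * H i' j' * a (N + j) (N + j'))" for i i'
  have four: "cube_expect (2 * N) v (\<lambda>z. z $ i * z $ i' * (z $ (N + j) * z $ (N + j'))) = a i i' * a (N + j) (N + j')"
    if "i < N" "i' < N" "j < N" "j' < N" for i i' j j'
  proof -
    have "cube_expect (2 * N) v (\<lambda>z. z $ i * z $ i' * (z $ (N + j) * z $ (N + j')))
      = a i i' * cube_expect (2 * N) v (\<lambda>z. z $ (N + j) * z $ (N + j') * 1)"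
      unfolding a_def D_def using that
      by (subst cube_expect_pair) (auto simp: flip_coord_index dim_sign_cube)
    also have "cube_expect (2 * N) v (\<lambda>z. z $ (N + j) * z $ (N + j') * 1) = a (N + j) (N + j')"
      unfolding a_def D_def using that by (subst cube_expect_pair) (auto simp: cube_expect_const)
    finally show ?thesis .
  qed
  have "cube_expect (2 * N) v (\<lambda>z. (pair_form (($) z))\<^sup>2)
    = cube_expect (2 * N) v (\<lambda>z. \<Sum>i<N. \<Sum>i'<N. \<Sum>j<N. \<Sum>j'<N. H i j * H i' j' * (z $ i * z $ i' * (z $ (N + j) * z $ (N + j'))))"
    by (simp add: pair_form_def power2_eq_square sum_product mult_ac)
  also have "\<dots> = (\<Sum>i<N. \<Sum>i'<N. \<Sum>j<N. \<Sum>j'<N. H i j * H i' j' * (a i i' * a (N + j) (N + j')))"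
    unfolding cube_expect_sum cube_expect_cmult by (intro sum.cong refl) (simp add: four)
  also have "\<dots> = (\<Sum>i<N. \<Sum>i'<N. a i i' * B i i')"
    by (simp add: B_def sum_distrib_left mult_ac)
  also have "\<dots> = (\<Sum>i<N. \<Sum>i'<N. v i * v i' * B i i') + (\<Sum>i<N. D i * B i i)"
  proof -
    have "(\<Sum>i'<N. a i i' * B i i') = (\<Sum>i'<N. v i * v i' * B i i') + D i * B i i" if "i < N" for i
    proof -
      have "(\<Sum>i'<N. a i i' * B i i') = (\<Sum>i'<N. v i * v i' * B i i') + (\<Sum>i'<N. of_bool (i = i') * D i * B i i')"
        by (simp add: a_def distrib_right sum.distrib)
      also have "(\<Sum>i'<N. of_bool (i = i') * D i * B i i') = D i * B i i"
        using that by (simp add: of_bool_def if_distrib if_distribR sum.delta cong: if_cong)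
      finally show ?thesis .
    qed
    then show ?thesis by (simp add: sum.distrib)
  qed
  also have "\<dots> \<le> ((pair_form v)\<^sup>2 + N) + (N + N)"
  proof (rule add_mono)
    have Beq: "B i i' = r i * r i' + (\<Sum>j<N. H i j * H i' j * D (N + j))" for i i'
    proof -
      have "B i i' = (\<Sum>j<N. (\<Sum>j'<N. H i j * v (N + j) * (H i' j' * v (N + j'))) + (\<Sum>j'<N. of_bool (j = j') * (H i j * H i' j' * D (N + j))))"
        unfolding B_def a_def sum.distrib[symmetric] by (intro sum.cong refl) (simp add: algebra_simps)
      also have "\<dots> = r i * r i' + (\<Sum>j<N. H i j * H i' j * D (N + j))"
        by (simp add: r_def sum.distrib sum_product of_bool_def if_distrib if_distribR sum.delta cong: if_cong)
      finally show ?thesis .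
    qed
    have pf: "pair_form v = (\<Sum>i<N. v i * r i)"
      by (simp add: pair_form_def r_def sum_distrib_left mult_ac)
    have "(\<Sum>i<N. \<Sum>i'<N. v i * v i' * B i i')
      = (\<Sum>i<N. \<Sum>i'<N. (v i * r i) * (v i' * r i')) + (\<Sum>i<N. \<Sum>i'<N. \<Sum>j<N. D (N + j) * ((H i j * v i) * (H i' j * v i')))"
      unfolding Beq by (simp add: distrib_left sum.distrib sum_distrib_left mult_ac)
    also have "(\<Sum>i<N. \<Sum>i'<N. (v i * r i) * (v i' * r i')) = (pair_form v)\<^sup>2"
      by (simp add: pf power2_eq_square sum_product)
    also have "(\<Sum>i<N. \<Sum>i'<N. \<Sum>j<N. D (N + j) * ((H i j * v i) * (H i' j * v i'))) = (\<Sum>j<N. D (N + j) * (cc j)\<^sup>2)"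
    proof -
      have "(\<Sum>i<N. \<Sum>i'<N. \<Sum>j<N. D (N + j) * ((H i j * v i) * (H i' j * v i')))
        = (\<Sum>i<N. \<Sum>j<N. \<Sum>i'<N. D (N + j) * ((H i j * v i) * (H i' j * v i')))"
        by (rule sum.cong[OF refl], rule sum.swap)
      also have "\<dots> = (\<Sum>j<N. \<Sum>i<N. \<Sum>i'<N. D (N + j) * ((H i j * v i) * (H i' j * v i')))"
        by (rule sum.swap)
      also have "\<dots> = (\<Sum>j<N. D (N + j) * (cc j)\<^sup>2)"
      proof (rule sum.cong[OF refl])
        fix j
        have "(cc j)\<^sup>2 = (\<Sum>i<N. \<Sum>i'<N. (H i j * v i) * (H i' j * v i'))"
          by (simp only: cc_def power2_eq_square sum_product)
        then show "(\<Sum>i<N. \<Sum>i'<N. D (N + j) * ((H i j * v i) * (H i' j * v i'))) = D (N + j) * (cc j)\<^sup>2"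
          by (simp only: sum_distrib_left)
      qed
      finally show ?thesis .
    qed
    also have "(\<Sum>j<N. D (N + j) * (cc j)\<^sup>2) \<le> (\<Sum>j<N. (cc j)\<^sup>2)"
      using D by (intro sum_mono mult_left_le_one_le) auto
    also have "(\<Sum>j<N. (cc j)\<^sup>2) = (\<Sum>i<N. (v i)\<^sup>2)"
      unfolding cc_def by (rule orthogonal_parseval[OF row_orth])
    also have "\<dots> \<le> (\<Sum>i<N. 1)" using v2 by (intro sum_mono) auto
    finally show "(\<Sum>i<N. \<Sum>i'<N. v i * v i' * B i i') \<le> (pair_form v)\<^sup>2 + N" by simp
    have "(\<Sum>i<N. D i * B i i) \<le> (\<Sum>i<N. B i i)"
    proof (intro sum_mono mult_left_le_one_le)
      fix i assume "i \<in> {..<N}"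
      then show "0 \<le> D i" "D i \<le> 1" using D[of i] by auto
      have "(\<Sum>j<N. H i j * H i j * D (N + j)) \<ge> 0" using D by (intro sum_nonneg) auto
      then show "0 \<le> B i i" unfolding Beq by simp
    qed
    also have "\<dots> = (\<Sum>i<N. (r i)\<^sup>2) + (\<Sum>i<N. \<Sum>j<N. H i j * H i j * D (N + j))"
      by (simp add: Beq sum.distrib power2_eq_square)
    also have "(\<Sum>i<N. (r i)\<^sup>2) = (\<Sum>j<N. (v (N + j))\<^sup>2)"
      unfolding r_def by (rule orthogonal_parseval[where G = "\<lambda>j i. H i j"]) (rule col_orth)
    also have "\<dots> \<le> (\<Sum>j<N. 1)" using v2 by (intro sum_mono) auto
    also have "(\<Sum>i<N. \<Sum>j<N. H i j * H i j * D (N + j)) \<le> (\<Sum>i<N. \<Sum>j<N. H i j * H i j)"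
      using D by (intro sum_mono mult_right_le_one_le) auto
    also have "\<dots> = (\<Sum>i<N. 1)" by (intro sum.cong refl) (simp add: row_orth)
    finally show "(\<Sum>i<N. D i * B i i) \<le> real (N + N)" by simp
  qed
  finally show ?thesis by simp
qed

section \<open>The stopped walk and its effect on decision trees\<close>

definition good :: "(nat \<Rightarrow> real) \<Rightarrow> bool" where
  "good X \<longleftrightarrow> (\<forall>m<2*N. \<bar>lin X m\<bar> \<le> 1/2)"

text \<open>The transition operator of the stopped walk acts on functions of the state, so that \<open>walk \<eta> p g\<close>
  is the expectation of \<open>g\<close> after \<open>p\<close> steps from the origin.\<close>

definition step :: "real \<Rightarrow> ((nat \<Rightarrow> real) \<Rightarrow> real) \<Rightarrow> (nat \<Rightarrow> real) \<Rightarrow> real" where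
  "step \<eta> g X = (if good X then unif (\<lambda>u. g (\<lambda>i. X i + \<eta> * u $ i)) else g X)"

definition walk :: "real \<Rightarrow> nat \<Rightarrow> ((nat \<Rightarrow> real) \<Rightarrow> real) \<Rightarrow> real" where
  "walk \<eta> p g = (step \<eta> ^^ p) g (\<lambda>_. 0)"

lemma walk_0: "walk \<eta> 0 g = g (\<lambda>_. 0)"
  by (simp add: walk_def)

lemma walk_Suc: "walk \<eta> (Suc p) g = walk \<eta> p (step \<eta> g)"
  by (simp add: walk_def funpow_swap1)

lemma step_mono: "(\<And>X. g X \<le> h X) \<Longrightarrow> step \<eta> g X \<le> step \<eta> h X"
  by (auto simp: step_def intro!: cube_expect_mono)

lemma walk_mono: "(\<And>X. g X \<le> h X) \<Longrightarrow> walk \<eta> p g \<le> walk \<eta> p h"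
proof (induction p arbitrary: g h)
  case (Suc p)
  show ?case unfolding walk_Suc by (intro Suc.IH step_mono Suc.prems)
qed (simp add: walk_0)

lemma step_add: "step \<eta> (\<lambda>X. g X + h X) = (\<lambda>X. step \<eta> g X + step \<eta> h X)"
  by (rule ext) (simp add: step_def cube_expect_add)

lemma step_cmult: "step \<eta> (\<lambda>X. c * g X) = (\<lambda>X. c * step \<eta> g X)"
  by (rule ext) (simp add: step_def cube_expect_cmult)

lemma step_const: "step \<eta> (\<lambda>X. c) = (\<lambda>X. c)"
  by (rule ext) (simp add: step_def cube_expect_const)

lemma walk_add: "walk \<eta> p (\<lambda>X. g X + h X) = walk \<eta> p g + walk \<eta> p h"
  by (induction p arbitrary: g h) (simp_all add: walk_0 walk_Suc step_add)

lemma walk_cmult: "walk \<eta> p (\<lambda>X. c * g X) = c * walk \<eta> p g"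
  by (induction p arbitrary: g) (simp_all add: walk_0 walk_Suc step_cmult)

lemma walk_const: "walk \<eta> p (\<lambda>X. c) = c"
  by (induction p) (simp_all add: walk_0 walk_Suc step_const)

lemma walk_diff: "walk \<eta> p (\<lambda>X. g X - h X) = walk \<eta> p g - walk \<eta> p h"
  using walk_add[of \<eta> p g "\<lambda>X. (- 1) * h X"] walk_cmult[of \<eta> p "- 1" h] by simp

lemma walk_sum: "finite I \<Longrightarrow> walk \<eta> p (\<lambda>X. \<Sum>i\<in>I. g i X) = (\<Sum>i\<in>I. walk \<eta> p (g i))"
  by (induction I rule: finite_induct) (simp_all add: walk_const walk_add)

text \<open>A live state has all means in [-1/2, 1/2] and one step moves each mean by at most
  \<open>\<eta> * sqrt N\<close>. The overshoot at the stopping time therefore stays in [-1, 1],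
  where product weights are still nonnegative. Pointwise inequalities that hold only on this box are
  transferred to the walk in this way.\<close>

lemma walk_nonneg_on_box:
  assumes "0 \<le> \<eta>" "\<eta> * sqrt N \<le> 1/2" "\<And>X. \<forall>m<2*N. \<bar>lin X m\<bar> \<le> 1 \<Longrightarrow> 0 \<le> g X"
  shows "0 \<le> walk \<eta> p g"
  using assms(3)
proof (induction p arbitrary: g)
  case 0
  then show ?case by (simp add: walk_0 lin_def)
next
  case (Suc p)
  show ?case unfolding walk_Suc
  proof (rule Suc.IH)
    fix X assume box: "\<forall>m<2*N. \<bar>lin X m\<bar> \<le> 1"
    show "0 \<le> step \<eta> g X"
    proof (cases "good X")
      case True
      have "0 \<le> g (\<lambda>i. X i + \<eta> * u $ i)" if u: "u \<in> sign_cube N" for u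
      proof (rule Suc.prems, intro allI impI)
        fix m assume m: "m < 2 * N"
        have "\<bar>\<eta> * lin (($) u) m\<bar> \<le> \<eta> * sqrt N"
          unfolding abs_mult using assms(1) abs_lin_sign_le[OF u m] by (simp add: mult_left_mono)
        then have "\<bar>\<eta> * lin (($) u) m\<bar> \<le> 1/2" using assms(2) by linarith
        moreover have "\<bar>lin X m\<bar> \<le> 1/2" using True m by (simp add: good_def)
        ultimately show "\<bar>lin (\<lambda>i. X i + \<eta> * u $ i) m\<bar> \<le> 1" unfolding lin_add by linarith
      qed
      then have "unif (\<lambda>_. 0) \<le> unif (\<lambda>u. g (\<lambda>i. X i + \<eta> * u $ i))" by (intro cube_expect_mono) auto
      then show ?thesis using True by (simp add: step_def cube_expect_const)
    next
      case False
      then show ?thesis using Suc.prems[OF box] by (simp add: step_def)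
    qed
  qed
qed

lemma walk_increment_le:
  assumes "\<And>X. \<bar>step \<eta> g X - g X\<bar> \<le> c"
  shows "\<bar>walk \<eta> p g - g (\<lambda>_. 0)\<bar> \<le> p * c"
proof (induction p)
  case 0
  then show ?case by (simp add: walk_0)
next
  case (Suc p)
  have "walk \<eta> p (\<lambda>X. step \<eta> g X - g X) \<le> walk \<eta> p (\<lambda>_. c)" "walk \<eta> p (\<lambda>_. - c) \<le> walk \<eta> p (\<lambda>X. step \<eta> g X - g X)"
    using assms by (intro walk_mono; (simp add: abs_le_iff)?; smt (verit))+
  then have "\<bar>walk \<eta> (Suc p) g - walk \<eta> p g\<bar> \<le> c" by (simp add: walk_const walk_diff walk_Suc)
  then show ?case using Suc by (simp add: distrib_right)
qed

text \<open>After the change of measure, u occurs only in the product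
  \<open>\<Prod> 1 + \<eta> * lin u i * \<psi> i\<close>. Averaging kills the first order, and the
  second-order coefficient is exactly \<open>pair_form \<psi>\<close> since forms from the same half
  are uncorrelated. The base of the cubic constant comes from
  \<open>\<bar>lin u i\<bar> \<le> sqrt N\<close> and
  \<open>\<bar>\<psi> i\<bar> \<le> 2\<close>.\<close>

lemma unif_dtree_ext:
  assumes T: "read_once T" "dtree_over (2 * N) T" "dtree_depth T \<le> d" and d: "d \<ge> 4"
    and X: "good X" and \<eta>: "0 \<le> \<eta>" "\<eta> \<le> 1"
  shows "\<bar>unif (\<lambda>u. dtree_ext T (lin (\<lambda>i. X i + \<eta> * u $ i))) - dtree_ext T (lin X)\<bar>
    \<le> \<eta>\<^sup>2 * (16 * d * (ln (2 * N) + 4) / sqrt N) + \<eta> ^ 3 * (1 + 2 * (2 * sqrt N)) ^ (2 * N)"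
proof -
  define v where "v = lin X"
  have v: "\<And>i. i < 2 * N \<Longrightarrow> \<bar>v i\<bar> \<le> 1/2" using X by (simp add: good_def v_def)
  then have v1: "\<And>i. i < 2 * N \<Longrightarrow> \<bar>v i\<bar> < 1" by force
  define C where "C = (1 + 2 * (2 * sqrt N)) ^ (2 * N)"
  define A where "A \<psi> = unif (\<lambda>u. \<Prod>i<2*N. 1 + \<eta> * (lin (($) u) i * \<psi> i))" for \<psi>
  have ext_eq: "dtree_ext T (\<lambda>i. v i + w i) = leaf_expect v (\<lambda>_. 0) T (\<lambda>\<psi> s. s * (\<Prod>i<2*N. 1 + w i * \<psi> i))" for w
    using dtree_ext_shift[of T "2 * N" v "\<lambda>_. 0" w] T v1 by simp
  have ext0: "dtree_ext T v = leaf_expect v (\<lambda>_. 0) T (\<lambda>\<psi> s. s)" using ext_eq[of "\<lambda>_. 0"] by simp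
  have "unif (\<lambda>u. dtree_ext T (lin (\<lambda>i. X i + \<eta> * u $ i)))
    = leaf_expect v (\<lambda>_. 0) T (\<lambda>\<psi> s. s * A \<psi>)"
    unfolding lin_add v_def[symmetric] ext_eq leaf_expect_cube cube_expect_cmult A_def by (simp only: mult.assoc)
  then have diff: "unif (\<lambda>u. dtree_ext T (lin (\<lambda>i. X i + \<eta> * u $ i))) - dtree_ext T (lin X)
    = leaf_expect v (\<lambda>_. 0) T (\<lambda>\<psi> s. s * A \<psi> + (- 1) * s)"
    unfolding leaf_expect_add leaf_expect_cmult v_def[symmetric] ext0 by simp
  have A: "\<bar>A \<psi> - 1\<bar> \<le> \<eta>\<^sup>2 * \<bar>pair_form \<psi>\<bar> + \<eta> ^ 3 * C" if \<psi>: "\<And>i. \<bar>\<psi> i\<bar> \<le> 2" for \<psi>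
  proof -
    define a where "a u i = lin (($) u) i * \<psi> i" for u i
    define Q where "Q u = 1 + \<eta> * (\<Sum>i<2*N. a u i) + \<eta>\<^sup>2 * (\<Sum>i<2*N. \<Sum>j<i. a u i * a u j)" for u
    have a: "\<bar>a u i\<bar> \<le> 2 * sqrt N" if "u \<in> sign_cube N" "i < 2 * N" for u i
      unfolding a_def abs_mult using mult_mono[OF abs_lin_sign_le[OF that] \<psi>[of i]] by (simp add: mult.commute)
    have so: "\<bar>(\<Prod>i<2*N. 1 + \<eta> * a u i) - Q u\<bar> \<le> \<eta> ^ 3 * C" if "u \<in> sign_cube N" for u
      unfolding Q_def C_def using a[OF that] by (intro prod_second_order[OF \<eta>]) auto
    have "A \<psi> \<le> unif (\<lambda>u. Q u + \<eta> ^ 3 * C)" "unif (\<lambda>u. Q u - \<eta> ^ 3 * C) \<le> A \<psi>"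
      unfolding A_def a_def[symmetric] using so by (intro cube_expect_mono; force simp: abs_le_iff)+
    then have AQ: "\<bar>A \<psi> - unif Q\<bar> \<le> \<eta> ^ 3 * C"
      by (simp add: cube_expect_add cube_expect_diff cube_expect_const abs_le_iff)
    have "unif (\<lambda>u. a u i) = 0" if "i < 2 * N" for i
      using unif_lin[OF that] cube_expect_cmult[of N "\<lambda>_. 0" "\<psi> i" "\<lambda>u. lin (($) u) i"]
      by (simp add: a_def mult.commute)
    moreover have "unif (\<lambda>u. a u i * a u j) = (if j < N \<and> N \<le> i then H j (i - N) else 0) * (\<psi> i * \<psi> j)" if "i < 2 * N" "j < i" for i j
      using unif_lin_lin[OF that] cube_expect_cmult[of N "\<lambda>_. 0" "\<psi> i * \<psi> j" "\<lambda>u. lin (($) u) i * lin (($) u) j"]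
      by (simp add: a_def mult_ac)
    ultimately have "unif Q = 1 + \<eta>\<^sup>2 * (\<Sum>i<2*N. \<Sum>j<i. (if j < N \<and> N \<le> i then H j (i - N) else 0) * (\<psi> i * \<psi> j))"
      unfolding Q_def cube_expect_add cube_expect_const cube_expect_cmult cube_expect_sum by simp
    also have "(\<Sum>i<2*N. \<Sum>j<i. (if j < N \<and> N \<le> i then H j (i - N) else 0) * (\<psi> i * \<psi> j)) = pair_form \<psi>"
    proof -
      have "(\<Sum>i<2*N. \<Sum>j<i. (if j < N \<and> N \<le> i then H j (i - N) else 0) * (\<psi> i * \<psi> j))
        = (\<Sum>i\<in>{N..<2*N}. \<Sum>j<i. (if j < N \<and> N \<le> i then H j (i - N) else 0) * (\<psi> i * \<psi> j))"
        by (rule sum.mono_neutral_right) auto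
      also have "\<dots> = (\<Sum>i\<in>{N..<2*N}. \<Sum>j<N. H j (i - N) * (\<psi> i * \<psi> j))"
      proof (rule sum.cong[OF refl])
        fix i assume i: "i \<in> {N..<2*N}"
        have "(\<Sum>j<i. (if j < N \<and> N \<le> i then H j (i - N) else 0) * (\<psi> i * \<psi> j))
          = (\<Sum>j<N. (if j < N \<and> N \<le> i then H j (i - N) else 0) * (\<psi> i * \<psi> j))"
          using i by (intro sum.mono_neutral_right) auto
        then show "(\<Sum>j<i. (if j < N \<and> N \<le> i then H j (i - N) else 0) * (\<psi> i * \<psi> j)) = (\<Sum>j<N. H j (i - N) * (\<psi> i * \<psi> j))"
          using i by simp
      qed
      also have "\<dots> = (\<Sum>i<N. \<Sum>j<N. H j i * (\<psi> (N + i) * \<psi> j))"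
        by (rule sum.reindex_bij_witness[of _ "\<lambda>i. N + i" "\<lambda>i. i - N"]) auto
      also have "\<dots> = pair_form \<psi>"
        unfolding pair_form_def by (subst sum.swap) (simp add: mult_ac)
      finally show ?thesis .
    qed
    finally have "unif Q = 1 + \<eta>\<^sup>2 * pair_form \<psi>" .
    moreover have "\<bar>\<eta>\<^sup>2 * pair_form \<psi>\<bar> = \<eta>\<^sup>2 * \<bar>pair_form \<psi>\<bar>" by (simp add: abs_mult)
    ultimately show ?thesis using AQ by linarith
  qed
  have bd: "\<bar>s * A \<psi> + (- 1) * s\<bar> \<le> \<eta>\<^sup>2 * \<bar>pair_form \<psi>\<bar> + \<eta> ^ 3 * C" if "\<And>i. \<bar>\<psi> i\<bar> \<le> 2" "\<bar>s\<bar> = 1" for \<psi> s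
  proof -
    have "s * A \<psi> + (- 1) * s = s * (A \<psi> - 1)" by (simp add: algebra_simps)
    then show ?thesis using A[OF that(1)] that(2) by (simp add: abs_mult)
  qed
  define b where "b = \<eta>\<^sup>2 * (16 * d * (ln (2 * N) + 4) / sqrt N) + \<eta> ^ 3 * C"
  have up: "leaf_expect v (\<lambda>_. 0) T (\<lambda>\<psi> s. \<eta>\<^sup>2 * \<bar>pair_form \<psi>\<bar> + \<eta> ^ 3 * C) \<le> b"
    unfolding leaf_expect_add leaf_expect_cmult leaf_expect_const b_def
    using leaf_expect_abs_pair_form[of T d v, OF T d v] \<eta> by (intro add_mono mult_left_mono) auto
  have "leaf_expect v (\<lambda>_. 0) T (\<lambda>\<psi> s. s * A \<psi> + (- 1) * s) \<le> leaf_expect v (\<lambda>_. 0) T (\<lambda>\<psi> s. \<eta>\<^sup>2 * \<bar>pair_form \<psi>\<bar> + \<eta> ^ 3 * C)"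
    using bd by (intro leaf_expect_mono[OF T(2) v]) (auto simp: abs_le_iff)
  moreover have "leaf_expect v (\<lambda>_. 0) T (\<lambda>\<psi> s. (- 1) * (\<eta>\<^sup>2 * \<bar>pair_form \<psi>\<bar> + \<eta> ^ 3 * C)) \<le> leaf_expect v (\<lambda>_. 0) T (\<lambda>\<psi> s. s * A \<psi> + (- 1) * s)"
  proof (rule leaf_expect_mono[OF T(2) v])
    fix \<psi> :: "nat \<Rightarrow> real" and s :: real
    assume a: "\<And>i. \<bar>\<psi> i\<bar> \<le> 2" and b: "\<bar>s\<bar> = 1"
    from bd[of \<psi> s, OF a b] show "(- 1) * (\<eta>\<^sup>2 * \<bar>pair_form \<psi>\<bar> + \<eta> ^ 3 * C) \<le> s * A \<psi> + (- 1) * s"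
      unfolding mult_minus1 by (simp only: abs_le_iff) linarith
  qed auto
  ultimately show ?thesis
    using up unfolding diff leaf_expect_cmult b_def C_def by linarith
qed

end

section \<open>Tails and moments of the walk, and the forrelated distribution\<close>

context flat_orthogonal
begin

lemma unif_exp_lin:
  assumes "m < 2 * N" "\<bar>s\<bar> \<le> 1"
  shows "unif (\<lambda>u. exp (s * lin (($) u) m)) \<le> exp (s\<^sup>2)"
proof -
  obtain c where c: "\<And>X. lin X m = (\<Sum>i<N. c i * X i)" "(\<Sum>i<N. (c i)\<^sup>2) = 1" "\<And>i. i < N \<Longrightarrow> \<bar>c i\<bar> \<le> 1"
    using lin_eq_sum[OF assms(1)] by blast
  have "unif (\<lambda>u. exp (s * lin (($) u) m)) = unif (\<lambda>u. \<Prod>i<N. exp (s * c i * u $ i))"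
    by (simp add: c(1) sum_distrib_left exp_sum mult.assoc)
  also have "\<dots> = (\<Prod>i<N. cosh (s * c i))"
    by (subst cube_expect_prod[where g = "\<lambda>i x. exp (s * c i * x)"]) (simp add: cosh_field_def field_simps)
  also have "\<dots> \<le> (\<Prod>i<N. exp ((s * c i)\<^sup>2))"
  proof (rule prod_mono)
    fix i assume "i \<in> {..<N}"
    then have "\<bar>s * c i\<bar> \<le> 1 * 1" unfolding abs_mult using assms c(3) by (intro mult_mono) auto
    then show "0 \<le> cosh (s * c i) \<and> cosh (s * c i) \<le> exp ((s * c i)\<^sup>2)"
      using cosh_le_exp_square by simp
  qed
  also have "\<dots> = exp (s\<^sup>2)" using c(2) by (simp add: exp_sum[symmetric] power_mult_distrib sum_distrib_left[symmetric])
  finally show ?thesis .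
qed

text \<open>A live step multiplies the expectation of cosh by at most
  \<open>exp ((\<mu> * \<eta>)\<^sup>2)\<close>; a stopped state leaves cosh unchanged, which the
  same factor covers.\<close>

lemma walk_cosh_le:
  assumes "m < 2 * N" "0 \<le> \<mu>" "0 \<le> \<eta>" "\<mu> * \<eta> \<le> 1"
  shows "walk \<eta> p (\<lambda>X. cosh (\<mu> * lin X m)) \<le> exp ((\<mu> * \<eta>)\<^sup>2 * p)"
proof (induction p)
  case 0
  then show ?case by (simp add: walk_0 lin_def)
next
  case (Suc p)
  define s where "s = \<mu> * \<eta>"
  have s: "\<bar>s\<bar> \<le> 1" "\<bar>- s\<bar> \<le> 1" using assms by (auto simp: s_def)
  have "step \<eta> (\<lambda>X. cosh (\<mu> * lin X m)) X \<le> exp (s\<^sup>2) * cosh (\<mu> * lin X m)" for X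
  proof (cases "good X")
    case True
    have "unif (\<lambda>u. cosh (\<mu> * lin (\<lambda>i. X i + \<eta> * u $ i) m))
      = unif (\<lambda>u. exp (\<mu> * lin X m) / 2 * exp (s * lin (($) u) m) + exp (- (\<mu> * lin X m)) / 2 * exp ((- s) * lin (($) u) m))"
    proof (rule cube_expect_cong)
      fix u
      have "\<mu> * lin (\<lambda>i. X i + \<eta> * u $ i) m = \<mu> * lin X m + s * lin (($) u) m"
        unfolding lin_add by (simp add: s_def algebra_simps)
      then show "cosh (\<mu> * lin (\<lambda>i. X i + \<eta> * u $ i) m)
        = exp (\<mu> * lin X m) / 2 * exp (s * lin (($) u) m) + exp (- (\<mu> * lin X m)) / 2 * exp ((- s) * lin (($) u) m)"
        by (simp add: cosh_field_def add_divide_distrib flip: exp_add)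
    qed
    also have "\<dots> \<le> exp (\<mu> * lin X m) / 2 * exp (s\<^sup>2) + exp (- (\<mu> * lin X m)) / 2 * exp ((- s)\<^sup>2)"
      unfolding cube_expect_add cube_expect_cmult
      by (intro add_mono mult_left_mono unif_exp_lin[OF assms(1)] s) auto
    also have "\<dots> = exp (s\<^sup>2) * cosh (\<mu> * lin X m)" by (simp add: cosh_field_def field_simps)
    finally show ?thesis using True by (simp add: step_def)
  next
    case False
    have "1 * cosh (\<mu> * lin X m) \<le> exp (s\<^sup>2) * cosh (\<mu> * lin X m)" by (intro mult_right_mono) auto
    then show ?thesis using False by (simp add: step_def)
  qed
  then have "walk \<eta> (Suc p) (\<lambda>X. cosh (\<mu> * lin X m)) \<le> walk \<eta> p (\<lambda>X. exp (s\<^sup>2) * cosh (\<mu> * lin X m))"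
    unfolding walk_Suc by (rule walk_mono)
  also have "\<dots> \<le> exp (s\<^sup>2) * exp (s\<^sup>2 * p)"
    unfolding walk_cmult using Suc by (intro mult_left_mono) (auto simp: s_def)
  also have "\<dots> = exp (s\<^sup>2 * Suc p)" by (simp add: algebra_simps flip: exp_add)
  finally show ?case by (simp add: s_def)
qed

text \<open>Since the walk freezes once it has left the good set, its position after p steps reveals
  whether it ever left. A Chernoff and union bound at time p thus replaces a maximal
  inequality.\<close>

lemma walk_bad_le:
  assumes "0 \<le> \<mu>" "0 \<le> \<eta>" "\<mu> * \<eta> \<le> 1"
  shows "walk \<eta> p (\<lambda>X. of_bool (\<not> good X)) \<le> 4 * N * exp ((\<mu> * \<eta>)\<^sup>2 * p - \<mu> / 2)"
proof -
  have "of_bool (\<not> good X) \<le> (\<Sum>m<2*N. 2 * exp (- (\<mu> / 2)) * cosh (\<mu> * lin X m))" for X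
  proof (cases "good X")
    case True
    have "0 \<le> (\<Sum>m<2*N. 2 * exp (- (\<mu> / 2)) * cosh (\<mu> * lin X m))" by (intro sum_nonneg) auto
    then show ?thesis using True by simp
  next
    case False
    then obtain m where m: "m < 2 * N" "\<bar>lin X m\<bar> > 1/2" by (auto simp: good_def not_le)
    have "\<mu> / 2 \<le> \<bar>\<mu> * lin X m\<bar>" unfolding abs_mult using m assms mult_left_mono[of "1/2" "\<bar>lin X m\<bar>" \<mu>] by simp
    then have "exp (\<mu> / 2) \<le> exp \<bar>\<mu> * lin X m\<bar>" by simp
    also have "\<dots> \<le> 2 * cosh \<bar>\<mu> * lin X m\<bar>" by (simp add: cosh_field_def)
    also have "cosh \<bar>\<mu> * lin X m\<bar> = cosh (\<mu> * lin X m)" by (cases "\<mu> * lin X m \<ge> 0") auto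
    finally have "exp (- (\<mu> / 2)) * exp (\<mu> / 2) \<le> exp (- (\<mu> / 2)) * (2 * cosh (\<mu> * lin X m))"
      by (intro mult_left_mono) auto
    then have "1 \<le> 2 * exp (- (\<mu> / 2)) * cosh (\<mu> * lin X m)"
      using exp_minus_inverse[of "\<mu> / 2"] by (simp add: mult.commute mult.left_commute)
    also have "\<dots> \<le> (\<Sum>m<2*N. 2 * exp (- (\<mu> / 2)) * cosh (\<mu> * lin X m))"
      using m by (intro member_le_sum[where f = "\<lambda>m. 2 * exp (- (\<mu> / 2)) * cosh (\<mu> * lin X m)"]) auto
    finally show ?thesis using False by simp
  qed
  then have "walk \<eta> p (\<lambda>X. of_bool (\<not> good X)) \<le> walk \<eta> p (\<lambda>X. \<Sum>m<2*N. 2 * exp (- (\<mu> / 2)) * cosh (\<mu> * lin X m))"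
    by (rule walk_mono)
  also have "\<dots> = (\<Sum>m<2*N. 2 * exp (- (\<mu> / 2)) * walk \<eta> p (\<lambda>X. cosh (\<mu> * lin X m)))"
    by (simp only: walk_sum finite_lessThan walk_cmult)
  also have "\<dots> \<le> (\<Sum>m<2*N. 2 * exp (- (\<mu> / 2)) * exp ((\<mu> * \<eta>)\<^sup>2 * p))"
    using assms by (intro sum_mono mult_left_mono walk_cosh_le) auto
  also have "\<dots> = 4 * N * exp ((\<mu> * \<eta>)\<^sup>2 * p - \<mu> / 2)"
    unfolding diff_conv_add_uminus exp_add by simp
  finally show ?thesis .
qed

lemma step_square:
  assumes "i < N"
  shows "step \<eta> (\<lambda>X. (X i)\<^sup>2) X = (X i)\<^sup>2 + \<eta>\<^sup>2 * of_bool (good X)"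
proof -
  have "unif (\<lambda>u. (X i + \<eta> * u $ i)\<^sup>2) = unif (\<lambda>u. ((X i)\<^sup>2 + \<eta>\<^sup>2) + (2 * \<eta> * X i) * u $ i)"
  proof (rule cube_expect_cong)
    fix u assume "u \<in> sign_cube N"
    then have "u $ i = -1 \<or> u $ i = 1" using assms sign_cube_cases by blast
    then show "(X i + \<eta> * u $ i)\<^sup>2 = ((X i)\<^sup>2 + \<eta>\<^sup>2) + (2 * \<eta> * X i) * u $ i"
      by (elim disjE) (simp_all add: power2_eq_square algebra_simps)
  qed
  also have "\<dots> = (X i)\<^sup>2 + \<eta>\<^sup>2"
    unfolding cube_expect_add cube_expect_cmult cube_expect_const using assms by (simp add: cube_expect_index)
  finally show ?thesis by (simp add: step_def)
qed

lemma walk_square_le: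
  assumes "i < N"
  shows "walk \<eta> p (\<lambda>X. (X i)\<^sup>2) \<le> p * \<eta>\<^sup>2"
proof (induction p)
  case (Suc p)
  have "walk \<eta> (Suc p) (\<lambda>X. (X i)\<^sup>2) \<le> walk \<eta> p (\<lambda>X. (X i)\<^sup>2 + \<eta>\<^sup>2)"
    unfolding walk_Suc using assms by (intro walk_mono) (simp add: step_square)
  then show ?case using Suc by (simp add: walk_add walk_const distrib_right)
qed (simp add: walk_0)

text \<open>The bound is the fourth moment of a Gaussian with variance
  \<open>p * \<eta>\<^sup>2\<close>; stopping can only lower the moment.\<close>

lemma walk_fourth_le:
  assumes "i < N"
  shows "walk \<eta> p (\<lambda>X. (X i) ^ 4) \<le> 3 * (p * \<eta>\<^sup>2)\<^sup>2"
proof (induction p)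
  case (Suc p)
  have "step \<eta> (\<lambda>X. (X i) ^ 4) X \<le> (X i) ^ 4 + (6 * \<eta>\<^sup>2 * (X i)\<^sup>2 + \<eta> ^ 4)" for X
  proof (cases "good X")
    case True
    have "unif (\<lambda>u. (X i + \<eta> * u $ i) ^ 4)
      = unif (\<lambda>u. ((X i) ^ 4 + (6 * \<eta>\<^sup>2 * (X i)\<^sup>2 + \<eta> ^ 4)) + (4 * \<eta> * (X i) ^ 3 + 4 * \<eta> ^ 3 * X i) * u $ i)"
    proof (rule cube_expect_cong)
      fix u assume "u \<in> sign_cube N"
      then have "u $ i = -1 \<or> u $ i = 1" using assms sign_cube_cases by blast
      then show "(X i + \<eta> * u $ i) ^ 4 = ((X i) ^ 4 + (6 * \<eta>\<^sup>2 * (X i)\<^sup>2 + \<eta> ^ 4)) + (4 * \<eta> * (X i) ^ 3 + 4 * \<eta> ^ 3 * X i) * u $ i"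
        by (elim disjE) (simp_all add: power2_eq_square power3_eq_cube power4_eq_xxxx algebra_simps)
    qed
    also have "\<dots> = (X i) ^ 4 + (6 * \<eta>\<^sup>2 * (X i)\<^sup>2 + \<eta> ^ 4)"
      unfolding cube_expect_add cube_expect_cmult cube_expect_const using assms by (simp add: cube_expect_index)
    finally show ?thesis using True by (simp add: step_def)
  next
    case False
    then show ?thesis by (simp add: step_def)
  qed
  then have "walk \<eta> (Suc p) (\<lambda>X. (X i) ^ 4) \<le> walk \<eta> p (\<lambda>X. (X i) ^ 4 + (6 * \<eta>\<^sup>2 * (X i)\<^sup>2 + \<eta> ^ 4))"
    unfolding walk_Suc by (rule walk_mono)
  also have "\<dots> = walk \<eta> p (\<lambda>X. (X i) ^ 4) + (6 * \<eta>\<^sup>2 * walk \<eta> p (\<lambda>X. (X i)\<^sup>2) + \<eta> ^ 4)"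
    by (simp only: walk_add walk_cmult walk_const)
  also have "\<dots> \<le> 3 * (p * \<eta>\<^sup>2)\<^sup>2 + (6 * \<eta>\<^sup>2 * (p * \<eta>\<^sup>2) + \<eta> ^ 4)"
    using Suc walk_square_le[OF assms] by (intro add_mono mult_left_mono) auto
  also have "\<dots> \<le> 3 * (Suc p * \<eta>\<^sup>2)\<^sup>2"
  proof -
    have "3 * (Suc p * \<eta>\<^sup>2)\<^sup>2 = 3 * (p * \<eta>\<^sup>2)\<^sup>2 + (6 * \<eta>\<^sup>2 * (p * \<eta>\<^sup>2) + \<eta> ^ 4) + 2 * \<eta> ^ 4"
      by (simp add: power2_eq_square power4_eq_xxxx algebra_simps)
    then show ?thesis by simp
  qed
  finally show ?case .
qed (simp add: walk_0)

text \<open>A live step adds exactly \<open>N * \<eta>\<^sup>2\<close> in expectation, as its cross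
  terms average to 0. Only the probability of having stopped is lost.\<close>

lemma walk_sum_squares_ge:
  fixes \<eta> \<beta> :: real
  assumes "\<And>t. t < p \<Longrightarrow> walk \<eta> t (\<lambda>X. of_bool (\<not> good X)) \<le> \<beta>"
  shows "walk \<eta> p (\<lambda>X. \<Sum>i<N. (X i)\<^sup>2) \<ge> N * (p * \<eta>\<^sup>2 * (1 - \<beta>))"
  using assms
proof (induction p)
  case (Suc p)
  have "step \<eta> (\<lambda>X. \<Sum>i<N. (X i)\<^sup>2) = (\<lambda>X. (\<Sum>i<N. (X i)\<^sup>2) + (N * \<eta>\<^sup>2) * (1 - of_bool (\<not> good X)))"
  proof (rule ext)
    fix X :: "nat \<Rightarrow> real"
    have "step \<eta> (\<lambda>X. \<Sum>i<N. (X i)\<^sup>2) X = (\<Sum>i<N. step \<eta> (\<lambda>X. (X i)\<^sup>2) X)"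
      by (simp add: step_def cube_expect_sum)
    also have "\<dots> = (\<Sum>i<N. (X i)\<^sup>2 + \<eta>\<^sup>2 * of_bool (good X))" by (simp add: step_square)
    finally show "step \<eta> (\<lambda>X. \<Sum>i<N. (X i)\<^sup>2) X = (\<Sum>i<N. (X i)\<^sup>2) + (N * \<eta>\<^sup>2) * (1 - of_bool (\<not> good X))"
      by (simp add: sum.distrib)
  qed
  then have "walk \<eta> (Suc p) (\<lambda>X. \<Sum>i<N. (X i)\<^sup>2)
    = walk \<eta> p (\<lambda>X. \<Sum>i<N. (X i)\<^sup>2) + (N * \<eta>\<^sup>2) * (1 - walk \<eta> p (\<lambda>X. of_bool (\<not> good X)))"
    by (simp only: walk_Suc walk_add walk_cmult walk_diff walk_const)
  also have "\<dots> \<ge> N * (p * \<eta>\<^sup>2 * (1 - \<beta>)) + (N * \<eta>\<^sup>2) * (1 - \<beta>)"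
    using Suc by (intro add_mono mult_left_mono) auto
  finally show ?case by (simp add: algebra_simps)
qed (simp add: walk_0)

definition sign_forr :: "real vec \<Rightarrow> real" where
  "sign_forr z = pair_form (($) z) / N"

lemma uniform_sign_forr_square:
  "cube_expect (2 * N) (\<lambda>_. 0) (\<lambda>z. (sign_forr z)\<^sup>2) \<le> 3 / N"
proof -
  have "cube_expect (2 * N) (\<lambda>_. 0) (\<lambda>z. (sign_forr z)\<^sup>2)
    = 1 / N\<^sup>2 * cube_expect (2 * N) (\<lambda>_. 0) (\<lambda>z. (pair_form (($) z))\<^sup>2)"
    by (simp add: sign_forr_def power_divide flip: cube_expect_cmult)
  also have "\<dots> \<le> 1 / N\<^sup>2 * (3 * N)"
    using cube_expect_pair_form_square[of "\<lambda>_. 0"] by (intro mult_left_mono) (auto simp: pair_form_def)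
  also have "\<dots> = 3 / N" using N_pos by (simp add: power2_eq_square)
  finally show ?thesis .
qed

lemma forrelated_distribution_exists:
  fixes \<delta> :: real
  assumes N: "N \<ge> 2" and d: "d \<ge> 4" and \<delta>: "\<delta> = 1 / (32 * ln (real N))"
  obtains W where "\<And>z. z \<in> sign_cube (2 * N) \<Longrightarrow> W z \<ge> 0" "(\<Sum>z\<in>sign_cube (2 * N). W z) = 1"
    "\<And>T. dtree_over (2 * N) T \<Longrightarrow> dtree_depth T \<le> d \<Longrightarrow>
      \<bar>(\<Sum>z\<in>sign_cube (2 * N). W z * dtree_eval T z) - cube_expect (2 * N) (\<lambda>_. 0) (dtree_eval T)\<bar>
        \<le> \<delta> * (16 * real d * (ln (2 * real N) + 4) / sqrt (real N)) + 1 / N"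
    "(\<Sum>z\<in>sign_cube (2 * N). W z * sign_forr z) \<ge> \<delta> * (1 - 4 / N)"
    "(\<Sum>z\<in>sign_cube (2 * N). W z * (sign_forr z)\<^sup>2) \<le> 3 * \<delta>\<^sup>2 + 3 / N"
proof -
  have lnN: "ln (real N) > 0" using N by simp
  have \<delta>0: "\<delta> > 0" using lnN by (simp add: \<delta>)
  \<comment> \<open>This value gives
    \<open>\<mu>\<^sup>2 * \<delta> - \<mu> / 2 = - 2 * ln N\<close>, so that the union bound over
    the 2 N means leaves 4 / N.\<close>
  define \<mu> where "\<mu> = 8 * ln N"
  have \<mu>: "\<mu> > 0" using lnN by (simp add: \<mu>_def)
  define C where "C = (1 + 2 * (2 * sqrt N)) ^ (2 * N)"
  have C: "C > 0" by (simp add: C_def add_pos_nonneg)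
  \<comment> \<open>The four bounds on the step size serve the expansion of the product, the
    confinement of the overshoot, the exponential moments at \<mu>, and a total cubic error of at
    most 1 / N.\<close>
  define e where "e = Min {1, 1 / (2 * sqrt N), 1 / \<mu>, 1 / (N * \<delta> * C)}"
  have e: "e > 0" "e \<le> 1" "e \<le> 1 / (2 * sqrt N)" "e \<le> 1 / \<mu>" "e \<le> 1 / (N * \<delta> * C)"
    unfolding e_def using N_pos \<mu> \<delta>0 C by auto
  \<comment> \<open>The number of steps is large enough for
    \<open>sqrt (\<delta> / p) \<le> e\<close>, while the total variance
    \<open>p * \<eta>\<^sup>2\<close> is exactly \<delta>.\<close>
  define p where "p = Suc (nat \<lceil>\<delta> / e\<^sup>2\<rceil>)"
  define \<eta> where "\<eta> = sqrt (\<delta> / p)"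
  have p: "real p \<ge> \<delta> / e\<^sup>2" "p > 0" unfolding p_def by linarith+
  have \<eta>2: "p * \<eta>\<^sup>2 = \<delta>" using p \<delta>0 by (simp add: \<eta>_def)
  have \<eta>0: "\<eta> > 0" using p \<delta>0 by (simp add: \<eta>_def)
  have "\<delta> / p \<le> e\<^sup>2" using p e \<delta>0 by (simp add: field_simps)
  then have \<eta>e: "\<eta> \<le> e" using e unfolding \<eta>_def by (simp add: real_le_lsqrt)
  have \<eta>1: "\<eta> \<le> 1" using \<eta>e e by linarith
  have \<eta>N: "\<eta> * sqrt N \<le> 1/2"
  proof -
    have "\<eta> \<le> 1 / (2 * sqrt N)" using \<eta>e e by linarith
    then show ?thesis using N_pos by (simp add: field_simps)
  qed
  have \<eta>\<mu>: "\<mu> * \<eta> \<le> 1"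
  proof -
    have "\<eta> \<le> 1 / \<mu>" using \<eta>e e by linarith
    then show ?thesis using \<mu> by (simp add: field_simps)
  qed
  have \<eta>C: "p * (\<eta> ^ 3 * C) \<le> 1 / N"
  proof -
    have "p * (\<eta> ^ 3 * C) = (p * \<eta>\<^sup>2) * C * \<eta>" by (simp add: power2_eq_square power3_eq_cube)
    also have "\<dots> \<le> \<delta> * C * (1 / (N * \<delta> * C))"
      unfolding \<eta>2 using \<eta>e e \<delta>0 C by (intro mult_left_mono) auto
    also have "\<dots> = 1 / N" using \<delta>0 C by simp
    finally show ?thesis .
  qed
  have bad: "walk \<eta> t (\<lambda>X. of_bool (\<not> good X)) \<le> 4 / N" if "t < p" for t
  proof -
    have "walk \<eta> t (\<lambda>X. of_bool (\<not> good X)) \<le> 4 * N * exp ((\<mu> * \<eta>)\<^sup>2 * t - \<mu> / 2)"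
      by (rule walk_bad_le) (use \<mu> \<eta>0 \<eta>\<mu> in auto)
    also have "(\<mu> * \<eta>)\<^sup>2 * t - \<mu> / 2 \<le> \<mu>\<^sup>2 * (p * \<eta>\<^sup>2) - \<mu> / 2"
    proof -
      have "\<mu>\<^sup>2 * (t * \<eta>\<^sup>2) \<le> \<mu>\<^sup>2 * (p * \<eta>\<^sup>2)" using that by (intro mult_left_mono mult_right_mono) auto
      then show ?thesis by (simp add: power_mult_distrib mult_ac)
    qed
    also have "\<mu>\<^sup>2 * (p * \<eta>\<^sup>2) - \<mu> / 2 = - (2 * ln N)"
    proof -
      have "(8 * L)\<^sup>2 * (1 / (32 * L)) - 8 * L / 2 = - (2 * L)" if "L > 0" for L :: real
        using that by (simp add: power2_eq_square)
      from this[OF lnN] show ?thesis unfolding \<eta>2 \<delta> \<mu>_def .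
    qed
    also have "4 * N * exp (- (2 * ln N)) = 4 / N"
    proof -
      have "exp (- (2 * ln N)) = inverse (real N * real N)" unfolding exp_minus mult_2 exp_add using N_pos by simp
      then show ?thesis using N_pos by (simp add: divide_inverse)
    qed
    finally show ?thesis by (simp add: mult_left_mono)
  qed
  \<comment> \<open>A mixture of product measures over the end point of the walk. Stopped end points
    may have means beyond 1/2, but not beyond 1, so this is a genuine distribution.\<close>
  define W where "W z = walk \<eta> p (\<lambda>X. \<Prod>i<2*N. (1 + z $ i * lin X i) / 2)" for z :: "real vec"
  have W: "(\<Sum>z\<in>sign_cube (2 * N). W z * g z) = walk \<eta> p (\<lambda>X. cube_expect (2 * N) (lin X) g)" for g
  proof -
    have "walk \<eta> p (\<lambda>X. (\<Prod>i<2*N. (1 + z $ i * lin X i) / 2) * g z) = W z * g z" for z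
      using walk_cmult[of \<eta> p "g z" "\<lambda>X. \<Prod>i<2*N. (1 + z $ i * lin X i) / 2"] by (simp only: W_def mult.commute[of "g z"])
    then show ?thesis unfolding cube_expect_def by (simp only: walk_sum[OF finite_sign_cube])
  qed
  show ?thesis
  proof (rule that[of W])
    show "W z \<ge> 0" if "z \<in> sign_cube (2 * N)" for z
      unfolding W_def
    proof (rule walk_nonneg_on_box[OF less_imp_le[OF \<eta>0] \<eta>N])
      fix X assume X: "\<forall>m<2*N. \<bar>lin X m\<bar> \<le> 1"
      show "0 \<le> (\<Prod>i<2*N. (1 + z $ i * lin X i) / 2)"
        by (rule cube_weight_nonneg[OF that]) (use X in simp)
    qed
    show "(\<Sum>z\<in>sign_cube (2 * N). W z) = 1"
      using W[of "\<lambda>_. 1"] by (simp add: cube_expect_const walk_const)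
    show "\<bar>(\<Sum>z\<in>sign_cube (2 * N). W z * dtree_eval T z) - cube_expect (2 * N) (\<lambda>_. 0) (dtree_eval T)\<bar>
        \<le> \<delta> * (16 * real d * (ln (2 * real N) + 4) / sqrt (real N)) + 1 / N" if T: "dtree_over (2 * N) T" "dtree_depth T \<le> d" for T
    proof -
      obtain T' where T': "read_once T'" "dtree_over (2 * N) T'" "dtree_depth T' \<le> d"
        "\<And>z. dtree_eval T' z = dtree_eval T z" using read_once_exists[OF T] by blast
      have ev: "dtree_eval T = dtree_eval T'" using T'(4) by auto
      define b where "b = \<eta>\<^sup>2 * (16 * real d * (ln (2 * real N) + 4) / sqrt (real N)) + \<eta> ^ 3 * C"
      have b0: "b \<ge> 0" using \<eta>0 C N by (simp add: b_def)
      have "\<bar>step \<eta> (\<lambda>X. dtree_ext T' (lin X)) X - dtree_ext T' (lin X)\<bar> \<le> b" for X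
        using unif_dtree_ext[OF T'(1-3) d, of X \<eta>] \<eta>0 \<eta>1 b0 by (auto simp: step_def b_def C_def)
      then have "\<bar>walk \<eta> p (\<lambda>X. dtree_ext T' (lin X)) - dtree_ext T' (lin (\<lambda>_. 0))\<bar> \<le> p * b"
        by (rule walk_increment_le)
      also have "lin (\<lambda>_. 0) = (\<lambda>_. 0)" by (rule ext) (simp add: lin_def)
      also have "p * b = (p * \<eta>\<^sup>2) * (16 * real d * (ln (2 * real N) + 4) / sqrt (real N)) + p * (\<eta> ^ 3 * C)"
        by (simp add: b_def algebra_simps)
      also have "\<dots> \<le> \<delta> * (16 * real d * (ln (2 * real N) + 4) / sqrt (real N)) + 1 / N"
        unfolding \<eta>2 using \<eta>C by simp
      finally show ?thesis unfolding W ev by (simp add: cube_expect_dtree[OF T'(1,2)])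
    qed
    have "N * (\<delta> * (1 - 4 / N)) \<le> walk \<eta> p (\<lambda>X. \<Sum>i<N. (X i)\<^sup>2)"
      using walk_sum_squares_ge[of p \<eta> "4 / N", OF bad] unfolding \<eta>2 .
    also have "\<dots> = N * walk \<eta> p (\<lambda>X. cube_expect (2 * N) (lin X) sign_forr)"
    proof -
      have "cube_expect (2 * N) (lin X) sign_forr = 1 / N * (\<Sum>i<N. (X i)\<^sup>2)" for X
        using cube_expect_cmult[of "2 * N" "lin X" "1 / N" "\<lambda>z. pair_form (($) z)"]
        by (simp add: sign_forr_def[abs_def] cube_expect_pair_form pair_form_lin)
      then show ?thesis using N_pos by (simp only: walk_cmult) simp
    qed
    finally show "(\<Sum>z\<in>sign_cube (2 * N). W z * sign_forr z) \<ge> \<delta> * (1 - 4 / N)"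
      unfolding W using N_pos by (simp add: mult.assoc)
    \<comment> \<open>The variance bound for a product measure requires means in [-1, 1], so the
      comparison goes through positivity on the box and not through monotonicity of the
      walk.\<close>
    have "0 \<le> walk \<eta> p (\<lambda>X. (1 / N * (\<Sum>i<N. (X i) ^ 4) + 3 / N) - cube_expect (2 * N) (lin X) (\<lambda>z. (sign_forr z)\<^sup>2))"
    proof (rule walk_nonneg_on_box[OF less_imp_le[OF \<eta>0] \<eta>N])
      fix X assume "\<forall>m<2*N. \<bar>lin X m\<bar> \<le> 1"
      then have "cube_expect (2 * N) (lin X) (\<lambda>z. (pair_form (($) z))\<^sup>2) \<le> (pair_form (lin X))\<^sup>2 + 3 * N"
        by (intro cube_expect_pair_form_square) auto
      also have "(pair_form (lin X))\<^sup>2 \<le> N * (\<Sum>i<N. (X i) ^ 4)"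
      proof -
        have "(\<Sum>i<N. (X i)\<^sup>2)\<^sup>2 \<le> (\<Sum>i<N. ((X i)\<^sup>2)\<^sup>2) * card {..<N}"
          by (rule sum_squared_le_sum_of_squares)
        then show ?thesis by (simp add: pair_form_lin mult.commute flip: power_mult)
      qed
      finally have "1 / N\<^sup>2 * cube_expect (2 * N) (lin X) (\<lambda>z. (pair_form (($) z))\<^sup>2) \<le> 1 / N\<^sup>2 * (N * (\<Sum>i<N. (X i) ^ 4) + 3 * N)"
        by (intro mult_left_mono) auto
      also have "\<dots> = 1 / N * (\<Sum>i<N. (X i) ^ 4) + 3 / N" using N_pos by (simp add: power2_eq_square field_simps)
      also have "1 / N\<^sup>2 * cube_expect (2 * N) (lin X) (\<lambda>z. (pair_form (($) z))\<^sup>2) = cube_expect (2 * N) (lin X) (\<lambda>z. (sign_forr z)\<^sup>2)"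
        by (simp add: sign_forr_def power_divide flip: cube_expect_cmult)
      finally show "0 \<le> (1 / N * (\<Sum>i<N. (X i) ^ 4) + 3 / N) - cube_expect (2 * N) (lin X) (\<lambda>z. (sign_forr z)\<^sup>2)"
        by simp
    qed
    then have "walk \<eta> p (\<lambda>X. cube_expect (2 * N) (lin X) (\<lambda>z. (sign_forr z)\<^sup>2)) \<le> 1 / N * (\<Sum>i<N. walk \<eta> p (\<lambda>X. (X i) ^ 4)) + 3 / N"
      unfolding walk_diff walk_add walk_cmult walk_const by (simp add: walk_sum)
    also have "\<dots> \<le> 1 / N * (\<Sum>i<N. 3 * \<delta>\<^sup>2) + 3 / N"
      using walk_fourth_le[of _ \<eta> p] unfolding \<eta>2 by (intro add_right_mono mult_left_mono sum_mono) auto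
    also have "\<dots> = 3 * \<delta>\<^sup>2 + 3 / N" using N_pos by simp
    finally show "(\<Sum>z\<in>sign_cube (2 * N). W z * (sign_forr z)\<^sup>2) \<le> 3 * \<delta>\<^sup>2 + 3 / N" unfolding W .
  qed
qed

end

section \<open>Hard distributions for the XOR\<close>

definition cut :: "nat \<Rightarrow> bool \<Rightarrow> (real vec \<Rightarrow> real) \<Rightarrow> real vec \<Rightarrow> real" where
  "cut i b \<nu> z = (if (z $ i = -1) = b then \<nu> z else 0)"

text \<open>The largest correlation of \<nu> with a tree of depth at most d. A query splits \<nu>
  into its unnormalised restrictions to two subcubes, each of which is then correlated on its own.
  Inserting the previous value makes the norm monotone in d and keeps the set under
  \<open>Max\<close> nonempty.\<close>

fun tree_norm :: "nat \<Rightarrow> nat \<Rightarrow> (real vec \<Rightarrow> real) \<Rightarrow> real" where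
  "tree_norm M 0 \<nu> = \<bar>\<Sum>z\<in>sign_cube M. \<nu> z\<bar>"
| "tree_norm M (Suc d) \<nu> = Max (insert (tree_norm M d \<nu>)
     ((\<lambda>i. tree_norm M d (cut i True \<nu>) + tree_norm M d (cut i False \<nu>)) ` {..<M}))"

lemma tree_norm_mono: "d \<le> e \<Longrightarrow> tree_norm M d \<nu> \<le> tree_norm M e \<nu>"
  by (induction e rule: dec_induct) (auto intro: order_trans)

lemma tree_norm_nonneg: "0 \<le> tree_norm M d \<nu>"
  using tree_norm_mono[of 0 d M \<nu>] abs_ge_zero[of "\<Sum>z\<in>sign_cube M. \<nu> z"] by (simp del: abs_ge_zero)

lemma tree_norm_cut: "i < M \<Longrightarrow> tree_norm M d (cut i True \<nu>) + tree_norm M d (cut i False \<nu>) \<le> tree_norm M (Suc d) \<nu>"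
  by auto

text \<open>The link between the two sides: the XOR bound is phrased with the norm, while
  indistinguishability on one block is known for trees.\<close>

lemma tree_norm_attained:
  "\<exists>t. dtree_over M t \<and> dtree_depth t \<le> d \<and> tree_norm M d \<nu> = (\<Sum>z\<in>sign_cube M. \<nu> z * dtree_eval t z)"
proof (induction d arbitrary: \<nu>)
  case 0
  define s where "s = (\<Sum>z\<in>sign_cube M. \<nu> z)"
  show ?case
  proof (cases "s \<ge> 0")
    case True
    then show ?thesis by (intro exI[of _ "Leaf 1"]) (simp add: s_def)
  next
    case False
    then show ?thesis by (intro exI[of _ "Leaf (-1)"]) (simp add: s_def sum_negf)
  qed
next
  case (Suc d)
  have "tree_norm M (Suc d) \<nu> \<in> insert (tree_norm M d \<nu>)
     ((\<lambda>i. tree_norm M d (cut i True \<nu>) + tree_norm M d (cut i False \<nu>)) ` {..<M})"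
    unfolding tree_norm.simps by (rule Max_in) auto
  then consider "tree_norm M (Suc d) \<nu> = tree_norm M d \<nu>"
    | i where "i < M" "tree_norm M (Suc d) \<nu> = tree_norm M d (cut i True \<nu>) + tree_norm M d (cut i False \<nu>)"
    by auto
  then show ?case
  proof cases
    case 1
    obtain t where "dtree_over M t" "dtree_depth t \<le> d" "tree_norm M d \<nu> = (\<Sum>z\<in>sign_cube M. \<nu> z * dtree_eval t z)"
      using Suc by blast
    then show ?thesis using 1 by (intro exI[of _ t]) auto
  next
    case (2 i)
    obtain t where t: "dtree_over M t" "dtree_depth t \<le> d"
      "tree_norm M d (cut i True \<nu>) = (\<Sum>z\<in>sign_cube M. cut i True \<nu> z * dtree_eval t z)" using Suc by blast
    obtain t' where t': "dtree_over M t'" "dtree_depth t' \<le> d"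
      "tree_norm M d (cut i False \<nu>) = (\<Sum>z\<in>sign_cube M. cut i False \<nu> z * dtree_eval t' z)" using Suc by blast
    have "tree_norm M (Suc d) \<nu> = (\<Sum>z\<in>sign_cube M. \<nu> z * dtree_eval (Query i t t') z)"
      unfolding 2(2) t(3) t'(3) sum.distrib[symmetric] by (intro sum.cong) (auto simp: cut_def)
    then show ?thesis using 2 t t' by (intro exI[of _ "Query i t t'"]) auto
  qed
qed

text \<open>The root queries a coordinate of one block a and cuts only the weight of that block, so
  for each answer the weight is again a product and the induction hypothesis applies; the norms of
  the two cuts add up to at most the norm for one more query. Each factor is allowed the full budget
  d, so how the queries are distributed over the blocks is irrelevant. The weights vary with j
  because the induction changes one factor at a time.\<close>

lemma xor_correlation_le:
  assumes "dtree_over (k * L) T" "dtree_depth T \<le> d"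
  shows "\<bar>\<Sum>z\<in>sign_cube (k * L). (\<Prod>j<k. \<nu> j (block L z j)) * dtree_eval T z\<bar> \<le> (\<Prod>j<k. tree_norm L d (\<nu> j))"
  using assms
proof (induction T arbitrary: d \<nu>)
  case (Leaf s)
  have "(\<Sum>z\<in>sign_cube (k * L). (\<Prod>j<k. \<nu> j (block L z j)) * s) = (\<Prod>j<k. \<Sum>y\<in>sign_cube L. \<nu> j y) * s"
    by (simp only: sum_distrib_right[symmetric] sum_prod_blocks)
  then have "\<bar>\<Sum>z\<in>sign_cube (k * L). (\<Prod>j<k. \<nu> j (block L z j)) * dtree_eval (Leaf s) z\<bar> = (\<Prod>j<k. tree_norm L 0 (\<nu> j))"
    using Leaf by (auto simp: abs_mult abs_prod)
  also have "\<dots> \<le> (\<Prod>j<k. tree_norm L d (\<nu> j))"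
    by (intro prod_mono conjI tree_norm_mono tree_norm_nonneg) simp
  finally show ?case .
next
  case (Query i l r)
  then obtain e where d: "d = Suc e" by (cases d) auto
  have i: "i < k * L" using Query by simp
  then have L: "L > 0" by (cases L) auto
  define a where "a = i div L"
  define b where "b = i mod L"
  have ab: "i = a * L + b" "b < L" using L by (auto simp: a_def b_def)
  have a: "a < k" using i L by (simp add: a_def less_mult_imp_div_less)
  define \<nu>' where "\<nu>' c = \<nu>(a := cut b c (\<nu> a))" for c
  define P where "P = (\<Prod>j\<in>{..<k}-{a}. tree_norm L d (\<nu> j))"
  have P0: "P \<ge> 0" unfolding P_def by (intro prod_nonneg) (auto intro: tree_norm_nonneg)
  have split: "(\<Prod>j<k. f j) = f a * (\<Prod>j\<in>{..<k}-{a}. f j)" for f :: "nat \<Rightarrow> real"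
    by (rule prod.remove) (use a in auto)
  have pr: "(\<Prod>j<k. \<nu>' c j (block L z j)) = (if (z $ i = -1) = c then \<Prod>j<k. \<nu> j (block L z j) else 0)" for c z
  proof -
    have "block L z a $ b = z $ i" using ab by (simp add: block_def)
    moreover have "(\<Prod>j\<in>{..<k}-{a}. \<nu>' c j (block L z j)) = (\<Prod>j\<in>{..<k}-{a}. \<nu> j (block L z j))"
      by (intro prod.cong) (auto simp: \<nu>'_def)
    ultimately show ?thesis unfolding split by (simp add: \<nu>'_def cut_def)
  qed
  have nb: "(\<Prod>j<k. tree_norm L e (\<nu>' c j)) \<le> tree_norm L e (cut b c (\<nu> a)) * P" for c
  proof -
    have "(\<Prod>j\<in>{..<k}-{a}. tree_norm L e (\<nu>' c j)) = (\<Prod>j\<in>{..<k}-{a}. tree_norm L e (\<nu> j))"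
      by (intro prod.cong) (auto simp: \<nu>'_def)
    also have "\<dots> \<le> P" unfolding P_def d
      by (intro prod_mono conjI tree_norm_mono tree_norm_nonneg) simp
    finally show ?thesis unfolding split by (simp add: \<nu>'_def mult_left_mono tree_norm_nonneg)
  qed
  have "(\<Sum>z\<in>sign_cube (k * L). (\<Prod>j<k. \<nu> j (block L z j)) * dtree_eval (Query i l r) z)
    = (\<Sum>z\<in>sign_cube (k * L). (\<Prod>j<k. \<nu>' True j (block L z j)) * dtree_eval l z)
    + (\<Sum>z\<in>sign_cube (k * L). (\<Prod>j<k. \<nu>' False j (block L z j)) * dtree_eval r z)"
    unfolding pr sum.distrib[symmetric] by (intro sum.cong) auto
  also have "\<bar>\<dots>\<bar> \<le> (\<Prod>j<k. tree_norm L e (\<nu>' True j)) + (\<Prod>j<k. tree_norm L e (\<nu>' False j))"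
    using Query.IH(1)[of e "\<nu>' True"] Query.IH(2)[of e "\<nu>' False"] Query.prems d by (intro order_trans[OF abs_triangle_ineq] add_mono) auto
  also have "\<dots> \<le> (tree_norm L e (cut b True (\<nu> a)) + tree_norm L e (cut b False (\<nu> a))) * P"
    using nb[of True] nb[of False] by (simp add: distrib_right)
  also have "\<dots> \<le> tree_norm L d (\<nu> a) * P"
    unfolding d by (intro mult_right_mono tree_norm_cut ab P0)
  also have "\<dots> = (\<Prod>j<k. tree_norm L d (\<nu> j))" unfolding P_def by (rule split[symmetric])
  finally show ?case .
qed

section \<open>Conditioning and the second moment method\<close>

text \<open>Let s be the expectation of 1 - t under U. If s is below 1/8, then 1 - t is also small
  under W, and conditioning on B enlarges its expectation by a factor of at most 8. If s is at least
  1/8, then 1 - t remains at least 3/32 after conditioning on A. In both cases the conditional means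
  differ by at most 31/16.\<close>

lemma conditioned_advantage_le:
  fixes U W t :: "'a \<Rightarrow> real"
  assumes S: "finite S" "A \<subseteq> S" "B \<subseteq> S"
    and U: "\<And>z. z \<in> S \<Longrightarrow> U z \<ge> 0" "sum U S = 1" and W: "\<And>z. z \<in> S \<Longrightarrow> W z \<ge> 0" "sum W S = 1"
    and A: "sum U A \<ge> 1 - 1/64" and B: "sum W B \<ge> 1/8"
    and t: "\<And>z. z \<in> S \<Longrightarrow> \<bar>t z\<bar> \<le> 1"
    and close: "\<bar>(\<Sum>z\<in>S. W z * t z) - (\<Sum>z\<in>S. U z * t z)\<bar> \<le> 1/64"
  shows "((\<Sum>z\<in>A. U z * t z) / sum U A - (\<Sum>z\<in>B. W z * t z) / sum W B) / 2 \<le> 31/32"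
proof -
  define s where "s = (\<Sum>z\<in>S. U z * (1 - t z))"
  have st: "s = 1 - (\<Sum>z\<in>S. U z * t z)" using U by (simp add: s_def right_diff_distrib sum_subtractf)
  have uA: "sum U A \<le> 1" using sum_mono2[OF S(1,2), of U] U by auto
  have uA0: "sum U A > 0" using A by linarith
  have wB0: "sum W B > 0" using B by linarith
  define x where "x = (\<Sum>z\<in>A. U z * (1 - t z))"
  define y where "y = (\<Sum>z\<in>B. W z * (1 - t z))"
  have xeq: "(\<Sum>z\<in>A. U z * t z) = sum U A - x" by (simp add: x_def right_diff_distrib sum_subtractf)
  have yeq: "(\<Sum>z\<in>B. W z * t z) = sum W B - y" by (simp add: y_def right_diff_distrib sum_subtractf)
  have tt: "0 \<le> 1 - t z" "1 - t z \<le> 2" if "z \<in> S" for z using t[OF that] by auto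
  have x0: "x \<ge> 0" unfolding x_def using S U tt by (intro sum_nonneg mult_nonneg_nonneg) auto
  have xs: "x \<ge> s - 1/32"
  proof -
    have "s = x + (\<Sum>z\<in>S-A. U z * (1 - t z))" unfolding s_def x_def using sum.subset_diff[OF S(2,1)] by (simp add: add.commute)
    also have "(\<Sum>z\<in>S-A. U z * (1 - t z)) \<le> (\<Sum>z\<in>S-A. U z * 2)" using U tt by (intro sum_mono mult_left_mono) auto
    also have "\<dots> = (sum U S - sum U A) * 2" using S by (simp add: sum_distrib_right[symmetric] sum_diff)
    also have "\<dots> \<le> 1/32" using A U by simp
    finally show ?thesis by simp
  qed
  have y2: "y \<le> 2 * sum W B"
  proof -
    have "y \<le> (\<Sum>z\<in>B. W z * 2)" unfolding y_def using S W tt by (intro sum_mono mult_left_mono) auto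
    then show ?thesis by (simp add: sum_distrib_right[symmetric] mult.commute)
  qed
  have ys: "y \<le> s + 1/64"
  proof -
    have "y \<le> (\<Sum>z\<in>S. W z * (1 - t z))" unfolding y_def using S W tt by (intro sum_mono2 mult_nonneg_nonneg) auto
    also have "\<dots> = 1 - (\<Sum>z\<in>S. W z * t z)" using W by (simp add: right_diff_distrib sum_subtractf)
    also have "\<dots> \<le> s + 1/64" using close st by linarith
    finally show ?thesis .
  qed
  have X: "x / sum U A \<ge> x" using x0 uA uA0 by (simp add: pos_le_divide_eq mult_left_le)
  have "(\<Sum>z\<in>A. U z * t z) / sum U A - (\<Sum>z\<in>B. W z * t z) / sum W B = y / sum W B - x / sum U A"
    unfolding xeq yeq using uA0 wB0 by (simp add: diff_divide_distrib)
  also have "\<dots> \<le> 31/16"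
  proof (cases "s \<ge> 1/8")
    case True
    have "y / sum W B \<le> 2" using y2 wB0 by (simp add: pos_divide_le_eq)
    then show ?thesis using X xs True by linarith
  next
    case False
    have "s \<ge> 0" unfolding s_def using U tt by (intro sum_nonneg mult_nonneg_nonneg) auto
    have "y / sum W B \<le> (s + 1/64) / sum W B" using ys wB0 by (intro divide_right_mono) auto
    also have "\<dots> \<le> (s + 1/64) / (1/8)" using B \<open>s \<ge> 0\<close> by (intro divide_left_mono) auto
    also have "\<dots> = 8 * s + 1/8" by simp
    finally have "y / sum W B \<le> 9/8" using False by linarith
    then show ?thesis using X x0 by linarith
  qed
  finally have "((\<Sum>z\<in>A. U z * t z) / sum U A - (\<Sum>z\<in>B. W z * t z) / sum W B) / 2 \<le> 31/16 / 2"
    by (rule divide_right_mono) simp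
  then show ?thesis by simp
qed

text \<open>A Paley-Zygmund inequality in which a is the excess of the mean over the threshold and b
  bounds the second moment.\<close>

lemma second_moment_tail:
  fixes W f :: "'a \<Rightarrow> real"
  assumes S: "finite S" and W: "\<And>z. z \<in> S \<Longrightarrow> W z \<ge> 0" "sum W S = 1"
    and m: "(\<Sum>z\<in>S. W z * f z) \<ge> \<theta> + a" "a > 0" "\<theta> \<ge> 0" and v: "(\<Sum>z\<in>S. W z * (f z)\<^sup>2) \<le> b" "b > 0"
  shows "sum W {z \<in> S. f z \<ge> \<theta>} \<ge> a\<^sup>2 / b"
proof -
  define B where "B = {z \<in> S. f z \<ge> \<theta>}"
  have B: "B \<subseteq> S" "finite B" using S by (auto simp: B_def)
  define w where "w = sum W B"
  have w0: "w \<ge> 0" unfolding w_def using W B by (intro sum_nonneg) auto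
  have "\<theta> + a \<le> (\<Sum>z\<in>S. W z * f z)" by (rule m)
  also have "\<dots> = (\<Sum>z\<in>B. W z * f z) + (\<Sum>z\<in>S-B. W z * f z)"
    using sum.subset_diff[OF B(1) S] by (simp add: add.commute)
  also have "(\<Sum>z\<in>S-B. W z * f z) \<le> (\<Sum>z\<in>S-B. W z * \<theta>)"
    using W by (intro sum_mono mult_left_mono) (auto simp: B_def)
  also have "\<dots> \<le> (\<Sum>z\<in>S. W z * \<theta>)" using W m S by (intro sum_mono2) auto
  also have "\<dots> = \<theta>" using W by (simp add: sum_distrib_right[symmetric])
  finally have aB: "a \<le> (\<Sum>z\<in>B. W z * f z)" by simp
  \<comment> \<open>The weighted arithmetic-geometric inequality is balanced so that the quadratic
    part contributes at most a / 2, half of the excess.\<close>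
  have "(\<Sum>z\<in>B. W z * f z) \<le> (\<Sum>z\<in>B. W z * (a / (2 * b) * (f z)\<^sup>2 + b / (2 * a)))"
  proof (intro sum_mono mult_left_mono)
    fix z
    have "0 \<le> (a * f z - b)\<^sup>2" by simp
    then have "2 * (a * b) * f z \<le> a\<^sup>2 * (f z)\<^sup>2 + b\<^sup>2"
      by (simp add: power2_eq_square algebra_simps)
    then have "2 * (a * b) * f z / (2 * (a * b)) \<le> (a\<^sup>2 * (f z)\<^sup>2 + b\<^sup>2) / (2 * (a * b))"
      using m v by (intro divide_right_mono) auto
    then show "f z \<le> a / (2 * b) * (f z)\<^sup>2 + b / (2 * a)"
      using m v by (simp add: add_divide_distrib power2_eq_square)
  qed (use W B in auto)
  also have "\<dots> = a / (2 * b) * (\<Sum>z\<in>B. W z * (f z)\<^sup>2) + b / (2 * a) * w"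
    by (simp only: w_def distrib_left sum.distrib sum_distrib_left sum_distrib_right mult_ac)
  also have "\<dots> \<le> a / (2 * b) * b + b / (2 * a) * w"
  proof -
    have "(\<Sum>z\<in>B. W z * (f z)\<^sup>2) \<le> (\<Sum>z\<in>S. W z * (f z)\<^sup>2)" using W B S by (intro sum_mono2) auto
    then show ?thesis using v m by (intro add_right_mono mult_left_mono) auto
  qed
  also have "\<dots> = a / 2 + b / (2 * a) * w" using v by simp
  finally have "a / 2 \<le> b / (2 * a) * w" using aB by simp
  then have "a\<^sup>2 \<le> b * w" using m by (simp add: field_simps power2_eq_square)
  then show ?thesis using v by (simp add: w_def B_def pos_divide_le_eq mult.commute)
qed

section \<open>The Hadamard matrix is flat and orthogonal\<close>

definition bit_parity :: "nat \<Rightarrow> nat \<Rightarrow> nat \<Rightarrow> nat" where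
  "bit_parity n a b = (\<Sum>i<n. of_bool (bit a i) * of_bool (bit b i))"

lemma bit_add_exp:
  fixes b :: nat
  assumes "b < 2 ^ n" "i \<le> n"
  shows "bit (b + 2 ^ n) i \<longleftrightarrow> i = n \<or> bit b i"
proof (cases "i = n")
  case True
  then show ?thesis using assms by (simp add: bit_iff_odd)
next
  case False
  then have "(2::nat) ^ n = 2 ^ i * 2 ^ (n - i)" using assms by (simp flip: power_add)
  then have "(b + 2 ^ n) div 2 ^ i = b div 2 ^ i + 2 ^ (n - i)" by simp
  then show ?thesis using False assms by (simp add: bit_iff_odd)
qed

lemma sum_lessThan_add: "(\<Sum>b<m + (k::nat). g b) = (\<Sum>b<m. g b) + (\<Sum>b<k. g (b + m))"
  for g :: "nat \<Rightarrow> 'a :: comm_monoid_add"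
  by (induction k) (auto simp: add_ac)

text \<open>Splitting b by its top bit yields the factor 1 + c, which is 0 if a and a' differ in bit
  n and 2 otherwise. Comparing truncations by \<open>take_bit\<close> lets a and a' stay fixed
  throughout the induction.\<close>

lemma character_orthogonality:
  "(\<Sum>b<2 ^ n. (- 1) ^ (bit_parity n a b + bit_parity n a' b)) = (2 ^ n * of_bool (take_bit n a = take_bit n a') :: real)"
proof (induction n)
  case 0
  then show ?case by (simp add: bit_parity_def)
next
  case (Suc n)
  define f where "f b = (- 1 :: real) ^ (bit_parity n a b + bit_parity n a' b)" for b
  define c where "c = (- 1 :: real) ^ (of_bool (bit a n) + of_bool (bit a' n))"
  have lo: "bit_parity (Suc n) x b = bit_parity n x b" if "b < 2 ^ n" for x b
    using that by (simp add: bit_parity_def bit_iff_odd)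
  have hi: "bit_parity (Suc n) x (b + 2 ^ n) = bit_parity n x b + of_bool (bit x n)" if "b < 2 ^ n" for x b
  proof -
    have "bit_parity n x (b + 2 ^ n) = bit_parity n x b"
      unfolding bit_parity_def using bit_add_exp[OF that] by (intro sum.cong) auto
    then show ?thesis using bit_add_exp[OF that, of n] by (simp add: bit_parity_def)
  qed
  have "(\<Sum>b<2 ^ Suc n. (- 1 :: real) ^ (bit_parity (Suc n) a b + bit_parity (Suc n) a' b))
    = (\<Sum>b<2 ^ n. (- 1) ^ (bit_parity (Suc n) a b + bit_parity (Suc n) a' b))
    + (\<Sum>b<2 ^ n. (- 1) ^ (bit_parity (Suc n) a (b + 2 ^ n) + bit_parity (Suc n) a' (b + 2 ^ n)))"
    unfolding power_Suc mult_2 by (rule sum_lessThan_add)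
  also have "\<dots> = (\<Sum>b<2 ^ n. f b) + (\<Sum>b<2 ^ n. f b * c)"
    by (intro arg_cong2[where f = "(+)"] sum.cong refl) (simp_all add: lo hi f_def c_def power_add)
  also have "\<dots> = (1 + c) * (\<Sum>b<2 ^ n. f b)" by (simp only: sum_distrib_right[symmetric]) (simp add: distrib_right)
  also have "(\<Sum>b<2 ^ n. f b) = 2 ^ n * of_bool (take_bit n a = take_bit n a')" unfolding f_def by (rule Suc)
  finally have main: "(\<Sum>b<2 ^ Suc n. (- 1 :: real) ^ (bit_parity (Suc n) a b + bit_parity (Suc n) a' b))
    = (1 + c) * (2 ^ n * of_bool (take_bit n a = take_bit n a'))" .
  have tb: "take_bit (Suc n) a = take_bit (Suc n) a' \<longleftrightarrow> take_bit n a = take_bit n a' \<and> bit a n = bit a' n"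
  proof -
    have "take_bit m a = take_bit m a' \<longleftrightarrow> (\<forall>i<m. bit a i = bit a' i)" for m
      by (auto simp: bit_eq_iff bit_take_bit_iff)
    then show ?thesis by (auto simp: less_Suc_eq)
  qed
  show ?case unfolding main tb by (auto simp: c_def)
qed

lemma bit_parity_commute: "bit_parity n a b = bit_parity n b a"
  by (simp add: bit_parity_def mult.commute)

lemma hadamard_index: "a < 2 ^ n \<Longrightarrow> b < 2 ^ n \<Longrightarrow> hadamard n $$ (a, b) = (- 1) ^ bit_parity n a b / sqrt (2 ^ n)"
  by (simp add: hadamard_def bit_parity_def)

lemma hadamard_flat_orthogonal: "flat_orthogonal (2 ^ n) (\<lambda>i j. hadamard n $$ (i, j))"
proof
  show orth: "(\<Sum>j<2 ^ n. hadamard n $$ (i, j) * hadamard n $$ (i', j)) = of_bool (i = i')"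
    if "i < 2 ^ n" "i' < 2 ^ n" for i i'
  proof -
    have "(\<Sum>j<2 ^ n. hadamard n $$ (i, j) * hadamard n $$ (i', j))
      = (\<Sum>j<2 ^ n. (- 1) ^ (bit_parity n i j + bit_parity n i' j)) / 2 ^ n"
      using that by (simp add: hadamard_index sum_divide_distrib power_add)
    then show ?thesis unfolding character_orthogonality using that by (simp add: take_bit_nat_eq_self)
  qed
  show "(\<Sum>i<2 ^ n. hadamard n $$ (i, j) * hadamard n $$ (i, j')) = of_bool (j = j')"
    if "j < 2 ^ n" "j' < 2 ^ n" for j j'
    using orth[OF that] that by (simp add: hadamard_index bit_parity_commute[of n _ j] bit_parity_commute[of n _ j'])
  show "\<bar>hadamard n $$ (i, j)\<bar> = 1 / sqrt (real (2 ^ n))" if "i < 2 ^ n" "j < 2 ^ n" for i j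
    using that by (simp add: hadamard_index power_abs)
qed simp

lemma forr_eq_sign_forr:
  assumes "dim_vec z = 2 * 2 ^ n"
  shows "forr n z = flat_orthogonal.sign_forr (2 ^ n) (\<lambda>i j. hadamard n $$ (i, j)) z"
proof -
  interpret flat_orthogonal "2 ^ n" "\<lambda>i j. hadamard n $$ (i, j)" by (rule hadamard_flat_orthogonal)
  have d: "dim_row (hadamard n) = 2 ^ n" "dim_col (hadamard n) = 2 ^ n" by (simp_all add: hadamard_def)
  have "forr n z = 1 / 2 ^ n * (\<Sum>i<2 ^ n. z $ i * (\<Sum>j<2 ^ n. hadamard n $$ (i, j) * z $ (2 ^ n + j)))"
    using assms d by (simp add: forr_def vec_first_def vec_last_def scalar_prod_def mult_2 lessThan_atLeast0)
  then show ?thesis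
    by (simp add: sign_forr_def pair_form_def sum_distrib_left sum_divide_distrib mult_ac)
qed

section \<open>From the single block to the worst-case success probability\<close>

text \<open>The easy direction of Yao's principle: the minimum over inputs is at most the average
  over D, and exchanging the two expectations leaves deterministic trees.\<close>

lemma worst_case_success_le_average:
  fixes f :: "real vec \<rightharpoonup> real" and D :: "real vec \<Rightarrow> real"
  assumes S: "finite S" and D: "\<And>z. z \<in> S \<Longrightarrow> D z \<ge> 0" "sum D S = 1" "\<And>z. z \<in> S \<Longrightarrow> D z \<noteq> 0 \<Longrightarrow> z \<in> dom f"
    and T: "\<And>T. T \<in> set_pmf R \<Longrightarrow> (\<Sum>z\<in>S. D z * of_bool (f z = Some (dtree_eval T z))) \<le> c"
  shows "worst_case_success f R \<le> c"
proof -
  define P where "P z = measure_pmf.prob R {T. f z = Some (dtree_eval T z)}" for z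
  have w: "worst_case_success f R \<le> P z" if "z \<in> dom f" for z
    unfolding worst_case_success_def P_def
    by (rule cINF_lower[OF _ that]) (auto intro: bdd_belowI[of _ 0])
  have int: "integrable (measure_pmf R) (\<lambda>T. D z * of_bool (f z = Some (dtree_eval T z)))" for z
    by (rule measure_pmf.integrable_const_bound[where B = "\<bar>D z\<bar>"]) auto
  have "worst_case_success f R = (\<Sum>z\<in>S. D z * worst_case_success f R)"
    using D(2) by (simp add: sum_distrib_right[symmetric])
  also have "\<dots> \<le> (\<Sum>z\<in>S. D z * P z)"
  proof (rule sum_mono)
    fix z assume "z \<in> S"
    then show "D z * worst_case_success f R \<le> D z * P z"
      using D(1,3)[of z] w[of z] by (cases "D z = 0") (auto intro: mult_left_mono)
  qed
  also have "\<dots> = (\<Sum>z\<in>S. measure_pmf.expectation R (\<lambda>T. D z * of_bool (f z = Some (dtree_eval T z))))"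
  proof (rule sum.cong[OF refl])
    fix z
    have "measure_pmf.expectation R (\<lambda>T. of_bool (f z = Some (dtree_eval T z)) :: real)
      = measure_pmf.expectation R (indicator {T. f z = Some (dtree_eval T z)})"
      by (intro Bochner_Integration.integral_cong) (auto simp: indicator_def)
    then show "D z * P z = measure_pmf.expectation R (\<lambda>T. D z * of_bool (f z = Some (dtree_eval T z)))"
      by (simp add: P_def)
  qed
  also have "\<dots> = measure_pmf.expectation R (\<lambda>T. \<Sum>z\<in>S. D z * of_bool (f z = Some (dtree_eval T z)))"
    using int by simp
  also have "\<dots> \<le> c"
  proof (rule measure_pmf.integral_le_const)
    show "integrable (measure_pmf R) (\<lambda>T. \<Sum>z\<in>S. D z * of_bool (f z = Some (dtree_eval T z)))"
      by (intro Bochner_Integration.integrable_sum int)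
    show "AE T in measure_pmf R. (\<Sum>z\<in>S. D z * of_bool (f z = Some (dtree_eval T z))) \<le> c"
      using T by (simp add: AE_measure_pmf_iff)
  qed
  finally show ?thesis .
qed

text \<open>On each block the hard input is, with probability 1/2 each, uniform conditioned on F = 1
  or drawn from \<open>W\<close> conditioned on F = -1. The hypothesis \<open>N2\<close> controls
  the second moment under W, \<open>tail\<close> is Chebyshev's inequality for uniform inputs, and
  \<open>close\<close> bounds the advantage of a tree before conditioning.\<close>

lemma xor_forr_lower_bound:
  fixes n k d :: nat
  defines "N \<equiv> (2::real) ^ n"
  assumes k: "k \<ge> 1" and n: "n \<ge> 1" and d: "d \<ge> 4" and R: "R \<in> randomized_dtrees (2 * k * 2 ^ n) d"
    and N1: "N \<ge> 60" and N2: "3 / N \<le> 1/5 * (1 / (32 * ln N))\<^sup>2"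
    and tail: "3 / N \<le> 1/64 * (forr_eps n k / 4)\<^sup>2"
    and close: "1 / (32 * ln N) * (16 * real d * (ln (2 * N) + 4) / sqrt N) + 1 / N \<le> 1/64"
  shows "worst_case_success (xor_forr n k) R \<le> 1/2 + (31/32) ^ k / 2"
proof -
  define L where "L = (2::nat) * 2 ^ n"
  interpret flat_orthogonal "2 ^ n" "\<lambda>i j. hadamard n $$ (i, j)" by (rule hadamard_flat_orthogonal)
  define \<epsilon> where "\<epsilon> = forr_eps n k"
  define \<delta> where "\<delta> = 1 / (32 * ln N)"
  have N: "real (2 ^ n) = N" by (simp add: N_def)
  have lnN: "ln N > 0" using N1 by simp
  have \<delta>0: "\<delta> > 0" using lnN by (simp add: \<delta>_def)
  have \<epsilon>0: "\<epsilon> > 0" unfolding \<epsilon>_def forr_eps_def N_def[symmetric] using lnN k by simp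
  have \<epsilon>\<delta>: "\<epsilon> / 2 \<le> 4/15 * \<delta>"
  proof -
    have "60 * 1 * ln N \<le> 60 * real k ^ 2 * ln N" using k lnN by (intro mult_right_mono mult_left_mono) auto
    then have "\<epsilon> \<le> 1 / (60 * 1 * ln N)" unfolding \<epsilon>_def forr_eps_def N_def[symmetric] using lnN k
      by (intro divide_left_mono) auto
    then show ?thesis using lnN by (simp add: \<delta>_def field_simps)
  qed
  have two: "(2::nat) ^ n \<ge> 2" using n by (cases n) auto
  obtain W where W: "\<And>z. z \<in> sign_cube (2 * 2 ^ n) \<Longrightarrow> W z \<ge> 0" "(\<Sum>z\<in>sign_cube (2 * 2 ^ n). W z) = 1"
    "\<And>T. dtree_over (2 * 2 ^ n) T \<Longrightarrow> dtree_depth T \<le> d \<Longrightarrow>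
      \<bar>(\<Sum>z\<in>sign_cube (2 * 2 ^ n). W z * dtree_eval T z) - cube_expect (2 * 2 ^ n) (\<lambda>_. 0) (dtree_eval T)\<bar>
        \<le> \<delta> * (16 * d * (ln (2 * real (2 ^ n)) + 4) / sqrt (2 ^ n)) + 1 / 2 ^ n"
    "(\<Sum>z\<in>sign_cube (2 * 2 ^ n). W z * sign_forr z) \<ge> \<delta> * (1 - 4 / 2 ^ n)"
    "(\<Sum>z\<in>sign_cube (2 * 2 ^ n). W z * (sign_forr z)\<^sup>2) \<le> 3 * \<delta>\<^sup>2 + 3 / 2 ^ n"
    using forrelated_distribution_exists[OF two d, of \<delta>] unfolding \<delta>_def N_def by (auto simp del: numeral_power_eq_of_nat_cancel_iff)
  define S where "S = sign_cube L"
  define U where "U z = (\<Prod>i<L. (1 + z $ i * 0) / 2)" for z :: "real vec"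
  have Ug: "(\<Sum>z\<in>S. U z * g z) = cube_expect L (\<lambda>_. 0) g" for g by (simp add: S_def U_def cube_expect_def)
  have fS: "finite S" by (simp add: S_def)
  have U0: "U z \<ge> 0" for z by (simp add: U_def prod_nonneg)
  have U1: "sum U S = 1" using Ug[of "\<lambda>_. 1"] by (simp add: cube_expect_const)
  have W0: "W z \<ge> 0" if "z \<in> S" for z using W(1) that by (simp add: S_def L_def)
  have W1: "sum W S = 1" using W(2) by (simp add: S_def L_def)
  have fz: "forr n z = sign_forr z" if "z \<in> S" for z
    using forr_eq_sign_forr[of z n] that by (simp add: S_def L_def dim_sign_cube)
  define A where "A = {z \<in> S. forr n z \<le> \<epsilon> / 4}"
  define B where "B = {z \<in> S. sign_forr z \<ge> \<epsilon> / 2}"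
  have AB: "A \<subseteq> S" "B \<subseteq> S" by (auto simp: A_def B_def)
  have PB: "sum W B \<ge> 1/8"
  proof -
    \<comment> \<open>The mean of the forrelation is at least \<open>14/15 * \<delta>\<close> and
      the threshold at most \<open>4/15 * \<delta>\<close>, which leaves the excess
      \<open>2/3 * \<delta>\<close>. The second moment is at most
      \<open>(3 + 1/5) * \<delta>\<^sup>2\<close>. The resulting probability 5/36 exceeds
      1/8.\<close>
    have "sum W B \<ge> (2/3 * \<delta>)\<^sup>2 / (16/5 * \<delta>\<^sup>2)"
      unfolding B_def
    proof (rule second_moment_tail[OF fS W0 W1])
      have "1 - 4 / N \<ge> 14/15" using N1 by (simp add: field_simps)
      then have "\<delta> * (1 - 4 / N) \<ge> \<delta> * (14/15)" using \<delta>0 by (intro mult_left_mono) auto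
      then show "\<epsilon> / 2 + 2/3 * \<delta> \<le> (\<Sum>z\<in>S. W z * sign_forr z)"
        using W(4) \<epsilon>\<delta> unfolding S_def L_def N_def by linarith
      show "(\<Sum>z\<in>S. W z * (sign_forr z)\<^sup>2) \<le> 16/5 * \<delta>\<^sup>2"
        using W(5) N2 unfolding S_def L_def N_def \<delta>_def by linarith
    qed (use \<delta>0 \<epsilon>0 in auto)
    moreover have "(2/3 * \<delta>)\<^sup>2 / (16/5 * \<delta>\<^sup>2) = 5/36" using \<delta>0 by (simp add: power2_eq_square)
    ultimately show ?thesis by linarith
  qed
  have PA: "sum U A \<ge> 1 - 1/64"
  proof -
    have "sum U (S - A) * (\<epsilon> / 4)\<^sup>2 = (\<Sum>z\<in>S-A. U z * (\<epsilon> / 4)\<^sup>2)" by (simp add: sum_distrib_right)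
    also have "\<dots> \<le> (\<Sum>z\<in>S-A. U z * (sign_forr z)\<^sup>2)"
    proof (intro sum_mono mult_left_mono U0)
      fix z assume "z \<in> S - A"
      then have "sign_forr z > \<epsilon> / 4" using fz by (auto simp: A_def)
      then show "(\<epsilon> / 4)\<^sup>2 \<le> (sign_forr z)\<^sup>2" using \<epsilon>0 by (intro power_mono) auto
    qed
    also have "\<dots> \<le> (\<Sum>z\<in>S. U z * (sign_forr z)\<^sup>2)" using fS U0 by (intro sum_mono2) auto
    also have "\<dots> \<le> 3 / N" unfolding Ug L_def using uniform_sign_forr_square by (simp add: N_def)
    also have "\<dots> \<le> 1/64 * (\<epsilon> / 4)\<^sup>2" using tail by (simp add: \<epsilon>_def)
    finally have "sum U (S - A) \<le> 1/64" using \<epsilon>0 mult_right_le_imp_le[of "sum U (S - A)" "(\<epsilon> / 4)\<^sup>2" "1/64"] by simp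
    moreover have "sum U (S - A) = sum U S - sum U A" using fS AB by (simp add: sum_diff finite_subset)
    ultimately show ?thesis using U1 by linarith
  qed
  \<comment> \<open>On the support of the distribution \<pi>, the signed weight \<nu> is \<pi> times
    F; hence products of \<nu> over the blocks are the input weight times the value of the
    XOR.\<close>
  define \<nu> where "\<nu> z = (of_bool (z \<in> A) * U z / sum U A - of_bool (z \<in> B) * W z / sum W B) / 2" for z
  define \<pi> where "\<pi> z = (of_bool (z \<in> A) * U z / sum U A + of_bool (z \<in> B) * W z / sum W B) / 2" for z
  have sA: "(\<Sum>z\<in>S. of_bool (z \<in> A) * U z / sum U A * g z) = (\<Sum>z\<in>A. U z * g z) / sum U A" for g
  proof -
    have "(\<Sum>z\<in>S. of_bool (z \<in> A) * U z / sum U A * g z) = (\<Sum>z\<in>A. U z / sum U A * g z)"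
      using fS AB by (intro sum.mono_neutral_cong_right) auto
    then show ?thesis by (simp add: sum_divide_distrib)
  qed
  have sB: "(\<Sum>z\<in>S. of_bool (z \<in> B) * W z / sum W B * g z) = (\<Sum>z\<in>B. W z * g z) / sum W B" for g
  proof -
    have "(\<Sum>z\<in>S. of_bool (z \<in> B) * W z / sum W B * g z) = (\<Sum>z\<in>B. W z / sum W B * g z)"
      using fS AB by (intro sum.mono_neutral_cong_right) auto
    then show ?thesis by (simp add: sum_divide_distrib)
  qed
  have \<nu>g: "(\<Sum>z\<in>S. \<nu> z * g z) = ((\<Sum>z\<in>A. U z * g z) / sum U A - (\<Sum>z\<in>B. W z * g z) / sum W B) / 2" for g
    unfolding \<nu>_def sA[symmetric] sB[symmetric] by (simp add: left_diff_distrib sum_subtractf sum_divide_distrib[symmetric] diff_divide_distrib)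
  have \<pi>1: "sum \<pi> S = 1"
  proof -
    have "sum \<pi> S = ((\<Sum>z\<in>S. of_bool (z \<in> A) * U z / sum U A * 1) + (\<Sum>z\<in>S. of_bool (z \<in> B) * W z / sum W B * 1)) / 2"
      by (simp add: \<pi>_def sum.distrib sum_divide_distrib[symmetric] add_divide_distrib)
    then show ?thesis unfolding sA sB using PA PB by simp
  qed
  have \<pi>0: "\<pi> z \<ge> 0" if "z \<in> S" for z
    unfolding \<pi>_def using PA PB U0 W0[OF that] by (intro divide_nonneg_nonneg add_nonneg_nonneg mult_nonneg_nonneg) auto
  have F: "z \<in> dom (forr_fun n k) \<and> \<pi> z * the (forr_fun n k z) = \<nu> z \<and> the (forr_fun n k z) \<in> {-1, 1}"
    if "z \<in> S" "\<pi> z \<noteq> 0" for z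
  proof -
    have "z \<in> A \<or> z \<in> B" using that by (auto simp: \<pi>_def)
    then show ?thesis using that(1) fz[OF that(1)] \<epsilon>0
      by (auto simp: A_def B_def forr_fun_def \<epsilon>_def[symmetric] S_def L_def dom_def \<pi>_def \<nu>_def)
  qed
  have norm: "tree_norm L d \<nu> \<le> 31/32"
  proof -
    obtain t where t: "dtree_over L t" "dtree_depth t \<le> d" "tree_norm L d \<nu> = (\<Sum>z\<in>S. \<nu> z * dtree_eval t z)"
      using tree_norm_attained[of L d \<nu>] unfolding S_def by blast
    have "\<bar>dtree_eval t z\<bar> \<le> 1" for z using dtree_eval_bounds[OF t(1), of z] by auto
    moreover have "\<bar>(\<Sum>z\<in>S. W z * dtree_eval t z) - (\<Sum>z\<in>S. U z * dtree_eval t z)\<bar> \<le> 1/64"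
      unfolding Ug unfolding S_def L_def
    proof (rule order_trans[OF W(3)])
      show "\<delta> * (16 * d * (ln (2 * real (2 ^ n)) + 4) / sqrt (2 ^ n)) + 1 / 2 ^ n \<le> 1/64"
        using close unfolding \<delta>_def N_def by simp
    qed (use t L_def in auto)
    ultimately show ?thesis unfolding t(3) \<nu>g
      using fS AB U0 U1 W0 W1 PA PB by (intro conditioned_advantage_le[where S = S]) auto
  qed
  have M: "2 * k * 2 ^ n = k * L" by (simp add: L_def)
  define D where "D z = (\<Prod>j<k. \<pi> (block L z j))" for z
  define V where "V z = (\<Prod>j<k. \<nu> (block L z j))" for z
  have blk: "block L z j \<in> S" if "z \<in> sign_cube (k * L)" "j < k" for z j
    unfolding S_def
  proof (rule sign_cubeI)
    fix i assume i: "i < L"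
    have "j * L + i < Suc j * L" using i by simp
    also have "\<dots> \<le> k * L" using that(2) by (intro mult_right_mono) auto
    finally show "block L z j $ i = -1 \<or> block L z j $ i = 1"
      using sign_cube_cases[OF that(1)] i by (simp add: block_def)
  qed (simp add: block_def)
  have dom: "z \<in> dom (xor_forr n k) \<and> D z * the (xor_forr n k z) = V z \<and> the (xor_forr n k z) \<in> {-1, 1}"
    if z: "z \<in> sign_cube (k * L)" "D z \<noteq> 0" for z
  proof -
    have nz: "\<pi> (block L z j) \<noteq> 0" if "j < k" for j using z(2) that by (auto simp: D_def)
    have Fj: "block L z j \<in> dom (forr_fun n k)" "\<pi> (block L z j) * the (forr_fun n k (block L z j)) = \<nu> (block L z j)"
       "the (forr_fun n k (block L z j)) \<in> {-1, 1}" if "j < k" for j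
      using F[OF blk[OF z(1) that] nz[OF that]] by auto
    have x: "xor_forr n k z = Some (\<Prod>j<k. the (forr_fun n k (block L z j)))"
      unfolding xor_forr_def L_def[symmetric] M using z(1) Fj(1) by simp
    have "(\<Prod>j<m. the (forr_fun n k (block L z j))) \<in> {-1, 1}" if "m \<le> k" for m
      using that
    proof (induction m)
      case (Suc m)
      then show ?case using Fj(3)[of m] by auto
    qed simp
    then show ?thesis unfolding x D_def V_def prod.distrib[symmetric] using Fj(2) x by (auto simp: prod.distrib[symmetric])
  qed
  have "worst_case_success (xor_forr n k) R \<le> 1/2 + (31/32) ^ k / 2"
  proof (rule worst_case_success_le_average[where S = "sign_cube (k * L)" and D = D])
    show "D z \<ge> 0" if "z \<in> sign_cube (k * L)" for z
      unfolding D_def using blk[OF that] by (intro prod_nonneg) (auto intro: \<pi>0)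
    show D1: "sum D (sign_cube (k * L)) = 1"
      unfolding D_def sum_prod_blocks[where g = "\<lambda>_. \<pi>"] using \<pi>1 by (simp add: S_def)
    show "z \<in> dom (xor_forr n k)" if "z \<in> sign_cube (k * L)" "D z \<noteq> 0" for z using dom[OF that] by blast
    fix T assume "T \<in> set_pmf R"
    then have T: "dtree_over (k * L) T" "dtree_depth T \<le> d" using R by (auto simp: randomized_dtrees_def M)
    \<comment> \<open>For signs y and t the indicator of y = t is \<open>(1 + y * t) / 2\<close>, so
      success is 1/2 plus half the correlation.\<close>
    have "(\<Sum>z\<in>sign_cube (k * L). D z * of_bool (xor_forr n k z = Some (dtree_eval T z)))
      = (\<Sum>z\<in>sign_cube (k * L). D z / 2 + V z * dtree_eval T z / 2)"
    proof (rule sum.cong[OF refl])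
      fix z assume z: "z \<in> sign_cube (k * L)"
      show "D z * of_bool (xor_forr n k z = Some (dtree_eval T z)) = D z / 2 + V z * dtree_eval T z / 2"
      proof (cases "D z = 0")
        case True
        then obtain j where "j < k" "\<pi> (block L z j) = 0" by (auto simp: D_def)
        \<comment> \<open>Both parts of \<pi> are nonnegative, so where their sum vanishes their
          difference does too.\<close>
        moreover from this have "\<nu> (block L z j) = 0"
        proof -
          have nn: "0 \<le> of_bool (block L z j \<in> A) * U (block L z j) / sum U A" "0 \<le> of_bool (block L z j \<in> B) * W (block L z j) / sum W B"
            using PA PB U0 W0[OF blk[OF z \<open>j < k\<close>]] by (auto intro!: divide_nonneg_nonneg)
          have "(p - q) / 2 = 0" if "0 \<le> p" "0 \<le> q" "(p + q) / 2 = 0" for p q :: real using that by simp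
          from this[OF nn] show ?thesis using \<open>\<pi> (block L z j) = 0\<close> unfolding \<pi>_def \<nu>_def by blast
        qed
        ultimately have "V z = 0" unfolding V_def by (intro prod_zero) auto
        then show ?thesis using True by simp
      next
        case False
        from dom[OF z False] obtain y where y: "xor_forr n k z = Some y" "D z * y = V z" "y \<in> {-1, 1}" by auto
        have "dtree_eval T z = -1 \<or> dtree_eval T z = 1" using dtree_eval_bounds[OF T(1), of z] by blast
        moreover have "y = -1 \<or> y = 1" using y(3) by blast
        ultimately show ?thesis unfolding y(1) y(2)[symmetric] option.inject
          by (elim disjE; simp only:; simp)
      qed
    qed
    also have "\<dots> = 1/2 + (\<Sum>z\<in>sign_cube (k * L). V z * dtree_eval T z) / 2"
      using D1 by (simp add: sum.distrib sum_divide_distrib[symmetric])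
    also have "(\<Sum>z\<in>sign_cube (k * L). V z * dtree_eval T z) \<le> (\<Prod>j<k. tree_norm L d \<nu>)"
      using order_trans[OF abs_ge_self xor_correlation_le[OF T, of "\<lambda>_. \<nu>"]] unfolding V_def .
    also have "\<dots> \<le> (31/32) ^ k" using norm tree_norm_nonneg[of L d \<nu>] by (simp add: power_mono)
    finally show "(\<Sum>z\<in>sign_cube (k * L). D z * of_bool (xor_forr n k z = Some (dtree_eval T z))) \<le> 1/2 + (31/32) ^ k / 2"
      by simp
  qed simp
  then show ?thesis .
qed

section \<open>Asymptotics of the lower bound\<close>

lemma randomized_dtrees_mono: "d \<le> e \<Longrightarrow> randomized_dtrees M d \<subseteq> randomized_dtrees M e"
  by (auto simp: randomized_dtrees_def intro: order_trans)

lemma xor_forr_lower_bound_eventually: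
  fixes k d :: "nat \<Rightarrow> nat"
  assumes k: "\<And>n. k n \<ge> 1" "(\<lambda>n. real (k n)) \<in> o(\<lambda>n. (2 ^ n) powr (1 / 50))"
    and d: "(\<lambda>n. real (d n)) \<in> o(\<lambda>n. sqrt (2 ^ n))"
  shows "\<forall>\<^sub>F n in sequentially. \<forall>R \<in> randomized_dtrees (2 * k n * 2 ^ n) (d n).
    worst_case_success (xor_forr n (k n)) R \<le> 1 / 2 + exp (- (1/32) * real (k n))"
proof -
  have ek: "\<forall>\<^sub>F n in sequentially. real (k n) \<le> (2 ^ n) powr (1 / 50)"
    using landau_o.smallD[OF k(2), of 1] by simp
  have ed: "\<forall>\<^sub>F n in sequentially. real (d n) \<le> 1/200 * sqrt (2 ^ n)"
    using landau_o.smallD[OF d, of "1/200"] by simp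
  have e1: "\<forall>\<^sub>F n in sequentially. (2::real) ^ n \<ge> 60" by real_asymp
  have e2: "\<forall>\<^sub>F n in sequentially. 3 / (2::real) ^ n \<le> 1/5 * (1 / (32 * ln (2 ^ n)))\<^sup>2" by real_asymp
  \<comment> \<open>Here the growth of k enters: the inverse square of the forrelation threshold is
    of order \<open>k ^ 4 * (ln N)\<^sup>2\<close>, and it has to be small against N.\<close>
  have e3: "\<forall>\<^sub>F n in sequentially. 3 / (2::real) ^ n * (60 * ((2 ^ n) powr (1 / 50))\<^sup>2 * ln (2 ^ n) * 4)\<^sup>2 \<le> 1/64" by real_asymp
  have e4: "\<forall>\<^sub>F n in sequentially. (ln (2 * 2 ^ n) + 4) / (2 * ln (2 ^ n)) \<le> (1::real)" by real_asymp
  have e5: "\<forall>\<^sub>F n in sequentially. 4 / sqrt (2 ^ n) + 1 / 2 ^ n \<le> (1/200::real)" by real_asymp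
  have e6: "\<forall>\<^sub>F n in sequentially. n \<ge> (1::nat)" by (rule eventually_ge_at_top)
  show ?thesis using ek ed e1 e2 e3 e4 e5 e6
  proof eventually_elim
    case (elim n)
    define N where "N = (2::real) ^ n"
    \<comment> \<open>The martingale estimate needs depth at least 4; the enlargement costs the term
      4 / sqrt N, which vanishes.\<close>
    define d' where "d' = max (d n) 4"
    have lnN: "ln N > 0" using elim(3) by (simp add: N_def)
    have sN: "sqrt N > 0" by (simp add: N_def)
    show ?case
    proof
      fix R assume "R \<in> randomized_dtrees (2 * k n * 2 ^ n) (d n)"
      then have R: "R \<in> randomized_dtrees (2 * k n * 2 ^ n) d'"
        using randomized_dtrees_mono[of "d n" d'] by (auto simp: d'_def)
      have "worst_case_success (xor_forr n (k n)) R \<le> 1/2 + (31/32) ^ k n / 2"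
      proof (rule xor_forr_lower_bound[OF k(1) elim(8) _ R elim(3,4)])
        show "d' \<ge> 4" by (simp add: d'_def)
        define x where "x = 60 * real (k n) ^ 2 * ln N * 4"
        have x0: "x > 0" using k(1)[of n] lnN by (simp add: x_def)
        have "x \<le> 60 * (N powr (1 / 50))\<^sup>2 * ln N * 4"
          unfolding x_def using elim(1) lnN by (intro mult_right_mono mult_left_mono power_mono) (auto simp: N_def)
        then have "3 / N * x\<^sup>2 \<le> 3 / N * (60 * (N powr (1 / 50))\<^sup>2 * ln N * 4)\<^sup>2"
          using x0 by (intro mult_left_mono power_mono) (auto simp: N_def)
        also have "\<dots> \<le> 1/64" using elim(5) by (simp add: N_def)
        finally have "3 / N * x\<^sup>2 * (1 / x\<^sup>2) \<le> 1/64 * (1 / x\<^sup>2)" by (rule mult_right_mono) simp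
        then have "3 / N \<le> 1/64 * (1 / x)\<^sup>2" using x0 by (simp add: power_divide)
        then show "3 / 2 ^ n \<le> 1/64 * (forr_eps n (k n) / 4)\<^sup>2"
          by (simp add: forr_eps_def x_def N_def mult.commute mult.left_commute)
        have dd: "real d' \<le> 1/200 * sqrt N + 4" using elim(2) by (simp add: d'_def N_def max_def)
        have "1 / (32 * ln N) * (16 * real d' * (ln (2 * N) + 4) / sqrt N) = (ln (2 * N) + 4) / (2 * ln N) * (real d' / sqrt N)"
          using lnN sN by (simp add: field_simps)
        also have "\<dots> \<le> 1 * (real d' / sqrt N)" using elim(6) sN by (intro mult_right_mono) (auto simp: N_def)
        also have "\<dots> \<le> (1/200 * sqrt N + 4) / sqrt N" using dd sN by (simp add: divide_right_mono)
        also have "\<dots> = 1/200 + 4 / sqrt N" using sN by (simp add: add_divide_distrib)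
        finally show "1 / (32 * ln (2 ^ n)) * (16 * real d' * (ln (2 * 2 ^ n) + 4) / sqrt (2 ^ n)) + 1 / 2 ^ n \<le> 1/64"
          using elim(7) unfolding N_def by linarith
      qed
      also have "(31/32::real) ^ k n / 2 \<le> exp (- (1/32) * real (k n))"
      proof -
        have "(31/32::real) ^ k n \<le> exp (- (1/32)) ^ k n"
          using exp_ge_add_one_self[of "- (1/32)"] by (intro power_mono) auto
        also have "\<dots> = exp (- (1/32) * real (k n))" by (simp add: exp_of_nat_mult[symmetric] mult.commute)
        finally have "(31/32::real) ^ k n \<le> exp (- (1/32) * real (k n))" .
        moreover have "(31/32::real) ^ k n \<ge> 0" by simp
        ultimately show ?thesis by linarith
      qed
      finally show "worst_case_success (xor_forr n (k n)) R \<le> 1 / 2 + exp (- (1/32) * real (k n))" by simp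
    qed
  qed
qed

section \<open>Quantum circuits with real amplitudes\<close>

lemma sum_lessThan_mult: "(\<Sum>i<k * L. f i) = (\<Sum>a<k. \<Sum>b<L. f (a * L + b))"
  for f :: "nat \<Rightarrow> 'a :: comm_monoid_add"
proof (induction k)
  case (Suc k)
  have "(\<Sum>i<Suc k * L. f i) = (\<Sum>i<k * L + L. f i)" by (simp add: add.commute)
  also have "\<dots> = (\<Sum>i<k * L. f i) + (\<Sum>b<L. f (b + k * L))" by (rule sum_lessThan_add)
  finally show ?case using Suc by (simp add: add.commute)
qed simp

lemma sum_of_bool_mult:
  fixes g :: "nat \<Rightarrow> real"
  assumes "j < m"
  shows "(\<Sum>l<m. of_bool (l = j) * g l) = g j"
  using assms by (simp add: of_bool_def if_distrib if_distribR sum.delta cong: if_cong)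

text \<open>All unitaries and states of the algorithm have real entries, so orthogonality and
  amplitudes are computed over the reals and only embedded here.\<close>

definition rmat :: "nat \<Rightarrow> (nat \<Rightarrow> nat \<Rightarrow> real) \<Rightarrow> complex mat" where
  "rmat m f = mat m m (\<lambda>(i, j). complex_of_real (f i j))"

definition rvec :: "nat \<Rightarrow> (nat \<Rightarrow> real) \<Rightarrow> complex vec" where
  "rvec m g = vec m (\<lambda>i. complex_of_real (g i))"

lemma rmat_carrier [simp]: "rmat m f \<in> carrier_mat m m"
  by (simp add: rmat_def)

lemma rvec_carrier [simp]: "rvec m g \<in> carrier_vec m"
  by (simp add: rvec_def)

lemma rmat_mult_rvec: "rmat m f *\<^sub>v rvec m g = rvec m (\<lambda>i. \<Sum>j<m. f i j * g j)"
  by (rule eq_vecI) (auto simp: rmat_def rvec_def scalar_prod_def lessThan_atLeast0)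

lemma rvec_cong: "(\<And>i. i < m \<Longrightarrow> g i = h i) \<Longrightarrow> rvec m g = rvec m h"
  by (rule eq_vecI) (auto simp: rvec_def)

lemma rmat_mult: "rmat m f * rmat m g = rmat m (\<lambda>i j. \<Sum>l<m. f i l * g l j)"
  by (rule eq_matI) (auto simp: rmat_def scalar_prod_def lessThan_atLeast0)

lemma mat_adjoint_rmat: "mat_adjoint (rmat m f) = rmat m (\<lambda>i j. f j i)"
proof (rule eq_matI)
  fix i j assume "i < dim_row (rmat m (\<lambda>i j. f j i))" "j < dim_col (rmat m (\<lambda>i j. f j i))"
  then have "i < m" "j < m" by (auto simp: rmat_def)
  then show "mat_adjoint (rmat m f) $$ (i, j) = rmat m (\<lambda>i j. f j i) $$ (i, j)"
    by (simp add: mat_adjoint_def rmat_def mat_of_rows_index col_def)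
qed (auto simp: mat_adjoint_def rmat_def)

lemma rmat_of_bool: "rmat m (\<lambda>i j. of_bool (i = j)) = 1\<^sub>m m"
  by (rule eq_matI) (auto simp: rmat_def)

lemma rmat_cong: "(\<And>i j. i < m \<Longrightarrow> j < m \<Longrightarrow> f i j = g i j) \<Longrightarrow> rmat m f = rmat m g"
  by (rule eq_matI) (auto simp: rmat_def)

lemma unitary_rmat:
  assumes "\<And>i j. i < m \<Longrightarrow> j < m \<Longrightarrow> (\<Sum>l<m. f i l * f j l) = of_bool (i = j)"
  shows "unitary_mat m (rmat m f)"
proof -
  have 1: "rmat m f * mat_adjoint (rmat m f) = 1\<^sub>m m"
    unfolding mat_adjoint_rmat rmat_mult rmat_of_bool[symmetric] using assms by (rule rmat_cong)
  have "mat_adjoint (rmat m f) \<in> carrier_mat m m" by (simp add: mat_adjoint_rmat)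
  then show ?thesis unfolding unitary_mat_def using mat_mult_left_right_inverse[OF rmat_carrier _ 1] 1 by simp
qed

lemma orthogonal_mult:
  fixes f g :: "nat \<Rightarrow> nat \<Rightarrow> real"
  assumes f: "\<And>i j. i < m \<Longrightarrow> j < m \<Longrightarrow> (\<Sum>l<m. f i l * f j l) = of_bool (i = j)"
    and g: "\<And>i j. i < m \<Longrightarrow> j < m \<Longrightarrow> (\<Sum>l<m. g i l * g j l) = of_bool (i = j)"
    and "i < m" "j < m"
  shows "(\<Sum>l<m. (\<Sum>p<m. f i p * g p l) * (\<Sum>p<m. f j p * g p l)) = of_bool (i = j)"
proof -
  have "(\<Sum>l<m. (\<Sum>p<m. f i p * g p l) * (\<Sum>p<m. f j p * g p l))
    = (\<Sum>l<m. \<Sum>p<m. \<Sum>p'<m. f i p * f j p' * (g p l * g p' l))"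
    by (simp add: sum_product mult_ac)
  also have "\<dots> = (\<Sum>p<m. \<Sum>l<m. \<Sum>p'<m. f i p * f j p' * (g p l * g p' l))"
    by (rule sum.swap)
  also have "\<dots> = (\<Sum>p<m. \<Sum>p'<m. \<Sum>l<m. f i p * f j p' * (g p l * g p' l))"
    by (rule sum.cong[OF refl], rule sum.swap)
  also have "\<dots> = (\<Sum>p<m. \<Sum>p'<m. f i p * f j p' * of_bool (p = p'))"
    by (intro sum.cong refl) (simp only: sum_distrib_left[symmetric] g lessThan_iff)
  also have "\<dots> = (\<Sum>p<m. f i p * f j p)"
    by (rule sum.cong[OF refl]) (simp add: of_bool_def if_distrib if_distribR sum.delta cong: if_cong)
  finally show ?thesis using f[OF assms(3,4)] by simp
qed

text \<open>A Householder reflection swaps the first basis vector with any other real unit vector.\<close>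

lemma orthogonal_with_first_column:
  fixes a :: "nat \<Rightarrow> real"
  assumes m: "m > 0" and a: "(\<Sum>i<m. (a i)\<^sup>2) = 1"
  obtains A where "\<And>i j. i < m \<Longrightarrow> j < m \<Longrightarrow> (\<Sum>l<m. A i l * A j l) = of_bool (i = j)" "\<And>i. i < m \<Longrightarrow> A i 0 = a i"
proof -
  define v where "v i = of_bool (i = 0) - a i" for i
  define s where "s = (\<Sum>i<m. (v i)\<^sup>2)"
  define A where "A i j = of_bool (i = j) - 2 * v i * v j / s" for i j
  have ob: "(\<Sum>l<m. of_bool (l = j) * g l) = g j" "(\<Sum>l<m. g l * of_bool (l = j)) = g j"
    "(\<Sum>l<m. of_bool (j = l) * g l) = g j" "(\<Sum>l<m. g l * of_bool (j = l)) = g j" if "j < m" for j and g :: "nat \<Rightarrow> real"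
    using that by (simp_all add: of_bool_def if_distrib if_distribR sum.delta cong: if_cong)
  \<comment> \<open>This says \<open>s = 2 * v 0\<close>, because of which the first column of the
    reflection is the first basis vector minus v, that is, a.\<close>
  have sv: "s = 2 - 2 * a 0"
  proof -
    have "s = (\<Sum>i<m. of_bool (i = 0) * (1 - 2 * a i) + (a i)\<^sup>2)"
      unfolding s_def v_def by (intro sum.cong refl) (auto simp: power2_eq_square algebra_simps)
    also have "\<dots> = 2 - 2 * a 0" unfolding sum.distrib a ob(1)[OF m] by simp
    finally show ?thesis .
  qed
  show ?thesis
  \<comment> \<open>The number s is the squared length of the reflection vector; it vanishes exactly
    when a is already the first basis vector, and the identity serves.\<close>
  proof (cases "s = 0")
    case True
    have "v i = 0" if "i < m" for i
      using True that sum_nonneg_eq_0_iff[of "{..<m}" "\<lambda>i. (v i)\<^sup>2"] by (auto simp: s_def)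
    then have "a i = of_bool (i = 0)" if "i < m" for i using that by (simp add: v_def)
    then show ?thesis by (intro that[of "\<lambda>i j. of_bool (i = j)"]) (auto simp: ob)
  next
    case False
    show ?thesis
    proof (rule that[of A])
      fix i j assume ij: "i < m" "j < m"
      have "(\<Sum>l<m. A i l * A j l) = (\<Sum>l<m. of_bool (i = l) * (of_bool (j = l)) - of_bool (i = l) * (2 * v j * v l / s)
          - (2 * v i * v l / s) * of_bool (j = l) + 4 * v i * v j / s\<^sup>2 * (v l)\<^sup>2)"
        unfolding A_def by (intro sum.cong refl) (simp add: algebra_simps power2_eq_square)
      also have "\<dots> = of_bool (j = i) - 2 * v j * v i / s - 2 * v i * v j / s + 4 * v i * v j / s\<^sup>2 * s"
        unfolding sum.distrib sum_subtractf sum_distrib_left[symmetric] s_def[symmetric] ob(3)[OF ij(1)] ob(4)[OF ij(2)] by simp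
      also have "\<dots> = of_bool (i = j)" using False by (simp add: power2_eq_square field_simps)
      finally show "(\<Sum>l<m. A i l * A j l) = of_bool (i = j)" .
    next
      fix i assume "i < m"
      have "2 * v 0 = s" by (simp add: v_def sv)
      moreover have "A i 0 = of_bool (i = 0) - v i * (2 * v 0 / s)" by (simp add: A_def)
      ultimately have "A i 0 = of_bool (i = 0) - v i * (s / s)" by simp
      then show "A i 0 = a i" using False by (simp add: v_def)
    qed
  qed
qed

lemma sum_registers:
  fixes F :: "nat \<Rightarrow> bool \<Rightarrow> nat \<Rightarrow> real"
  assumes "W > 0"
  shows "(\<Sum>r<2 * M * W. F (r div (2 * W)) (odd (r div W)) (r mod W)) = (\<Sum>i<M. \<Sum>b\<in>UNIV. \<Sum>w<W. F i b w)"
proof -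
  have "(\<Sum>r<2 * M * W. F (r div (2 * W)) (odd (r div W)) (r mod W))
    = (\<Sum>x<M * 2. \<Sum>w<W. F ((x * W + w) div (2 * W)) (odd ((x * W + w) div W)) ((x * W + w) mod W))"
    by (subst mult.commute[of 2 M], rule sum_lessThan_mult)
  also have "\<dots> = (\<Sum>x<M * 2. \<Sum>w<W. F (x div 2) (odd x) w)"
  proof (intro sum.cong refl)
    fix x w assume "w \<in> {..<W}"
    then have "(x * W + w) div W = x" "(x * W + w) mod W = w" by auto
    moreover have "(x * W + w) div (2 * W) = x div 2"
      using calculation(1) div_mult2_eq[of "x * W + w" W 2] by (simp add: mult.commute)
    ultimately show "F ((x * W + w) div (2 * W)) (odd ((x * W + w) div W)) ((x * W + w) mod W) = F (x div 2) (odd x) w"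
      by simp
  qed
  also have "\<dots> = (\<Sum>i<M. \<Sum>c<2. \<Sum>w<W. F ((i * 2 + c) div 2) (odd (i * 2 + c)) w)"
    by (rule sum_lessThan_mult)
  also have "\<dots> = (\<Sum>i<M. \<Sum>b\<in>UNIV. \<Sum>w<W. F i b w)"
  proof -
    have "{..<2} = {0, 1::nat}" by auto
    then show ?thesis by (simp add: UNIV_bool)
  qed
  finally show ?thesis .
qed

locale registers =
  fixes M W :: nat
  assumes W_pos: "W > 0"
begin

definition state :: "(nat \<Rightarrow> bool \<Rightarrow> nat \<Rightarrow> real) \<Rightarrow> complex vec" where
  "state g = rvec (2 * M * W) (\<lambda>r. g (r div (2 * W)) (odd (r div W)) (r mod W))"

lemma decode_basis_index:
  assumes "w < W"
  shows "basis_index W i b w div (2 * W) = i" "odd (basis_index W i b w div W) = b" "basis_index W i b w mod W = w"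
proof -
  have "basis_index W i b w div W = 2 * i + of_bool b" "basis_index W i b w mod W = w"
    using assms by (auto simp: basis_index_def)
  moreover from this(1) have "basis_index W i b w div (2 * W) = i"
    using div_mult2_eq[of "basis_index W i b w" W 2] by (simp add: mult.commute)
  ultimately show "basis_index W i b w div (2 * W) = i" "odd (basis_index W i b w div W) = b" "basis_index W i b w mod W = w"
    by auto
qed

lemma encode_basis_index: "basis_index W (r div (2 * W)) (odd (r div W)) (r mod W) = r"
proof -
  have "2 * (r div (2 * W)) + of_bool (odd (r div W)) = r div W"
    using div_mult2_eq[of r W 2] by (simp add: mult.commute odd_iff_mod_2_eq_one[symmetric] of_bool_odd_eq_mod_2)
  then show ?thesis by (simp add: basis_index_def)
qed

lemma register_bounds: "r < 2 * M * W \<Longrightarrow> r div (2 * W) < M" "r mod W < W"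
  using W_pos less_mult_imp_div_less[of r M "2 * W"] by (auto simp: mult_ac)

lemma basis_index_less: "i < M \<Longrightarrow> w < W \<Longrightarrow> basis_index W i b w < 2 * M * W"
proof -
  assume "i < M" "w < W"
  then have "(2 * i + of_bool b) * W + w < (2 * i + of_bool b + 1) * W" by simp
  also have "\<dots> \<le> (2 * M) * W" using \<open>i < M\<close> by (intro mult_right_mono) auto
  finally show ?thesis by (simp add: basis_index_def)
qed

lemma state_cong: "(\<And>i b w. i < M \<Longrightarrow> w < W \<Longrightarrow> g i b w = h i b w) \<Longrightarrow> state g = state h"
  unfolding state_def by (rule rvec_cong) (simp add: register_bounds)

text \<open>A query permutes the basis and is its own inverse, so the new amplitude is the old one
  at the flipped answer bit.\<close>

lemma query_op_state: "query_op M W z *\<^sub>v state g = state (\<lambda>i b w. g i (b \<noteq> (z $ i = -1)) w)"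
proof -
  define e where "e r = basis_index W (r div (2 * W)) (odd (r div W) \<noteq> (z $ (r div (2 * W)) = -1)) (r mod W)" for r
  have q: "query_op M W z = rmat (2 * M * W) (\<lambda>r c. of_bool (c = e r))"
  proof (rule eq_matI)
    fix r c assume "r < dim_row (rmat (2 * M * W) (\<lambda>r c. of_bool (c = e r)))" "c < dim_col (rmat (2 * M * W) (\<lambda>r c. of_bool (c = e r)))"
    then have rc: "r < 2 * M * W" "c < 2 * M * W" by (auto simp: rmat_def)
    have "(\<exists>i<M. \<exists>b. \<exists>w<W. c = basis_index W i b w \<and> r = basis_index W i (b \<noteq> (z $ i = -1)) w) \<longleftrightarrow> c = e r"
    proof
      assume "\<exists>i<M. \<exists>b. \<exists>w<W. c = basis_index W i b w \<and> r = basis_index W i (b \<noteq> (z $ i = -1)) w"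
      then obtain i b w where *: "i < M" "w < W" "c = basis_index W i b w" "r = basis_index W i (b \<noteq> (z $ i = -1)) w" by blast
      then show "c = e r" unfolding e_def *(4) decode_basis_index[OF *(2)] *(3)
        by (cases b; cases "z $ i = -1"; simp)
    next
      assume "c = e r"
      moreover have "r = basis_index W (r div (2 * W)) ((odd (r div W) \<noteq> (z $ (r div (2 * W)) = -1)) \<noteq> (z $ (r div (2 * W)) = -1)) (r mod W)"
        using encode_basis_index[of r] by (cases "odd (r div W)"; cases "z $ (r div (2 * W)) = -1"; simp)
      ultimately show "\<exists>i<M. \<exists>b. \<exists>w<W. c = basis_index W i b w \<and> r = basis_index W i (b \<noteq> (z $ i = -1)) w"
        using register_bounds(1)[OF rc(1)] register_bounds(2)[of r] unfolding e_def by blast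
    qed
    then show "query_op M W z $$ (r, c) = rmat (2 * M * W) (\<lambda>r c. of_bool (c = e r)) $$ (r, c)"
      using rc by (simp add: query_op_def rmat_def)
  qed (auto simp: query_op_def rmat_def)
  show ?thesis unfolding q state_def rmat_mult_rvec
  proof (rule rvec_cong)
    fix r assume r: "r < 2 * M * W"
    define G where "G c = g (c div (2 * W)) (odd (c div W)) (c mod W)" for c
    have "e r < 2 * M * W" unfolding e_def using register_bounds(1)[OF r] register_bounds(2)[of r] by (rule basis_index_less)
    then have "(\<Sum>c<2 * M * W. of_bool (c = e r) * G c) = G (e r)"
      by (simp add: of_bool_def if_distrib if_distribR sum.delta cong: if_cong)
    also have "\<dots> = g (r div (2 * W)) (odd (r div W) \<noteq> (z $ (r div (2 * W)) = -1)) (r mod W)"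
      unfolding G_def e_def decode_basis_index[OF register_bounds(2)[of r]] ..
    finally show "(\<Sum>c<2 * M * W. of_bool (c = e r) * g (c div (2 * W)) (odd (c div W)) (c mod W))
      = g (r div (2 * W)) (odd (r div W) \<noteq> (z $ (r div (2 * W)) = -1)) (r mod W)" unfolding G_def .
  qed
qed

definition lift :: "(nat \<Rightarrow> nat \<Rightarrow> real) \<Rightarrow> nat \<Rightarrow> nat \<Rightarrow> real" where
  "lift f r c = of_bool (odd (c div W) = odd (r div W)) * of_bool (c mod W = r mod W) * f (r div (2 * W)) (c div (2 * W))"

lemma sum_lift:
  fixes G :: "nat \<Rightarrow> bool \<Rightarrow> nat \<Rightarrow> real"
  assumes "w' < W"
  shows "(\<Sum>c<2 * M * W. of_bool (odd (c div W) = b') * of_bool (c mod W = w') * G (c div (2 * W)) (odd (c div W)) (c mod W))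
    = (\<Sum>i<M. G i b' w')"
proof -
  have "(\<Sum>c<2 * M * W. of_bool (odd (c div W) = b') * of_bool (c mod W = w') * G (c div (2 * W)) (odd (c div W)) (c mod W))
    = (\<Sum>i<M. \<Sum>b\<in>UNIV. \<Sum>w<W. of_bool (b = b') * of_bool (w = w') * G i b w)"
    by (rule sum_registers[OF W_pos, where F = "\<lambda>i b w. of_bool (b = b') * of_bool (w = w') * G i b w"])
  also have "\<dots> = (\<Sum>i<M. G i b' w')"
  proof (rule sum.cong[OF refl])
    fix i
    have "(\<Sum>w<W. of_bool (b = b') * of_bool (w = w') * G i b w) = of_bool (b = b') * G i b w'" for b
      using sum_of_bool_mult[OF assms, of "\<lambda>w. of_bool (b = b') * G i b w"] by (cases "b = b'") simp_all
    then show "(\<Sum>b\<in>UNIV. \<Sum>w<W. of_bool (b = b') * of_bool (w = w') * G i b w) = G i b' w'"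
      by (simp add: UNIV_bool)
  qed
  finally show ?thesis .
qed

lemma lift_state: "rmat (2 * M * W) (lift f) *\<^sub>v state g = state (\<lambda>i b w. \<Sum>i'<M. f i i' * g i' b w)"
  unfolding state_def rmat_mult_rvec
proof (rule rvec_cong)
  fix r assume r: "r < 2 * M * W"
  show "(\<Sum>c<2 * M * W. lift f r c * g (c div (2 * W)) (odd (c div W)) (c mod W))
    = (\<Sum>i'<M. f (r div (2 * W)) i' * g i' (odd (r div W)) (r mod W))"
    using sum_lift[OF register_bounds(2)[of r], of "odd (r div W)" "\<lambda>i b w. f (r div (2 * W)) i * g i b w"]
    by (simp only: lift_def mult.assoc)
qed

lemma lift_orthogonal:
  assumes f: "\<And>i j. i < M \<Longrightarrow> j < M \<Longrightarrow> (\<Sum>l<M. f i l * f j l) = of_bool (i = j)"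
    and r: "r < 2 * M * W" "r' < 2 * M * W"
  shows "(\<Sum>c<2 * M * W. lift f r c * lift f r' c) = of_bool (r = r')"
proof -
  define p where "p \<longleftrightarrow> odd (r div W) = odd (r' div W)"
  define q where "q \<longleftrightarrow> r mod W = r' mod W"
  define t where "t \<longleftrightarrow> r div (2 * W) = r' div (2 * W)"
  have "lift f r c * lift f r' c = of_bool (odd (c div W) = odd (r div W)) * of_bool (c mod W = r mod W) *
    (f (r div (2 * W)) (c div (2 * W)) *
      (of_bool (odd (c div W) = odd (r' div W)) * of_bool (c mod W = r' mod W) * f (r' div (2 * W)) (c div (2 * W))))" for c
    by (simp only: lift_def mult.assoc)
  then have "(\<Sum>c<2 * M * W. lift f r c * lift f r' c)
    = (\<Sum>i<M. f (r div (2 * W)) i * (of_bool p * of_bool q * f (r' div (2 * W)) i))"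
    using sum_lift[OF register_bounds(2)[of r], of "odd (r div W)" "\<lambda>i b w. f (r div (2 * W)) i *
        (of_bool (b = odd (r' div W)) * of_bool (w = r' mod W) * f (r' div (2 * W)) i)"]
    unfolding p_def q_def by (simp only:)
  also have "\<dots> = of_bool p * of_bool q * (\<Sum>i<M. f (r div (2 * W)) i * f (r' div (2 * W)) i)"
    by (cases p; cases q) simp_all
  also have "\<dots> = of_bool (p \<and> q \<and> t)"
    unfolding f[OF register_bounds(1)[OF r(1)] register_bounds(1)[OF r(2)]] t_def[symmetric] by simp
  also have "(p \<and> q \<and> t) \<longleftrightarrow> r = r'"
  proof
    assume "p \<and> q \<and> t"
    then have "odd (r div W) = odd (r' div W)" "r mod W = r' mod W" "r div (2 * W) = r' div (2 * W)"
      unfolding p_def q_def t_def by blast+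
    from encode_basis_index[of r, unfolded this] encode_basis_index[of r'] show "r = r'" by (rule trans[OF sym])
  qed (simp add: p_def q_def t_def)
  finally show ?thesis .
qed

lemma permutation_orthogonal:
  fixes \<sigma> :: "nat \<Rightarrow> nat"
  assumes "inj_on \<sigma> {..<m}" "\<sigma> ` {..<m} \<subseteq> {..<m}" "r < m" "r' < m"
  shows "(\<Sum>c<m. of_bool (c = \<sigma> r) * of_bool (c = \<sigma> r')) = (of_bool (r = r') :: real)"
proof -
  have "\<sigma> r < m" using assms by auto
  from sum_of_bool_mult[OF this, of "\<lambda>c. of_bool (c = \<sigma> r')"]
  have "(\<Sum>c<m. of_bool (c = \<sigma> r) * of_bool (c = \<sigma> r')) = (of_bool (\<sigma> r = \<sigma> r') :: real)" .
  then show ?thesis using assms by (simp add: inj_on_eq_iff)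
qed

end

section \<open>Repeated forrelation tests\<close>

context flat_orthogonal
begin

text \<open>In block form this is the matrix with rows (I, H) and (I, -H), divided by sqrt 2. It
  sends the state proportional to (x, y) to the pair x + H y, x - H y up to normalisation.\<close>

definition test_kernel :: "nat \<Rightarrow> nat \<Rightarrow> real" where
  "test_kernel r i = (if i < N then of_bool (i = r mod N) else (if r < N then 1 else - 1) * H (r mod N) (i - N)) / sqrt 2"

lemma sum_double: "(\<Sum>i<2 * N. f i) = (\<Sum>i<N. f i) + (\<Sum>i<N. f (N + i))" for f :: "nat \<Rightarrow> real"
  using sum_lessThan_add[of f N N] by (simp add: mult_2 add.commute)

lemma test_kernel_orthogonal:
  assumes "r < 2 * N" "r' < 2 * N"
  shows "(\<Sum>i<2 * N. test_kernel r i * test_kernel r' i) = of_bool (r = r')"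
proof -
  define s where "s r = (if r < N then 1 else - 1 :: real)" for r
  have m: "r mod N < N" "r' mod N < N" using N_pos by auto
  have "(\<Sum>i<2 * N. test_kernel r i * test_kernel r' i)
    = (\<Sum>i<N. of_bool (i = r mod N) * (of_bool (i = r' mod N) / 2)) + (\<Sum>i<N. s r * s r' / 2 * (H (r mod N) i * H (r' mod N) i))"
    unfolding sum_double by (intro arg_cong2[where f = "(+)"] sum.cong refl) (auto simp: test_kernel_def s_def)
  also have "(\<Sum>i<N. of_bool (i = r mod N) * (of_bool (i = r' mod N) / 2)) = of_bool (r mod N = r' mod N) / (2::real)"
    by (rule sum_of_bool_mult[OF m(1), where g = "\<lambda>i. of_bool (i = r' mod N) / 2"])
  also have "(\<Sum>i<N. s r * s r' / 2 * (H (r mod N) i * H (r' mod N) i)) = s r * s r' / 2 * of_bool (r mod N = r' mod N)"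
    unfolding sum_distrib_left[symmetric] row_orth[OF m] ..
  also have "of_bool (r mod N = r' mod N) / 2 + s r * s r' / 2 * of_bool (r mod N = r' mod N) = of_bool (r = r')"
  proof -
    have d: "r mod N = (if r < N then r else r - N)" "r' mod N = (if r' < N then r' else r' - N)"
      using assms by (auto simp: mod_if)
    show ?thesis unfolding d s_def using assms by (cases "r < N"; cases "r' < N") auto
  qed
  finally show ?thesis .
qed

text \<open>For a sign vector (x, y) both x and H y have squared norm N, so the squared norms of x +
  H y and x - H y differ only by the cross term, which is \<open>pair_form z\<close>.\<close>

lemma test_kernel_prob:
  assumes z: "\<And>i. i < 2 * N \<Longrightarrow> z i * z i = (1::real)"
  shows "(\<Sum>r<N. (\<Sum>i<2 * N. test_kernel r i * (z i / sqrt (2 * N)))\<^sup>2) = 1/2 + pair_form z / N / 2"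
    "(\<Sum>r<N. (\<Sum>i<2 * N. test_kernel (N + r) i * (z i / sqrt (2 * N)))\<^sup>2) = 1/2 - pair_form z / N / 2"
proof -
  define h where "h r = (\<Sum>j<N. H r j * z (N + j))" for r
  have zz: "(\<Sum>r<N. z r * z r) = N" using z by simp
  have "(\<Sum>r<N. (h r)\<^sup>2) = (\<Sum>j<N. (z (N + j))\<^sup>2)"
    unfolding h_def by (rule orthogonal_parseval[where G = "\<lambda>j i. H i j"]) (rule col_orth)
  also have "\<dots> = N" using z by (simp add: power2_eq_square)
  finally have hh: "(\<Sum>r<N. h r * h r) = N" by (simp add: power2_eq_square)
  have zh: "(\<Sum>r<N. z r * h r) = pair_form z"
    by (simp add: h_def pair_form_def sum_distrib_left mult_ac)
  have row: "(\<Sum>i<2 * N. test_kernel (c * N + r) i * (z i / sqrt (2 * N))) = (z r + (if c = 0 then 1 else - 1) * h r) / (sqrt 2 * sqrt (2 * N))"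
    if "r < N" "c \<le> 1" for r c
  proof -
    have m: "(c * N + r) mod N = r" using that by simp
    have lt: "c * N + r < N \<longleftrightarrow> c = 0" using that by (cases c) auto
    have "(\<Sum>i<2 * N. test_kernel (c * N + r) i * (z i / sqrt (2 * N)))
      = (\<Sum>i<N. of_bool (i = r) * (z i / (sqrt 2 * sqrt (2 * N))))
        + (\<Sum>i<N. (if c = 0 then 1 else - 1) / (sqrt 2 * sqrt (2 * N)) * (H r i * z (N + i)))"
      unfolding sum_double by (intro arg_cong2[where f = "(+)"] sum.cong refl) (use that in \<open>auto simp: test_kernel_def m lt\<close>)
    also have "\<dots> = z r / (sqrt 2 * sqrt (2 * N)) + (if c = 0 then 1 else - 1) / (sqrt 2 * sqrt (2 * N)) * h r"
      unfolding sum_distrib_left[symmetric] h_def[symmetric] sum_of_bool_mult[OF that(1), of "\<lambda>i. z i / (sqrt 2 * sqrt (2 * N))"] ..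
    finally show ?thesis by (simp add: add_divide_distrib)
  qed
  have den: "(sqrt 2 * sqrt (2 * N))\<^sup>2 = 4 * real N" by (simp add: power_mult_distrib)
  have sq: "(\<Sum>r<N. ((z r + e * h r) / (sqrt 2 * sqrt (2 * N)))\<^sup>2) = 1/2 + e * pair_form z / N / 2" if "e * e = 1" for e
  proof -
    have "(\<Sum>r<N. ((z r + e * h r) / (sqrt 2 * sqrt (2 * N)))\<^sup>2)
      = (\<Sum>r<N. (z r * z r + (e * e) * (h r * h r)) + 2 * e * (z r * h r)) / (4 * N)"
      unfolding power_divide den sum_divide_distrib by (intro sum.cong refl) (simp add: power2_eq_square algebra_simps)
    also have "\<dots> = (N + N + 2 * e * pair_form z) / (4 * N)"
      unfolding sum.distrib sum_distrib_left[symmetric] zz hh zh that by simp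
    also have "\<dots> = 1/2 + e * pair_form z / N / 2" using N_pos by (simp add: field_simps)
    finally show ?thesis .
  qed
  show "(\<Sum>r<N. (\<Sum>i<2 * N. test_kernel r i * (z i / sqrt (2 * N)))\<^sup>2) = 1/2 + pair_form z / N / 2"
    using sq[of 1] row[of _ 0] by simp
  show "(\<Sum>r<N. (\<Sum>i<2 * N. test_kernel (N + r) i * (z i / sqrt (2 * N)))\<^sup>2) = 1/2 - pair_form z / N / 2"
    using sq[of "- 1"] row[of _ 1] by simp
qed

end

definition block_kernel :: "nat \<Rightarrow> (nat \<Rightarrow> nat \<Rightarrow> real) \<Rightarrow> nat \<Rightarrow> nat \<Rightarrow> real" where
  "block_kernel L t r i = of_bool (i div L = r div L) * t (r mod L) (i mod L)"

lemma sum_block_kernel: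
  fixes g :: "nat \<Rightarrow> nat \<Rightarrow> real"
  assumes "a < k" "L > 0"
  shows "(\<Sum>i<k * L. of_bool (i div L = a) * g (i div L) (i mod L)) = (\<Sum>b<L. g a b)"
proof -
  have "(\<Sum>i<k * L. of_bool (i div L = a) * g (i div L) (i mod L))
    = (\<Sum>x<k. \<Sum>b<L. of_bool ((x * L + b) div L = a) * g ((x * L + b) div L) ((x * L + b) mod L))"
    by (rule sum_lessThan_mult)
  also have "\<dots> = (\<Sum>x<k. of_bool (x = a) * (\<Sum>b<L. g x b))"
    unfolding sum_distrib_left by (intro sum.cong refl) simp
  also have "\<dots> = (\<Sum>b<L. g a b)" by (rule sum_of_bool_mult[OF assms(1)])
  finally show ?thesis .
qed

lemma block_kernel_orthogonal:
  assumes t: "\<And>r r'. r < L \<Longrightarrow> r' < L \<Longrightarrow> (\<Sum>i<L. t r i * t r' i) = of_bool (r = r')"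
    and "r < k * L" "r' < k * L"
  shows "(\<Sum>i<k * L. block_kernel L t r i * block_kernel L t r' i) = of_bool (r = r')"
proof -
  have L: "L > 0" using assms(2) by (cases L) auto
  have a: "r div L < k" using assms(2) by (simp add: less_mult_imp_div_less)
  have m: "r mod L < L" "r' mod L < L" using L by auto
  have "(\<Sum>i<k * L. block_kernel L t r i * block_kernel L t r' i)
    = (\<Sum>i<k * L. of_bool (i div L = r div L) * (\<lambda>a b. t (r mod L) b * (of_bool (a = r' div L) * t (r' mod L) b)) (i div L) (i mod L))"
    by (simp only: block_kernel_def mult.assoc)
  also have "\<dots> = (\<Sum>b<L. t (r mod L) b * (of_bool (r div L = r' div L) * t (r' mod L) b))"
    by (rule sum_block_kernel[OF a L])
  also have "\<dots> = of_bool (r div L = r' div L) * (\<Sum>b<L. t (r mod L) b * t (r' mod L) b)"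
    by (cases "r div L = r' div L") simp_all
  also have "\<dots> = of_bool (r div L = r' div L \<and> r mod L = r' mod L)" unfolding t[OF m] by simp
  also have "(r div L = r' div L \<and> r mod L = r' mod L) \<longleftrightarrow> r = r'"
    by (metis div_mult_mod_eq)
  finally show ?thesis .
qed

lemma block_amplitude:
  assumes "j < k" "r < k * L"
  shows "(\<Sum>i<k * L. block_kernel L t r i * (of_bool (i div L = j) / sqrt L * z i))
    = of_bool (r div L = j) * (\<Sum>b<L. t (r mod L) b * (z (j * L + b) / sqrt L))"
proof -
  have L: "L > 0" using assms(2) by (cases L) auto
  have a: "r div L < k" using assms(2) by (simp add: less_mult_imp_div_less)
  have "(\<Sum>i<k * L. block_kernel L t r i * (of_bool (i div L = j) / sqrt L * z i))
    = (\<Sum>i<k * L. of_bool (i div L = r div L) * (\<lambda>a b. t (r mod L) b * (of_bool (a = j) / sqrt L * z (a * L + b))) (i div L) (i mod L))"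
    unfolding block_kernel_def by (intro sum.cong refl) (simp add: mult.assoc)
  also have "\<dots> = (\<Sum>b<L. t (r mod L) b * (of_bool (r div L = j) / sqrt L * z (r div L * L + b)))"
    by (rule sum_block_kernel[OF a L])
  also have "\<dots> = of_bool (r div L = j) * (\<Sum>b<L. t (r mod L) b * (z (j * L + b) / sqrt L))"
    by (cases "r div L = j") simp_all
  finally show ?thesis .
qed

text \<open>The workspace \<open>w < M ^ q\<close> is a stack of base-\<open>M\<close> digits holding the measurement registers of
  all earlier runs; \<open>c t\<close> is the amplitude vector produced by run \<open>t\<close>.\<close>

fun stack_amp :: "nat \<Rightarrow> (nat \<Rightarrow> nat \<Rightarrow> real) \<Rightarrow> nat \<Rightarrow> nat \<Rightarrow> real" where
  "stack_amp M c 0 w = of_bool (w = 0)"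
| "stack_amp M c (Suc t) w = stack_amp M c t (w div M) * c t (w mod M)"

fun stack_count :: "nat \<Rightarrow> (nat \<Rightarrow> bool) \<Rightarrow> (nat \<Rightarrow> bool) \<Rightarrow> nat \<Rightarrow> nat \<Rightarrow> nat" where
  "stack_count M sel acc 0 w = 0"
| "stack_count M sel acc (Suc t) w = stack_count M sel acc t (w div M) + of_bool (sel t \<and> acc (w mod M))"

lemma stack_amp_eq_0:
  assumes "M > 0" "w \<ge> M ^ t"
  shows "stack_amp M c t w = 0"
  using assms(2)
proof (induction t arbitrary: w)
  case (Suc t)
  have "M ^ t * M div M \<le> w div M" using Suc.prems by (intro div_le_mono) (simp add: mult.commute)
  then have "w div M \<ge> M ^ t" using assms(1) by simp
  then show ?case using Suc.IH by simp
qed simp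

lemma sum_digits:
  fixes F G :: "nat \<Rightarrow> real"
  assumes "M > 0"
  shows "(\<Sum>w<M ^ Suc t. F (w div M) * G (w mod M)) = (\<Sum>w<M ^ t. F w) * (\<Sum>r<M. G r)"
proof -
  have "(\<Sum>w<M ^ Suc t. F (w div M) * G (w mod M)) = (\<Sum>a<M ^ t. \<Sum>b<M. F ((a * M + b) div M) * G ((a * M + b) mod M))"
    unfolding power_Suc2 by (rule sum_lessThan_mult)
  also have "\<dots> = (\<Sum>a<M ^ t. \<Sum>b<M. F a * G b)" by (intro sum.cong refl) simp
  finally show ?thesis by (simp add: sum_product)
qed

lemma stack_amp_norm:
  assumes "M > 0" "\<And>t. (\<Sum>r<M. (c t r)\<^sup>2) = 1"
  shows "(\<Sum>w<M ^ t. (stack_amp M c t w)\<^sup>2) = 1"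
proof (induction t)
  case (Suc t)
  have "(\<Sum>w<M ^ Suc t. (stack_amp M c (Suc t) w)\<^sup>2) = (\<Sum>w<M ^ Suc t. (stack_amp M c t (w div M))\<^sup>2 * (c t (w mod M))\<^sup>2)"
    by (simp only: stack_amp.simps power_mult_distrib)
  also have "\<dots> = (\<Sum>w<M ^ t. (stack_amp M c t w)\<^sup>2) * (\<Sum>r<M. (c t r)\<^sup>2)" by (rule sum_digits[OF assms(1)])
  finally show ?case using Suc assms(2) by simp
qed simp

lemma bernoulli_mgf_le:
  fixes p x :: real
  assumes "0 \<le> p" "p \<le> 1" "\<bar>x\<bar> \<le> 1"
  shows "p * exp (x * (1 - p)) + (1 - p) * exp (x * (0 - p)) \<le> exp (x\<^sup>2 / 4)"
proof -
  have "\<bar>x * (1 - p)\<bar> \<le> 1 * 1" "\<bar>x * (0 - p)\<bar> \<le> 1 * 1" unfolding abs_mult using assms by (intro mult_mono; simp)+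
  then have e: "exp (x * (1 - p)) \<le> 1 + x * (1 - p) + (x * (1 - p))\<^sup>2" "exp (x * (0 - p)) \<le> 1 + x * (0 - p) + (x * (0 - p))\<^sup>2"
    by (simp_all only: mult_1 exp_le_quadratic)
  have "p * exp (x * (1 - p)) + (1 - p) * exp (x * (0 - p))
    \<le> p * (1 + x * (1 - p) + (x * (1 - p))\<^sup>2) + (1 - p) * (1 + x * (0 - p) + (x * (0 - p))\<^sup>2)"
    using e assms by (intro add_mono mult_left_mono) auto
  also have "\<dots> = 1 + x\<^sup>2 * (p * (1 - p))" by (simp add: power2_eq_square algebra_simps)
  also have "\<dots> \<le> 1 + x\<^sup>2 * (1/4)"
  proof -
    have "0 \<le> (p - 1/2)\<^sup>2" by simp
    then have "p * (1 - p) \<le> 1/4" by (simp add: power2_eq_square algebra_simps)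
    then show ?thesis by (intro add_left_mono mult_left_mono) auto
  qed
  also have "\<dots> \<le> exp (x\<^sup>2 / 4)" using exp_ge_add_one_self[of "x\<^sup>2 / 4"] by simp
  finally show ?thesis .
qed

text \<open>The squared amplitudes form a product distribution on the digits, under which the count
  is a sum of independent Bernoulli variables with parameter p over the selected runs. Runs that are
  not selected contribute the factor 1.\<close>

lemma stack_count_mgf_le:
  assumes M: "M > 0" and norm: "\<And>t. (\<Sum>r<M. (c t r)\<^sup>2) = 1"
    and acc: "\<And>t. sel t \<Longrightarrow> (\<Sum>r<M. of_bool (acc r) * (c t r)\<^sup>2) = p" and x: "\<bar>x\<bar> \<le> 1"
  shows "(\<Sum>w<M ^ t. (stack_amp M c t w)\<^sup>2 * exp (x * (real (stack_count M sel acc t w) - p * real (\<Sum>s<t. of_bool (sel s)))))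
    \<le> exp (x\<^sup>2 / 4 * real (\<Sum>s<t. of_bool (sel s)))"
proof (induction t)
  case (Suc t)
  define m where "m = (\<Sum>s<t. of_bool (sel s) :: nat)"
  define F where "F w = (stack_amp M c t w)\<^sup>2 * exp (x * (real (stack_count M sel acc t w) - p * real m))" for w
  define G where "G r = (c t r)\<^sup>2 * exp (x * (of_bool (sel t) * (of_bool (acc r) - p)))" for r
  have IH: "(\<Sum>w<M ^ t. F w) \<le> exp (x\<^sup>2 / 4 * real m)" using Suc by (simp only: F_def m_def)
  have F0: "(\<Sum>w<M ^ t. F w) \<ge> 0" by (intro sum_nonneg) (simp add: F_def)
  have m': "(\<Sum>s<Suc t. of_bool (sel s)) = m + of_bool (sel t)" by (simp add: m_def)
  have "(stack_amp M c (Suc t) w)\<^sup>2 * exp (x * (real (stack_count M sel acc (Suc t) w) - p * real (\<Sum>s<Suc t. of_bool (sel s))))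
    = F (w div M) * G (w mod M)" for w
  proof -
    have "x * (real (stack_count M sel acc (Suc t) w) - p * real (m + of_bool (sel t)))
      = x * (real (stack_count M sel acc t (w div M)) - p * real m) + x * (of_bool (sel t) * (of_bool (acc (w mod M)) - p))"
      by (cases "sel t") (simp_all add: algebra_simps)
    then show ?thesis unfolding m' F_def G_def by (simp only: exp_add stack_amp.simps power_mult_distrib mult_ac)
  qed
  then have "(\<Sum>w<M ^ Suc t. (stack_amp M c (Suc t) w)\<^sup>2 * exp (x * (real (stack_count M sel acc (Suc t) w) - p * real (\<Sum>s<Suc t. of_bool (sel s)))))
    = (\<Sum>w<M ^ Suc t. F (w div M) * G (w mod M))" by (simp only:)
  also have "\<dots> = (\<Sum>w<M ^ t. F w) * (\<Sum>r<M. G r)" by (rule sum_digits[OF M])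
  also have "\<dots> \<le> exp (x\<^sup>2 / 4 * real m) * exp (x\<^sup>2 / 4 * of_bool (sel t))"
  proof (rule mult_mono[OF IH])
    show "(\<Sum>r<M. G r) \<le> exp (x\<^sup>2 / 4 * of_bool (sel t))"
    proof (cases "sel t")
      case True
      have p0: "0 \<le> p" unfolding acc[OF True, symmetric] by (intro sum_nonneg) auto
      have p1: "p \<le> 1" unfolding acc[OF True, symmetric] norm[of t, symmetric] by (intro sum_mono) auto
      have "(\<Sum>r<M. G r) = (\<Sum>r<M. of_bool (acc r) * (c t r)\<^sup>2 * exp (x * (1 - p)) + ((c t r)\<^sup>2 - of_bool (acc r) * (c t r)\<^sup>2) * exp (x * (0 - p)))"
        unfolding G_def using True by (intro sum.cong refl) auto
      also have "\<dots> = p * exp (x * (1 - p)) + (1 - p) * exp (x * (0 - p))"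
        unfolding sum.distrib sum_distrib_right[symmetric] sum_subtractf norm acc[OF True] ..
      also have "\<dots> \<le> exp (x\<^sup>2 / 4)" by (rule bernoulli_mgf_le[OF p0 p1 x])
      finally show ?thesis using True by simp
    next
      case False
      then show ?thesis using norm[of t] by (simp add: G_def)
    qed
    show "0 \<le> (\<Sum>r<M. G r)" by (intro sum_nonneg) (simp add: G_def)
  qed simp
  also have "\<dots> = exp (x\<^sup>2 / 4 * real (\<Sum>s<Suc t. of_bool (sel s)))" unfolding m' by (simp add: distrib_left exp_add)
  finally show ?case .
qed simp

text \<open>The sign s selects the upper or the lower tail. The parameter
  \<open>\<epsilon> / 8\<close> optimises the Chernoff exponent for the deviation
  \<open>\<epsilon> / 16\<close> per run: it is -1/128 + 1/256 = -1/256 times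
  \<open>\<tau> * \<epsilon>\<^sup>2\<close>. The bound \<open>\<epsilon> \<le> 8\<close> keeps the
  parameter in [-1, 1].\<close>

lemma stack_count_tail:
  assumes M: "M > 0" and norm: "\<And>t. (\<Sum>r<M. (c t r)\<^sup>2) = 1"
    and acc: "\<And>t. sel t \<Longrightarrow> (\<Sum>r<M. of_bool (acc r) * (c t r)\<^sup>2) = p"
    and \<tau>: "(\<Sum>s<q. of_bool (sel s)) = \<tau>" and \<epsilon>: "0 < \<epsilon>" "\<epsilon> \<le> 8"
    and B: "\<And>w. w \<in> B \<Longrightarrow> w < M ^ q \<and> s * (real (stack_count M sel acc q w) - p * real \<tau>) \<ge> \<epsilon> / 16 * real \<tau>"
    and s: "s = 1 \<or> s = -1"
  shows "(\<Sum>w\<in>B. (stack_amp M c q w)\<^sup>2) \<le> exp (- real \<tau> * \<epsilon>\<^sup>2 / 256)"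
proof -
  define x where "x = s * (\<epsilon> / 8)"
  have x: "\<bar>x\<bar> \<le> 1" using s \<epsilon> by (auto simp: x_def)
  have x2: "x\<^sup>2 = \<epsilon>\<^sup>2 / 64" using s by (auto simp: x_def power_divide)
  define A where "A w = (stack_amp M c q w)\<^sup>2 * exp (x * (real (stack_count M sel acc q w) - p * real \<tau>))" for w
  have "(\<Sum>w\<in>B. (stack_amp M c q w)\<^sup>2) \<le> (\<Sum>w\<in>B. exp (- (\<epsilon> / 8 * (\<epsilon> / 16 * real \<tau>))) * A w)"
  proof (rule sum_mono)
    fix w assume w: "w \<in> B"
    have "\<epsilon> / 8 * (\<epsilon> / 16 * real \<tau>) \<le> \<epsilon> / 8 * (s * (real (stack_count M sel acc q w) - p * real \<tau>))"
      using B[OF w] \<epsilon> by (intro mult_left_mono) auto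
    also have "\<dots> = x * (real (stack_count M sel acc q w) - p * real \<tau>)" by (simp add: x_def)
    finally have "exp (- (\<epsilon> / 8 * (\<epsilon> / 16 * real \<tau>))) * exp (x * (real (stack_count M sel acc q w) - p * real \<tau>)) \<ge> 1"
      by (simp flip: exp_add)
    then have "(stack_amp M c q w)\<^sup>2 * 1 \<le> (stack_amp M c q w)\<^sup>2 * (exp (- (\<epsilon> / 8 * (\<epsilon> / 16 * real \<tau>))) * exp (x * (real (stack_count M sel acc q w) - p * real \<tau>)))"
      by (intro mult_left_mono) auto
    then show "(stack_amp M c q w)\<^sup>2 \<le> exp (- (\<epsilon> / 8 * (\<epsilon> / 16 * real \<tau>))) * A w"
      unfolding A_def by (simp only: mult_1_right mult.left_commute)
  qed
  also have "\<dots> = exp (- (\<epsilon> / 8 * (\<epsilon> / 16 * real \<tau>))) * (\<Sum>w\<in>B. A w)" by (simp only: sum_distrib_left)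
  also have "\<dots> \<le> exp (- (\<epsilon> / 8 * (\<epsilon> / 16 * real \<tau>))) * exp (x\<^sup>2 / 4 * real \<tau>)"
  proof (rule mult_left_mono)
    have "(\<Sum>w\<in>B. A w) \<le> (\<Sum>w<M ^ q. A w)" using B by (intro sum_mono2) (auto simp: A_def)
    also have "\<dots> \<le> exp (x\<^sup>2 / 4 * real \<tau>)"
      using stack_count_mgf_le[of M c sel acc p x q, OF M norm acc x] unfolding \<tau> A_def .
    finally show "(\<Sum>w\<in>B. A w) \<le> exp (x\<^sup>2 / 4 * real \<tau>)" .
  qed simp
  also have "\<dots> = exp (- real \<tau> * \<epsilon>\<^sup>2 / 256)"
  proof -
    have "- (\<epsilon> / 8 * (\<epsilon> / 16 * real \<tau>)) + x\<^sup>2 / 4 * real \<tau> = - real \<tau> * \<epsilon>\<^sup>2 / 256"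
      unfolding x2 by (simp add: power2_eq_square field_simps)
    then show ?thesis by (simp only: exp_add[symmetric])
  qed
  finally show ?thesis .
qed

section \<open>Deferred measurement with a stack of registers\<close>

locale stack_registers =
  fixes M q :: nat
  assumes M_pos: "M > 0" and q_pos: "q > 0"
begin

sublocale registers M "M ^ q"
  by standard (use M_pos in simp)

definition push_source :: "nat \<Rightarrow> nat" where
  "push_source r = basis_index (M ^ q) (r mod M ^ q mod M) (odd (r div M ^ q))
     (r mod M ^ q div M + r div (2 * M ^ q) * M ^ (q - 1))"

lemma power_q: "M ^ q = M ^ (q - 1) * M"
  using q_pos by (cases q) (simp_all add: mult.commute)

lemma push_bounds:
  assumes "i < M" "w < M ^ q"
  shows "w mod M < M" "w div M < M ^ (q - 1)" "w div M + i * M ^ (q - 1) < M ^ q"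
proof -
  show "w mod M < M" using M_pos by simp
  show 1: "w div M < M ^ (q - 1)" using assms(2) unfolding power_q by (rule less_mult_imp_div_less)
  have "w div M + i * M ^ (q - 1) < Suc i * M ^ (q - 1)" using 1 by simp
  also have "\<dots> \<le> M * M ^ (q - 1)" using assms(1) by (intro mult_right_mono) auto
  finally show "w div M + i * M ^ (q - 1) < M ^ q" unfolding power_q by (simp add: mult.commute)
qed

lemma push_source_less: "r < 2 * M * M ^ q \<Longrightarrow> push_source r < 2 * M * M ^ q"
  unfolding push_source_def
  using push_bounds(1,3)[OF register_bounds(1)[of r] register_bounds(2)[of r]] by (intro basis_index_less)

lemma inj_push_source: "inj_on push_source {..<2 * M * M ^ q}"
proof (rule inj_onI)
  fix r r' assume r: "r \<in> {..<2 * M * M ^ q}" "r' \<in> {..<2 * M * M ^ q}" and eq: "push_source r = push_source r'"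
  define i b w i' b' w' where d: "i = r div (2 * M ^ q)" "b = odd (r div M ^ q)" "w = r mod M ^ q"
     "i' = r' div (2 * M ^ q)" "b' = odd (r' div M ^ q)" "w' = r' mod M ^ q"
  have bd: "i < M" "w < M ^ q" "i' < M" "w' < M ^ q"
    using r register_bounds(1)[of r] register_bounds(1)[of r'] register_bounds(2) by (auto simp: d)
  note p = push_bounds[OF bd(1,2)] and p' = push_bounds[OF bd(3,4)]
  have e: "basis_index (M ^ q) (w mod M) b (w div M + i * M ^ (q - 1)) = basis_index (M ^ q) (w' mod M) b' (w' div M + i' * M ^ (q - 1))"
    using eq by (simp only: push_source_def d)
  have 1: "w mod M = w' mod M"
    using arg_cong[OF e, of "\<lambda>x. x div (2 * M ^ q)"] unfolding decode_basis_index(1)[OF p(3)] decode_basis_index(1)[OF p'(3)] .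
  have 2: "b = b'"
    using arg_cong[OF e, of "\<lambda>x. odd (x div M ^ q)"] unfolding decode_basis_index(2)[OF p(3)] decode_basis_index(2)[OF p'(3)] .
  have 3: "w div M + i * M ^ (q - 1) = w' div M + i' * M ^ (q - 1)"
    using arg_cong[OF e, of "\<lambda>x. x mod M ^ q"] unfolding decode_basis_index(3)[OF p(3)] decode_basis_index(3)[OF p'(3)] .
  have "(x + j * X) div X = j" if "x < X" for x j X :: nat using that by simp
  from this[OF p(2)] this[OF p'(2)]
  have "(w div M + i * M ^ (q - 1)) div M ^ (q - 1) = i" "(w' div M + i' * M ^ (q - 1)) div M ^ (q - 1) = i'" .
  with 3 have 4: "i = i'" by simp
  with 3 have 5: "w div M = w' div M" by simp
  have 6: "w = w'" using 1 5 by (metis div_mult_mod_eq)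
  have "r = basis_index (M ^ q) i b w" unfolding d by (rule encode_basis_index[symmetric])
  also have "\<dots> = r'" unfolding 2 4 6 unfolding d by (rule encode_basis_index)
  finally show "r = r'" .
qed

lemma push_state:
  "rmat (2 * M * M ^ q) (\<lambda>r c. of_bool (c = push_source r)) *\<^sub>v state g
    = state (\<lambda>i b w. g (w mod M) b (w div M + i * M ^ (q - 1)))"
  unfolding state_def rmat_mult_rvec
proof (rule rvec_cong)
  fix r assume r: "r < 2 * M * M ^ q"
  define G where "G c = g (c div (2 * M ^ q)) (odd (c div M ^ q)) (c mod M ^ q)" for c
  have "(\<Sum>c<2 * M * M ^ q. of_bool (c = push_source r) * G c) = G (push_source r)"
    by (rule sum_of_bool_mult[OF push_source_less[OF r]])
  also have "\<dots> = g (r mod M ^ q mod M) (odd (r div M ^ q)) (r mod M ^ q div M + r div (2 * M ^ q) * M ^ (q - 1))"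
    unfolding G_def push_source_def
      decode_basis_index[OF push_bounds(3)[OF register_bounds(1)[OF r] register_bounds(2)[of r]]] ..
  finally show "(\<Sum>c<2 * M * M ^ q. of_bool (c = push_source r) * g (c div (2 * M ^ q)) (odd (c div M ^ q)) (c mod M ^ q))
    = g (r mod M ^ q mod M) (odd (r div M ^ q)) (r mod M ^ q div M + r div (2 * M ^ q) * M ^ (q - 1))"
    unfolding G_def .
qed

definition minus_amp :: "bool \<Rightarrow> real" where
  "minus_amp b = (if b then - 1 else 1) / sqrt 2"

text \<open>In run \<open>t\<close> the query register holds \<open>a t\<close>, the answer bit holds the state with amplitudes
  \<open>minus_amp\<close> (so that a query multiplies by the sign \<open>z\<^sub>i\<close>), the unitary with kernel \<open>K\<close> is applied to
  the query register, and the result is pushed onto the workspace.\<close>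

lemma repeated_test_circuit:
  assumes a: "\<And>t. (\<Sum>i<M. (a t i)\<^sup>2) = 1"
    and K: "\<And>i j. i < M \<Longrightarrow> j < M \<Longrightarrow> (\<Sum>l<M. K i l * K j l) = of_bool (i = j)"
  obtains U Us where "unitary_mat (2 * M * M ^ q) U" "\<forall>V\<in>set Us. unitary_mat (2 * M * M ^ q) V" "length Us = q"
    "\<And>z. z \<in> sign_cube M \<Longrightarrow> final_state M (M ^ q) U Us z
       = state (\<lambda>i b w. a q i * minus_amp b * stack_amp M (\<lambda>t r. \<Sum>i<M. K r i * (a t i * z $ i)) q w)"
proof -
  define D where "D = 2 * M * M ^ q"
  have D: "D > 0" using M_pos by (simp add: D_def)
  have bsum: "(\<Sum>b\<in>UNIV. (minus_amp b)\<^sup>2) = 1" by (simp add: UNIV_bool minus_amp_def power_divide)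
  have "\<exists>A. (\<forall>i j. i < M \<longrightarrow> j < M \<longrightarrow> (\<Sum>l<M. A i l * A j l) = of_bool (i = j)) \<and> (\<forall>i<M. A i 0 = a t i)" for t
    using orthogonal_with_first_column[OF M_pos a[of t]] by metis
  then obtain A where A: "\<And>t i j. i < M \<Longrightarrow> j < M \<Longrightarrow> (\<Sum>l<M. A t i l * A t j l) = of_bool (i = j)"
    "\<And>t i. i < M \<Longrightarrow> A t i 0 = a t i" by metis
  \<comment> \<open>The amplitudes before run 0: the query register holds \<open>a 0\<close>, the
    answer bit is set for phase queries, and the stack is empty.\<close>
  define g0 where "g0 i b w = a 0 i * minus_amp b * of_bool (w = (0::nat))" for i b w
  have "(\<Sum>r<D. (g0 (r div (2 * M ^ q)) (odd (r div M ^ q)) (r mod M ^ q))\<^sup>2) = 1"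
  proof -
    have "(\<Sum>r<D. (g0 (r div (2 * M ^ q)) (odd (r div M ^ q)) (r mod M ^ q))\<^sup>2) = (\<Sum>i<M. \<Sum>b\<in>UNIV. \<Sum>w<M ^ q. (g0 i b w)\<^sup>2)"
      unfolding D_def by (rule sum_registers[OF W_pos, where F = "\<lambda>i b w. (g0 i b w)\<^sup>2"])
    also have "\<dots> = (\<Sum>i<M. \<Sum>b\<in>UNIV. (a 0 i)\<^sup>2 * (minus_amp b)\<^sup>2)"
    proof (intro sum.cong refl)
      fix i b
      have "(\<Sum>w<M ^ q. (g0 i b w)\<^sup>2) = (\<Sum>w<M ^ q. of_bool (w = 0) * ((a 0 i)\<^sup>2 * (minus_amp b)\<^sup>2))"
        by (intro sum.cong refl) (simp add: g0_def power_mult_distrib)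
      also have "\<dots> = (a 0 i)\<^sup>2 * (minus_amp b)\<^sup>2" by (rule sum_of_bool_mult[OF W_pos])
      finally show "(\<Sum>w<M ^ q. (g0 i b w)\<^sup>2) = (a 0 i)\<^sup>2 * (minus_amp b)\<^sup>2" .
    qed
    also have "\<dots> = 1" unfolding sum_distrib_left[symmetric] bsum using a[of 0] by simp
    finally show ?thesis .
  qed
  from orthogonal_with_first_column[OF D this] obtain U0 where
    U0: "\<And>i j. i < D \<Longrightarrow> j < D \<Longrightarrow> (\<Sum>l<D. U0 i l * U0 j l) = of_bool (i = j)"
    "\<And>r. r < D \<Longrightarrow> U0 r 0 = g0 (r div (2 * M ^ q)) (odd (r div M ^ q)) (r mod M ^ q)" by blast
  define \<phi> where "\<phi> z t i b w = a t i * minus_amp b * stack_amp M (\<lambda>t r. \<Sum>i<M. K r i * (a t i * z $ i)) t w" for z t i b w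
  have init: "rmat D U0 *\<^sub>v unit_vec D 0 = state (\<phi> z 0)" for z
  proof -
    have "unit_vec D 0 = rvec D (\<lambda>c. of_bool (c = 0))" by (rule eq_vecI) (auto simp: rvec_def)
    then have "rmat D U0 *\<^sub>v unit_vec D 0 = rvec D (\<lambda>r. \<Sum>c<D. of_bool (c = 0) * U0 r c)"
      by (simp only: rmat_mult_rvec mult.commute)
    also have "\<dots> = rvec D (\<lambda>r. U0 r 0)" by (simp only: sum_of_bool_mult[OF D])
    also have "\<dots> = state (\<phi> z 0)" unfolding state_def D_def[symmetric]
      by (rule rvec_cong) (simp add: U0(2) g0_def \<phi>_def)
    finally show ?thesis .
  qed
  define P where "P r c = (of_bool (c = push_source r) :: real)" for r c
  \<comment> \<open>After the query of run t this applies the test, pushes the outcome register, and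
    prepares \<open>a (Suc t)\<close> in the register that the push has reset to 0. The last such
    step prepares \<open>a q\<close>, which therefore occurs in the final state.\<close>
  define V where "V t = rmat D (lift (A (Suc t))) * (rmat D P * rmat D (lift K))" for t
  have Vu: "unitary_mat D (V t)" for t
    unfolding V_def rmat_mult
  proof (rule unitary_rmat, rule orthogonal_mult)
    show "(\<Sum>l<D. lift (A (Suc t)) i l * lift (A (Suc t)) j l) = of_bool (i = j)" if "i < D" "j < D" for i j
      using A(1) that unfolding D_def by (rule lift_orthogonal[where f = "A (Suc t)"])
    show "(\<Sum>l<D. (\<Sum>p<D. P i p * lift K p l) * (\<Sum>p<D. P j p * lift K p l)) = of_bool (i = j)" if "i < D" "j < D" for i j
    proof (rule orthogonal_mult[OF _ _ that])
      show "(\<Sum>l<D. P i l * P j l) = of_bool (i = j)" if "i < D" "j < D" for i j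
        unfolding P_def using inj_push_source push_source_less that unfolding D_def[symmetric]
        by (intro permutation_orthogonal) auto
      show "(\<Sum>l<D. lift K i l * lift K j l) = of_bool (i = j)" if "i < D" "j < D" for i j
        using K that unfolding D_def by (rule lift_orthogonal[where f = K])
    qed
  qed
  have step: "V t *\<^sub>v (query_op M (M ^ q) z *\<^sub>v state (\<phi> z t)) = state (\<phi> z (Suc t))" if t: "t < q" and z: "z \<in> sign_cube M" for t z
  proof -
    define c where "c t r = (\<Sum>i<M. K r i * (a t i * z $ i))" for t r
    define S where "S = stack_amp M c"
    have \<phi>S: "\<phi> z t = (\<lambda>i b w. a t i * minus_amp b * S t w)" for t
      by (intro ext) (simp only: \<phi>_def S_def c_def[abs_def])
    have 1: "query_op M (M ^ q) z *\<^sub>v state (\<phi> z t) = state (\<lambda>i b w. (a t i * z $ i) * (minus_amp b * S t w))"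
      unfolding query_op_state
    proof (rule state_cong)
      fix i b w assume "i < M"
      then have "z $ i = -1 \<or> z $ i = 1" using sign_cube_cases[OF z] by blast
      then have "minus_amp (b \<noteq> (z $ i = -1)) = z $ i * minus_amp b" by (cases b) (auto simp: minus_amp_def)
      then show "\<phi> z t i (b \<noteq> (z $ i = -1)) w = (a t i * z $ i) * (minus_amp b * S t w)"
        unfolding \<phi>S by (simp only: mult.assoc)
    qed
    have 2: "rmat D (lift K) *\<^sub>v state (\<lambda>i b w. (a t i * z $ i) * (minus_amp b * S t w)) = state (\<lambda>i b w. c t i * (minus_amp b * S t w))"
      unfolding D_def lift_state c_def sum_distrib_right by (simp only: mult.assoc)
    have 3: "rmat D P *\<^sub>v state (\<lambda>i b w. c t i * (minus_amp b * S t w)) = state (\<lambda>i b w. of_bool (i = 0) * (minus_amp b * S (Suc t) w))"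
      unfolding D_def P_def[abs_def] push_state
    proof (rule state_cong)
      fix i b w assume "i < M" "w < M ^ q"
      show "c t (w mod M) * (minus_amp b * S t (w div M + i * M ^ (q - 1))) = of_bool (i = 0) * (minus_amp b * S (Suc t) w)"
      proof (cases "i = 0")
        case True
        then show ?thesis by (simp add: S_def mult_ac)
      next
        case False
        \<comment> \<open>A nonzero digit i would have been the top digit of the old stack, which is
          still 0 because t < q.\<close>
        have "M ^ t \<le> M ^ (q - 1)" using M_pos t by (intro power_increasing) auto
        also have "\<dots> \<le> i * M ^ (q - 1)" using False by simp
        also have "\<dots> \<le> w div M + i * M ^ (q - 1)" by simp
        finally have "S t (w div M + i * M ^ (q - 1)) = 0" unfolding S_def by (rule stack_amp_eq_0[OF M_pos])
        then show ?thesis using False by simp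
      qed
    qed
    have 4: "rmat D (lift (A (Suc t))) *\<^sub>v state (\<lambda>i b w. of_bool (i = 0) * (minus_amp b * S (Suc t) w)) = state (\<phi> z (Suc t))"
      unfolding D_def lift_state
    proof (rule state_cong)
      fix i b w assume i: "i < M"
      have "(\<Sum>i'<M. A (Suc t) i i' * (of_bool (i' = 0) * (minus_amp b * S (Suc t) w)))
        = (\<Sum>i'<M. of_bool (i' = 0) * (A (Suc t) i i' * (minus_amp b * S (Suc t) w)))"
        by (simp only: mult.left_commute)
      also have "\<dots> = A (Suc t) i 0 * (minus_amp b * S (Suc t) w)" by (rule sum_of_bool_mult[OF M_pos])
      finally show "(\<Sum>i'<M. A (Suc t) i i' * (of_bool (i' = 0) * (minus_amp b * S (Suc t) w))) = \<phi> z (Suc t) i b w"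
        unfolding \<phi>S A(2)[OF i] by (simp only: mult.assoc)
    qed
    have sc: "state g \<in> carrier_vec D" for g by (simp add: state_def D_def)
    have "V t *\<^sub>v state g = rmat D (lift (A (Suc t))) *\<^sub>v (rmat D P *\<^sub>v (rmat D (lift K) *\<^sub>v state g))" for g
    proof -
      have "V t *\<^sub>v state g = rmat D (lift (A (Suc t))) *\<^sub>v ((rmat D P * rmat D (lift K)) *\<^sub>v state g)"
        unfolding V_def by (rule assoc_mult_mat_vec[OF rmat_carrier mult_carrier_mat[OF rmat_carrier rmat_carrier] sc])
      also have "(rmat D P * rmat D (lift K)) *\<^sub>v state g = rmat D P *\<^sub>v (rmat D (lift K) *\<^sub>v state g)"
        by (rule assoc_mult_mat_vec[OF rmat_carrier rmat_carrier sc])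
      finally show ?thesis .
    qed
    then show ?thesis unfolding 1 using 2 3 4 by simp
  qed
  have fin: "foldl (\<lambda>\<psi> V. V *\<^sub>v (query_op M (M ^ q) z *\<^sub>v \<psi>)) (rmat D U0 *\<^sub>v unit_vec D 0) (map V [0..<t]) = state (\<phi> z t)"
    if "t \<le> q" "z \<in> sign_cube M" for t z
    using that(1)
  proof (induction t)
    case 0
    then show ?case by (simp add: init)
  next
    case (Suc t)
    then show ?case using step[of t z] that(2) by simp
  qed
  show ?thesis
  proof (rule that[of "rmat D U0" "map V [0..<q]"])
    show "unitary_mat (2 * M * M ^ q) (rmat D U0)" unfolding D_def[symmetric] by (rule unitary_rmat[OF U0(1)])
    show "\<forall>V\<in>set (map V [0..<q]). unitary_mat (2 * M * M ^ q) V" using Vu by (auto simp: D_def)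
    show "length (map V [0..<q]) = q" by simp
    show "final_state M (M ^ q) (rmat D U0) (map V [0..<q]) z
       = state (\<lambda>i b w. a q i * minus_amp b * stack_amp M (\<lambda>t r. \<Sum>i<M. K r i * (a t i * z $ i)) q w)" if "z \<in> sign_cube M" for z
      using fin[OF order_refl that] unfolding final_state_def D_def[symmetric] \<phi>_def[abs_def] .
  qed
qed

lemma output_prob_state:
  assumes "(\<Sum>i<M. (a i)\<^sup>2) = 1"
  shows "output_prob (state (\<lambda>i b w. a i * minus_amp b * S w)) (\<lambda>r. out (r mod M ^ q)) s
    = (\<Sum>w | w < M ^ q \<and> out w = s. (S w)\<^sup>2)"
proof -
  define D where "D = 2 * M * M ^ q"
  define F where "F i b w = of_bool (out w = s) * (a i * minus_amp b * S w)\<^sup>2" for i b w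
  have bsum: "(\<Sum>b\<in>UNIV. (minus_amp b)\<^sup>2) = 1" by (simp add: UNIV_bool minus_amp_def power_divide)
  have "output_prob (state (\<lambda>i b w. a i * minus_amp b * S w)) (\<lambda>r. out (r mod M ^ q)) s
    = (\<Sum>r | r < D \<and> out (r mod M ^ q) = s. (a (r div (2 * M ^ q)) * minus_amp (odd (r div M ^ q)) * S (r mod M ^ q))\<^sup>2)"
    unfolding output_prob_def state_def D_def[symmetric]
    by (intro sum.cong) (auto simp: rvec_def norm_mult power_mult_distrib)
  also have "\<dots> = (\<Sum>r<D. F (r div (2 * M ^ q)) (odd (r div M ^ q)) (r mod M ^ q))"
    by (intro sum.mono_neutral_cong_left) (auto simp: F_def)
  also have "\<dots> = (\<Sum>i<M. \<Sum>b\<in>UNIV. \<Sum>w<M ^ q. F i b w)" unfolding D_def by (rule sum_registers[OF W_pos])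
  also have "\<dots> = (\<Sum>i<M. \<Sum>b\<in>UNIV. (a i)\<^sup>2 * ((minus_amp b)\<^sup>2 * (\<Sum>w<M ^ q. of_bool (out w = s) * (S w)\<^sup>2)))"
    unfolding F_def sum_distrib_left by (intro sum.cong refl) (simp only: power_mult_distrib mult_ac)
  also have "\<dots> = (\<Sum>w<M ^ q. of_bool (out w = s) * (S w)\<^sup>2)"
    unfolding sum_distrib_left[symmetric] sum_distrib_right[symmetric] bsum assms by simp
  also have "\<dots> = (\<Sum>w | w < M ^ q \<and> out w = s. (S w)\<^sup>2)"
    by (intro sum.mono_neutral_cong_right) auto
  finally show ?thesis .
qed

end

section \<open>The quantum algorithm and its query count\<close>

text \<open>Every block gets its own majority-type decision from \<tau> runs, and the product of the
  decisions is returned. A union bound over the k blocks leaves total error at most 1/3, which is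
  the hypothesis \<open>small\<close>.\<close>

lemma forr_quantum_upper_bound:
  fixes n k \<tau> :: nat
  assumes k: "k \<ge> 1" and \<tau>: "\<tau> \<ge> 1" and \<epsilon>: "0 < forr_eps n k" "forr_eps n k \<le> 8"
    and small: "real k * exp (- real \<tau> * (forr_eps n k)\<^sup>2 / 256) \<le> 1/3"
  shows "bounded_error_quantum_computable (2 * k * 2 ^ n) (xor_forr n k) (k * \<tau>)"
proof -
  define N where "N = (2::nat) ^ n"
  define L where "L = 2 * N"
  define M where "M = k * L"
  define q where "q = k * \<tau>"
  define e where "e = forr_eps n k"
  have pos: "N > 0" "L > 0" "M > 0" "q > 0" using k \<tau> by (auto simp: N_def L_def M_def q_def)
  interpret flat_orthogonal N "\<lambda>i j. hadamard n $$ (i, j)"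
    unfolding N_def by (rule hadamard_flat_orthogonal)
  interpret stack_registers M q by standard (use pos in auto)
  \<comment> \<open>Runs come in k consecutive groups of \<tau>. The \<open>mod\<close> first takes
    effect at t = q, where \<open>a q\<close> still has to be a unit vector.\<close>
  define blk where "blk t = (t div \<tau>) mod k" for t
  have blk: "blk t < k" for t using k by (simp add: blk_def)
  define a where "a t i = of_bool (i div L = blk t) / sqrt L" for t i
  have anorm: "(\<Sum>i<M. (a t i)\<^sup>2) = 1" for t
  proof -
    have "(\<Sum>i<M. (a t i)\<^sup>2) = (\<Sum>i<M. of_bool (i div L = blk t) * (\<lambda>_ _. 1 / L) (i div L) (i mod L))"
      by (intro sum.cong refl) (simp add: a_def power_divide)
    also have "\<dots> = (\<Sum>b<L. 1 / L)" unfolding M_def by (rule sum_block_kernel[OF blk pos(2)])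
    finally show ?thesis using pos by simp
  qed
  define K where "K = block_kernel L test_kernel"
  have Korth: "(\<Sum>l<M. K i l * K j l) = of_bool (i = j)" if "i < M" "j < M" for i j
    using test_kernel_orthogonal that unfolding K_def M_def L_def by (rule block_kernel_orthogonal)
  obtain U Us where U: "unitary_mat (2 * M * M ^ q) U" "\<forall>V\<in>set Us. unitary_mat (2 * M * M ^ q) V" "length Us = q"
    and fin: "\<And>z. z \<in> sign_cube M \<Longrightarrow> final_state M (M ^ q) U Us z
       = state (\<lambda>i b w. a q i * minus_amp b * stack_amp M (\<lambda>t r. \<Sum>i<M. K r i * (a t i * z $ i)) q w)"
  proof (rule repeated_test_circuit[of a K])
    show "(\<Sum>i<M. (a t i)\<^sup>2) = 1" for t by (rule anorm)
    show "(\<Sum>l<M. K i l * K j l) = of_bool (i = j)" if "i < M" "j < M" for i j by (rule Korth[OF that])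
  qed (rule that)
  define acc where "acc r \<longleftrightarrow> r mod L < N" for r
  define cnt where "cnt j = stack_count M (\<lambda>t. blk t = j) acc q" for j
  \<comment> \<open>The acceptance probability is at least 1/2 + e / 4 if F = -1 and at most 1/2 + e
    / 8 if F = 1. The threshold is the midpoint, at distance e / 16 per run from both.\<close>
  define \<theta> where "\<theta> = (1/2 + 3/16 * e) * real \<tau>"
  define vote where "vote j w = (if real (cnt j w) \<ge> \<theta> then - 1 else 1 :: real)" for j w
  define out where "out w = (\<Prod>j<k. vote j w)" for w
  have outs: "out w \<in> {-1, 1}" for w
  proof -
    have "(\<Prod>j<m. vote j w) \<in> {-1, 1}" for m by (induction m) (auto simp: vote_def)
    then show ?thesis unfolding out_def .
  qed
  have runs: "(\<Sum>s<q. of_bool (blk s = j)) = \<tau>" if "j < k" for j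
  proof -
    have "(\<Sum>s<q. of_bool (blk s = j) :: nat) = (\<Sum>x<k. \<Sum>b<\<tau>. of_bool (blk (x * \<tau> + b) = j))"
      unfolding q_def by (rule sum_lessThan_mult)
    also have "\<dots> = (\<Sum>x<k. \<Sum>b<\<tau>. of_bool (x = j))"
      by (intro sum.cong refl) (simp add: blk_def)
    also have "\<dots> = \<tau>" using that by (simp add: of_bool_def if_distrib if_distribR sum.delta cong: if_cong)
    finally show ?thesis .
  qed
  have main: "output_prob (final_state M (M ^ q) U Us z) (\<lambda>r. out (r mod M ^ q)) (the (xor_forr n k z)) \<ge> 2/3"
    if zdom: "z \<in> dom (xor_forr n k)" for z
  proof -
    have sizes: "2 * k * 2 ^ n = M" "2 * 2 ^ n = L" by (simp_all add: M_def L_def N_def)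
    have zc: "z \<in> sign_cube M" and zb: "\<And>j. j < k \<Longrightarrow> block L z j \<in> dom (forr_fun n k)"
      and xz: "xor_forr n k z = Some (\<Prod>j<k. the (forr_fun n k (block L z j)))"
      using zdom unfolding xor_forr_def sizes by (auto split: if_splits)
    define c where "c t r = (\<Sum>i<M. K r i * (a t i * z $ i))" for t r
    have idx: "j * L + i < M" if "j < k" "i < L" for i j
    proof -
      have "j * L + i < Suc j * L" using that by simp
      also have "\<dots> \<le> k * L" using that by (intro mult_right_mono) auto
      finally show ?thesis by (simp add: M_def)
    qed
    define p where "p j = 1/2 + forr n (block L z j) / 2" for j
    have camp: "c t r = of_bool (r div L = blk t) * (\<Sum>b<L. test_kernel (r mod L) b * (z $ (blk t * L + b) / sqrt L))" if "r < M" for t r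
      unfolding c_def K_def a_def M_def using that by (intro block_amplitude[OF blk]) (simp add: M_def)
    have sel: "(\<Sum>r<M. of_bool (acc r) * (c t r)\<^sup>2) = p (blk t)" "(\<Sum>r<M. (c t r)\<^sup>2) = 1" for t
    proof -
      define j where "j = blk t"
      have j: "j < k" using blk by (simp add: j_def)
      define y where "y b = z $ (j * L + b)" for b
      define T where "T r = (\<Sum>b<L. test_kernel r b * (y b / sqrt L))" for r
      have yy: "y i * y i = 1" if "i < L" for i unfolding y_def by (rule sign_cube_square[OF zc idx[OF j that]])
      have pf: "pair_form y / N = forr n (block L z j)"
      proof -
        have "pair_form y = pair_form (($) (block L z j))"
          unfolding pair_form_def y_def block_def L_def by (intro sum.cong refl) simp
        moreover have "forr n (block L z j) = sign_forr (block L z j)"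
          using forr_eq_sign_forr[of "block L z j" n] by (simp add: block_def L_def N_def)
        ultimately show ?thesis by (simp add: sign_forr_def)
      qed
      have hi: "(\<Sum>r<N. (T r)\<^sup>2) = p j"
        using test_kernel_prob(1)[of y] yy pf unfolding T_def L_def p_def by simp
      have lo: "(\<Sum>r<N. (T (N + r))\<^sup>2) = 1 - p j"
        using test_kernel_prob(2)[of y] yy pf unfolding T_def L_def p_def by simp
      have red: "(\<Sum>r<M. f (r mod L) * (c t r)\<^sup>2) = (\<Sum>b<L. f b * (T b)\<^sup>2)" for f :: "nat \<Rightarrow> real"
      proof -
        have "(\<Sum>r<M. f (r mod L) * (c t r)\<^sup>2) = (\<Sum>r<M. of_bool (r div L = j) * (\<lambda>_ b. f b * (T b)\<^sup>2) (r div L) (r mod L))"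
          by (intro sum.cong refl) (simp add: camp j_def[symmetric] T_def y_def power_mult_distrib)
        also have "\<dots> = (\<Sum>b<L. f b * (T b)\<^sup>2)" unfolding M_def by (rule sum_block_kernel[OF j pos(2)])
        finally show ?thesis .
      qed
      have "(\<Sum>r<M. of_bool (acc r) * (c t r)\<^sup>2) = (\<Sum>b<L. of_bool (b < N) * (T b)\<^sup>2)"
        unfolding acc_def by (rule red)
      also have "\<dots> = (\<Sum>r<N. (T r)\<^sup>2)" unfolding L_def sum_double by simp
      finally show "(\<Sum>r<M. of_bool (acc r) * (c t r)\<^sup>2) = p (blk t)" using hi by (simp add: j_def)
      show "(\<Sum>r<M. (c t r)\<^sup>2) = 1" using red[of "\<lambda>_. 1"] hi lo unfolding L_def sum_double by simp
    qed
    define S where "S = stack_amp M c q"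
    define bad where "bad j = {w. w < M ^ q \<and> vote j w \<noteq> the (forr_fun n k (block L z j))}" for j
    have badj: "(\<Sum>w\<in>bad j. (S w)\<^sup>2) \<le> exp (- real \<tau> * e\<^sup>2 / 256)" if j: "j < k" for j
    proof -
      have "block L z j \<in> dom (forr_fun n k)" by (rule zb[OF j])
      then consider "forr n (block L z j) \<ge> e / 2" "the (forr_fun n k (block L z j)) = -1"
        | "forr n (block L z j) \<le> e / 4" "the (forr_fun n k (block L z j)) = 1"
        by (auto simp: forr_fun_def e_def split: if_splits)
      then obtain s :: real where s: "s = 1 \<or> s = -1"
        "\<And>w. w \<in> bad j \<Longrightarrow> s * (real (cnt j w) - p j * real \<tau>) \<ge> e / 16 * real \<tau>"
      proof cases
        case 1
        have "- 1 * (real (cnt j w) - p j * real \<tau>) \<ge> e / 16 * real \<tau>" if "w \<in> bad j" for w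
        proof -
          have "real (cnt j w) < \<theta>" using that 1(2) by (auto simp: bad_def vote_def split: if_splits)
          moreover have "(1/2 + e / 4) * real \<tau> \<le> p j * real \<tau>" using 1(1) by (intro mult_right_mono) (auto simp: p_def)
          ultimately show ?thesis by (simp add: \<theta>_def algebra_simps)
        qed
        then show ?thesis by (intro that[of "- 1"]) auto
      next
        case 2
        have "1 * (real (cnt j w) - p j * real \<tau>) \<ge> e / 16 * real \<tau>" if "w \<in> bad j" for w
        proof -
          have "real (cnt j w) \<ge> \<theta>" using that 2(2) by (auto simp: bad_def vote_def split: if_splits)
          moreover have "p j * real \<tau> \<le> (1/2 + e / 8) * real \<tau>" using 2(1) by (intro mult_right_mono) (auto simp: p_def)
          ultimately show ?thesis by (simp add: \<theta>_def algebra_simps)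
        qed
        then show ?thesis by (intro that[of 1]) auto
      qed
      show ?thesis unfolding S_def
      proof (rule stack_count_tail[OF pos(3), where sel = "\<lambda>t. blk t = j" and acc = acc and p = "p j" and s = s])
        show "(\<Sum>r<M. (c t r)\<^sup>2) = 1" for t by (rule sel(2))
        show "(\<Sum>r<M. of_bool (acc r) * (c t r)\<^sup>2) = p j" if "blk t = j" for t using sel(1)[of t] that by simp
        show "w < M ^ q \<and> e / 16 * real \<tau> \<le> s * (real (stack_count M (\<lambda>t. blk t = j) acc q w) - p j * real \<tau>)" if "w \<in> bad j" for w
          using s(2)[OF that] that by (simp add: cnt_def bad_def)
      qed (use \<epsilon> s runs[OF j] in \<open>auto simp: e_def\<close>)
    qed
    define F where "F = (\<Prod>j<k. the (forr_fun n k (block L z j)))"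
    define G where "G = {w. w < M ^ q \<and> out w = F}"
    \<comment> \<open>If all votes are right then so is their product; hence every stack content
      outside G lies in some \<open>bad j\<close>.\<close>
    have pt: "(S w)\<^sup>2 \<le> of_bool (w \<in> G) * (S w)\<^sup>2 + (\<Sum>j<k. of_bool (w \<in> bad j) * (S w)\<^sup>2)" if w: "w < M ^ q" for w
    proof (cases "w \<in> G")
      case True
      have "0 \<le> (\<Sum>j<k. of_bool (w \<in> bad j) * (S w)\<^sup>2)" by (intro sum_nonneg) auto
      then show ?thesis using True by simp
    next
      case False
      have "\<exists>j<k. w \<in> bad j"
      proof (rule ccontr)
        assume "\<not> (\<exists>j<k. w \<in> bad j)"
        then have "vote j w = the (forr_fun n k (block L z j))" if "j < k" for j
          using that w by (auto simp: bad_def)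
        then have "out w = F" unfolding out_def F_def by (intro prod.cong) auto
        then show False using w False by (auto simp: G_def)
      qed
      then obtain j where j: "j < k" "w \<in> bad j" by blast
      have "(S w)\<^sup>2 = of_bool (w \<in> bad j) * (S w)\<^sup>2" using j by simp
      also have "\<dots> \<le> (\<Sum>j<k. of_bool (w \<in> bad j) * (S w)\<^sup>2)"
        using j by (intro member_le_sum[where f = "\<lambda>j. of_bool (w \<in> bad j) * (S w)\<^sup>2"]) auto
      finally show ?thesis using False by simp
    qed
    have ind: "(\<Sum>w<M ^ q. of_bool (w \<in> X) * (S w)\<^sup>2) = (\<Sum>w\<in>X. (S w)\<^sup>2)" if "X \<subseteq> {..<M ^ q}" for X
      using that by (intro sum.mono_neutral_cong_right) auto
    have "1 = (\<Sum>w<M ^ q. (S w)\<^sup>2)" unfolding S_def by (rule stack_amp_norm[OF pos(3) sel(2), symmetric])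
    also have "\<dots> \<le> (\<Sum>w<M ^ q. of_bool (w \<in> G) * (S w)\<^sup>2 + (\<Sum>j<k. of_bool (w \<in> bad j) * (S w)\<^sup>2))"
      by (intro sum_mono pt) simp
    also have "\<dots> = (\<Sum>w<M ^ q. of_bool (w \<in> G) * (S w)\<^sup>2) + (\<Sum>j<k. \<Sum>w<M ^ q. of_bool (w \<in> bad j) * (S w)\<^sup>2)"
      unfolding sum.distrib by (subst sum.swap) (rule refl)
    also have "\<dots> = (\<Sum>w\<in>G. (S w)\<^sup>2) + (\<Sum>j<k. \<Sum>w\<in>bad j. (S w)\<^sup>2)"
      by (intro arg_cong2[where f = "(+)"] sum.cong refl ind) (auto simp: G_def bad_def)
    finally have "1 \<le> (\<Sum>w\<in>G. (S w)\<^sup>2) + (\<Sum>j<k. \<Sum>w\<in>bad j. (S w)\<^sup>2)" .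
    also have "(\<Sum>j<k. \<Sum>w\<in>bad j. (S w)\<^sup>2) \<le> (\<Sum>j<k. exp (- real \<tau> * e\<^sup>2 / 256))" by (intro sum_mono badj) simp
    also have "\<dots> = real k * exp (- real \<tau> * e\<^sup>2 / 256)" by simp
    also have "\<dots> \<le> 1/3" using small unfolding e_def .
    finally have "2/3 \<le> (\<Sum>w\<in>G. (S w)\<^sup>2)" by simp
    also have "\<dots> = output_prob (final_state M (M ^ q) U Us z) (\<lambda>r. out (r mod M ^ q)) F"
      unfolding fin[OF zc] output_prob_state[OF anorm] G_def S_def c_def[abs_def] ..
    finally show ?thesis unfolding xz F_def by simp
  qed
  have "M = 2 * k * 2 ^ n" by (simp add: M_def L_def N_def)
  then show ?thesis unfolding bounded_error_quantum_computable_def q_def[symmetric]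
    using U main outs pos
    by (intro exI[of _ "M ^ q"] exI[of _ U] exI[of _ Us] exI[of _ "\<lambda>r. out (r mod M ^ q)"]) auto
qed

lemma forr_query_count:
  fixes n k :: nat
  assumes n: "n \<ge> 1" and k: "k \<ge> 1"
  shows "\<exists>q. real q \<le> 3000000 * real k ^ 5 * (log 2 (2 ^ n))\<^sup>2 * max 1 (log 2 (real k)) \<and>
    bounded_error_quantum_computable (2 * k * 2 ^ n) (xor_forr n k) q"
proof -
  define m where "m = max 1 (log 2 (real k))"
  define \<epsilon> where "\<epsilon> = forr_eps n k"
  \<comment> \<open>The least number of runs with
    \<open>exp (- \<tau> * \<epsilon>\<^sup>2 / 256) \<le> 1 / (3 * k)\<close>, as the union bound
    requires.\<close>
  define \<tau> where "\<tau> = nat \<lceil>256 * ln (3 * real k) / \<epsilon>\<^sup>2\<rceil>"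
  have m: "m \<ge> 1" "m \<ge> log 2 (real k)" by (auto simp: m_def)
  have ln2: "ln 2 \<le> (1::real)" "ln 2 \<ge> (1/2::real)" using ln_2_less_1 ln2_ge_two_thirds by auto
  have k1: "real k \<ge> 1" using k by simp
  define l where "l = ln ((2::real) ^ n)"
  have l: "l = real n * ln 2" by (simp add: l_def ln_realpow)
  have l0: "l \<ge> 1/2" "l \<le> real n"
  proof -
    have "1 * (1/2) \<le> real n * ln 2" using n ln2 by (intro mult_mono) auto
    then show "l \<ge> 1/2" by (simp add: l)
    have "real n * ln 2 \<le> real n * 1" using ln2 by (intro mult_left_mono) auto
    then show "l \<le> real n" by (simp add: l)
  qed
  have eps: "\<epsilon> = 1 / (60 * real k ^ 2 * l)" by (simp add: \<epsilon>_def forr_eps_def l_def)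
  have \<epsilon>0: "\<epsilon> > 0" unfolding eps using k1 l0 by simp
  have \<epsilon>8: "\<epsilon> \<le> 8"
  proof -
    have "60 * 1 * (1/2) \<le> 60 * real k ^ 2 * l" using k1 l0 by (intro mult_mono) auto
    then have "\<epsilon> \<le> 1 / (60 * 1 * (1/2))" unfolding eps by (intro divide_left_mono) auto
    then show ?thesis by simp
  qed
  have ln3k: "ln (3 * real k) > 0" using k1 by (intro ln_gt_zero) simp
  have \<tau>: "256 * ln (3 * real k) / \<epsilon>\<^sup>2 \<le> real \<tau>" unfolding \<tau>_def by linarith
  have "256 * ln (3 * real k) / \<epsilon>\<^sup>2 > 0" using ln3k \<epsilon>0 by simp
  then have \<tau>1: "\<tau> \<ge> 1" and \<tau>2: "real \<tau> \<le> 256 * ln (3 * real k) / \<epsilon>\<^sup>2 + 1" using \<tau> unfolding \<tau>_def by linarith+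
  have comp: "bounded_error_quantum_computable (2 * k * 2 ^ n) (xor_forr n k) (k * \<tau>)"
  proof (rule forr_quantum_upper_bound[OF k \<tau>1])
    have "256 * ln (3 * real k) \<le> real \<tau> * \<epsilon>\<^sup>2" using \<tau> \<epsilon>0 by (simp add: pos_divide_le_eq)
    then have "exp (- real \<tau> * \<epsilon>\<^sup>2 / 256) \<le> exp (- ln (3 * real k))" by simp
    also have "\<dots> = 1 / (3 * real k)" using k1 by (simp add: exp_minus inverse_eq_divide)
    finally have "real k * exp (- real \<tau> * \<epsilon>\<^sup>2 / 256) \<le> real k * (1 / (3 * real k))" by (intro mult_left_mono) auto
    then show "real k * exp (- real \<tau> * (forr_eps n k)\<^sup>2 / 256) \<le> 1/3" using k1 by (simp add: \<epsilon>_def)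
  qed (use \<epsilon>0 \<epsilon>8 in \<open>auto simp: \<epsilon>_def\<close>)
  have lnk: "ln (3 * real k) \<le> 3 * m"
  proof -
    have "ln (3 * real k) \<le> ln (2 * (2 * real k))" using k1 by (subst ln_le_cancel_iff) auto
    also have "\<dots> = ln 2 + ln (2 * real k)" using k1 by (intro ln_mult_pos) auto
    also have "ln (2 * real k) = ln 2 + ln (real k)" using k1 by (intro ln_mult_pos) auto
    also have "ln 2 + (ln 2 + ln (real k)) = 2 * ln 2 + ln (real k)" by simp
    also have "ln (real k) = log 2 (real k) * ln 2" by (simp add: log_def)
    also have "2 * ln 2 + log 2 (real k) * ln 2 \<le> 2 * 1 + log 2 (real k) * 1"
      using ln2 k1 by (intro add_mono mult_left_mono) auto
    also have "\<dots> \<le> 3 * m" using m by simp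
    finally show ?thesis .
  qed
  have "real (k * \<tau>) = real k * real \<tau>" by simp
  also have "\<dots> \<le> real k * (256 * (3 * m) * (3600 * real k ^ 4 * (real n)\<^sup>2) + 1)"
  proof (rule mult_left_mono)
    have "256 * ln (3 * real k) / \<epsilon>\<^sup>2 = 256 * ln (3 * real k) * (3600 * real k ^ 4 * l\<^sup>2)"
      by (simp add: eps power_divide power_mult_distrib flip: power_mult)
    also have "\<dots> \<le> 256 * (3 * m) * (3600 * real k ^ 4 * (real n)\<^sup>2)"
      using lnk l0 m ln3k by (intro mult_mono power_mono) auto
    finally show "real \<tau> \<le> 256 * (3 * m) * (3600 * real k ^ 4 * (real n)\<^sup>2) + 1" using \<tau>2 by linarith
  qed simp
  \<comment> \<open>The constant is 256 * 3 * 3600, where 3600 is the square of the 60 in the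
    threshold. Four of the five powers of k come from the inverse square of the threshold and one
    from the number of blocks; the term k from rounding up is absorbed below.\<close>
  also have "\<dots> = 2764800 * (real k ^ 5 * (real n)\<^sup>2 * m) + real k"
    by (simp add: algebra_simps power_numeral_reduce)
  finally have 1: "real (k * \<tau>) \<le> 2764800 * (real k ^ 5 * (real n)\<^sup>2 * m) + real k" .
  have 2: "real k \<le> real k ^ 5 * (real n)\<^sup>2 * m"
  proof -
    have "real k ^ 1 \<le> real k ^ 5" using k1 by (intro power_increasing) auto
    then have "real k * 1 * 1 \<le> real k ^ 5 * (real n)\<^sup>2 * m" using n m by (intro mult_mono) auto
    then show ?thesis by simp
  qed
  from 1 2 k1 have "real (k * \<tau>) \<le> 3000000 * (real k ^ 5 * (real n)\<^sup>2 * m)" by linarith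
  then have "real (k * \<tau>) \<le> 3000000 * real k ^ 5 * (log 2 (2 ^ n))\<^sup>2 * max 1 (log 2 (real k))"
    unfolding m_def[symmetric] by (simp add: log_nat_power mult.assoc)
  with comp show ?thesis by blast
qed

theorem theorem3p5:
  shows "\<exists>(C::real) (c::real) (m::nat). C > 0 \<and> c > 0 \<and>
    (\<forall>k :: nat \<Rightarrow> nat.
       (\<forall>n. k n \<ge> 1) \<and> (\<lambda>n. real (k n)) \<in> o(\<lambda>n. (2 ^ n) powr (1 / 50)) \<longrightarrow>
       (\<forall>\<^sub>F n in sequentially. \<exists>q :: nat.
          real q \<le> C * real (k n) ^ 5 * (log 2 (2 ^ n))\<^sup>2 * max 1 (log 2 (real (k n))) \<and>
          bounded_error_quantum_computable (2 * k n * 2 ^ n) (xor_forr n (k n)) q) \<and>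
       (\<forall>d :: nat \<Rightarrow> nat.
          (\<lambda>n. real (d n)) \<in> o(\<lambda>n. sqrt (2 ^ n) / (log 2 (2 ^ n)) ^ m) \<longrightarrow>
          (\<forall>\<^sub>F n in sequentially. \<forall>R \<in> randomized_dtrees (2 * k n * 2 ^ n) (d n).
             worst_case_success (xor_forr n (k n)) R \<le> 1 / 2 + exp (- c * real (k n)))))"
\<comment> \<open>The decay rate 1/32 comes from \<open>31/32 \<le> exp (- 1/32)\<close>. The
  exponent 0 records that the logarithm in the martingale bound is cancelled by the one in
  \<delta>.\<close>
proof (rule exI[of _ 3000000], rule exI[of _ "1/32"], rule exI[of _ 0], intro conjI allI impI; (elim conjE)?)
  fix k :: "nat \<Rightarrow> nat"
  assume k: "\<forall>n. k n \<ge> 1" "(\<lambda>n. real (k n)) \<in> o(\<lambda>n. (2 ^ n) powr (1 / 50))"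
  show "\<forall>\<^sub>F n in sequentially. \<exists>q :: nat.
      real q \<le> 3000000 * real (k n) ^ 5 * (log 2 (2 ^ n))\<^sup>2 * max 1 (log 2 (real (k n))) \<and>
      bounded_error_quantum_computable (2 * k n * 2 ^ n) (xor_forr n (k n)) q"
    using eventually_ge_at_top[of "1::nat"] by eventually_elim (use k forr_query_count in blast)
next
  fix k d :: "nat \<Rightarrow> nat"
  assume k: "\<forall>n. k n \<ge> 1" "(\<lambda>n. real (k n)) \<in> o(\<lambda>n. (2 ^ n) powr (1 / 50))"
  assume "(\<lambda>n. real (d n)) \<in> o(\<lambda>n. sqrt (2 ^ n) / (log 2 (2 ^ n)) ^ 0)"
  then show "\<forall>\<^sub>F n in sequentially. \<forall>R \<in> randomized_dtrees (2 * k n * 2 ^ n) (d n).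
      worst_case_success (xor_forr n (k n)) R \<le> 1 / 2 + exp (- (1/32) * real (k n))"
    using k by (intro xor_forr_lower_bound_eventually) auto
qed simp_all

end
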